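(* Let $G_0=\sum_{k=1}^{K_0}\tilde\alpha^0_k\delta_{\theta^0_k}\in\mathcal{E}_{K_0}$ and $K\ge K_0$. Let $\Pi$ be the prior on $\mathcal{O}_K$ induced by $G=\sum_{k=1}^K\tilde\alpha_k\delta_{\theta_k}$, with $\tilde\alpha\sim\Pi_\alpha$ on $\Delta^{K-1}$ and, independently, $\theta_1,\dots,\theta_K$ independently distributed according to $\Pi_\theta$ on $\Delta^{V-1}$. Assume: (P1) there is $c_0>0$ such that $\theta^0_{kv}\ge c_0$ for all $v\in\{1,\dots,V\}$ and $k\in\{1,\dots,K_0\}$; (P2) $\Pi_\alpha$ and $\Pi_\theta$ are regular, and their supports contain, respectively, the true parameter $\tilde\alpha^0$ (completed by $K-K_0$ zeros) and the true topics $\theta^0_1,\dots,\theta^0_{K_0}$. Let $X^1_{[N]},\dots,X^m_{[N]}$ be i.i.d. documents of length $N$ from $p^{\mathscr{L}}_{G_0,N}$, and let $\Pi(\cdot\mid X^1_{[N]},\dots,X^m_{[N]})$ be the posterior. Then: (a) (Density estimation) There exists a sufficiently large constant $C$ such that $$\Pi\left(G\in\mathcal{O}_K:\ d_H(p^{\mathscr{L}}_{G,N},p^{\mathscr{L}}_{G_0,N})\ge C\Big(\frac{\log(mN)}{m}\Big)^{1/2}\ \Big|\ X^1_{[N]},\dots,X^m_{[N]}\right)\to0$$ in $\bigotimes_{i=1}^\infty P^{\mathscr{L}}_{G_0,N}$-probability as $m\to\infty$. (b) (Exact-fitted setting) If $K=K_0$ and $N\ge\mathfrak{N}_1(G_0)$,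 there exists a sufficiently large constant $C$ depending on $G_0$ such that $$\Pi\left(G\in\mathcal{O}_{K_0}:\ W_1(G,G_0)\ge C\Big(\frac{\log(mN)}{m}\Big)^{1/2}\ \Big|\ X^1_{[N]},\dots,X^m_{[N]}\right)\to0$$ in $\bigotimes_{i=1}^\infty P^{\mathscr{L}}_{G_0,N}$-probability as $m\to\infty$. (c) (Over-fitted setting) If $K>K_0$ and $N\ge\mathfrak{N}_2(G_0,K)$, there exists a sufficiently large constant $C$ depending on $G_0$ and $K$ such that $$\Pi\left(G\in\mathcal{O}_K:\ W_2(G,G_0)\ge C\Big(\frac{\log(mN)}{m}\Big)^{1/4}\ \Big|\ X^1_{[N]},\dots,X^m_{[N]}\right)\to0$$ in $\bigotimes_{i=1}^\infty P^{\mathscr{L}}_{G_0,N}$-probability as $m\to\infty$.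
   Context: $\Delta^{D-1}$ is the set of probability vectors in $\mathbb{R}^D$. $\mathcal{E}_K$ is the set of discrete probability measures on $\Delta^{V-1}$ with exactly $K$ atoms, and $\mathcal{O}_K=\bigcup_{k=1}^K\mathcal{E}_k$. A concentration parameter $\overline{\alpha}>0$ is known and fixed. For $G=\sum_k\tilde\alpha_k\delta_{\theta_k}$, the LDA probability mass function on $\{1,\dots,V\}^N$ is $$p^{\mathscr{L}}_{G,N}(x)=\mathbb{E}_{q\sim\mathrm{Dir}_{\overline{\alpha}\tilde\alpha}}\prod_{j=1}^N\Big(\sum_kq_k\theta_{kx_j}\Big),$$ and $P^{\mathscr{L}}_{G,N}$ is the corresponding distribution. The posterior is $$\Pi(G\in B\mid X^1_{[N]},\dots,X^m_{[N]})=\frac{\int_B\prod_{i=1}^mp^{\mathscr{L}}_{G,N}(X^i_{[N]})\,d\Pi(G)}{\int\prod_{i=1}^mp^{\mathscr{L}}_{G,N}(X^i_{[N]})\,d\Pi(G)}$$ for Borel $B\subset\mathcal{O}_K$. A probability measure $P$ supported on $\Omega\subset\Delta^{D-1}$ is regular if for some constant $c=c(D)>0$, $\inf_{\eta^*\in\Omega}P(\{\eta\in\Omega:\|\eta-\eta^*\|<\epsilon\})\ge c\,\epsilon^{D-1}$ for all sufficiently small $\epsilon>0$. $d_H^2(p,p')=\frac12\sum_x(\sqrt{p(x)}-\sqrt{p'(x)})^2$ and $d_{TV}(p,p')=\frac12\sum_x|p(x)-p'(x)|$. $W_r$ ($r\ge1$) is the Wasserstein-$r$ distance: $W_r^r(\sum_i\tilde\alpha_i\delta_{\theta_i},\sum_j\tilde\alpha'_j\delta_{\theta'_j})=\inf_q\sum_{i,j}q_{ij}\|\theta_i-\theta'_j\|^r$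 over couplings $q$ of $\tilde\alpha,\tilde\alpha'$, with $\|\cdot\|$ Euclidean. $\mathfrak{N}_1(G_0)$ is the smallest $N$ such that there is $c>0$ (not depending on $G$) with $d_{TV}(p^{\mathscr{L}}_{G_0,N},p^{\mathscr{L}}_{G,N})\ge c\,W_1(G,G_0)$ for all $G\in\mathcal{E}_{K_0}$. For $K>K_0$, $\mathfrak{N}_2(G_0,K)$ is the smallest $N$ such that there is $c>0$ (not depending on $G$) with $d_{TV}(p^{\mathscr{L}}_{G_0,N},p^{\mathscr{L}}_{G,N})\ge c\,W_2^2(G,G_0)$ for all $G\in\mathcal{O}_K$. *)

theory Defs
  imports "HOL-Probability.Probability"
begin

definition prob_simplex :: "(real ^ 'd) set" where
  "prob_simplex = {\<eta>. (\<forall>i. 0 \<le> \<eta> $ i) \<and> (\<Sum>i\<in>UNIV. \<eta> $ i) = 1}"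

text \<open>A discrete probability measure is a pmf; its atoms are the points of \<^const>\<open>set_pmf\<close>.\<close>

definition exact_mixing :: "nat \<Rightarrow> (real ^ 'v) pmf set" where
  "exact_mixing k = {G. set_pmf G \<subseteq> prob_simplex \<and> finite (set_pmf G) \<and> card (set_pmf G) = k}"

definition over_mixing :: "nat \<Rightarrow> (real ^ 'v) pmf set" where
  "over_mixing K = (\<Union>k\<in>{1..K}. exact_mixing k)"

text \<open>\<open>mixing_measure w \<theta>\<close> is \<open>\<Sum>\<^sub>k w\<^sub>k \<delta>\<^bsub>\<theta>\<^sub>k\<^esub>\<close>, for nonnegative weights \<open>w\<close> with sum 1. Weights
  may vanish and atoms may coincide.\<close>

definition mixing_measure :: "('i \<Rightarrow> real) \<Rightarrow> ('i \<Rightarrow> 'a) \<Rightarrow> 'a pmf" where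
  "mixing_measure w \<theta> = map_pmf \<theta> (embed_pmf w)"

definition wasserstein :: "real \<Rightarrow> 'a::metric_space pmf \<Rightarrow> 'a pmf \<Rightarrow> real" where
  "wasserstein r G G' =
    (INF q\<in>{q. map_pmf fst q = G \<and> map_pmf snd q = G'}.
       measure_pmf.expectation q (\<lambda>(x, y). dist x y powr r)) powr (1 / r)"

text \<open>Borel sets of \<open>over_mixing K\<close>. All \<open>W\<^sub>r\<close> metrize the weak topology there, as the simplex is compact.\<close>

definition mixing_borel :: "nat \<Rightarrow> (real ^ 'v) pmf measure" where
  "mixing_borel K = sigma (over_mixing K)
     {U. openin (Metric_space.mtopology (over_mixing K) (wasserstein 1)) U}"

text \<open>The Dirichlet distribution on the simplex over a finite nonempty index set \<open>A\<close>, with positive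
  parameters \<open>a\<close>: its usual density with respect to Lebesgue measure in all coordinates but one, the
  remaining coordinate \<open>b\<close> being one minus their sum. The density is symmetric, so the choice
  of \<open>b\<close> does not matter. For a singleton \<open>A\<close> this is the point mass at 1.\<close>

definition dirichlet :: "'i set \<Rightarrow> ('i \<Rightarrow> real) \<Rightarrow> ('i \<Rightarrow> real) measure" where
  "dirichlet A a =
    (let b = (SOME b. b \<in> A); J = A - {b} in
      distr
        (density (PiM J (\<lambda>_. lborel))
          (\<lambda>y. ennreal
            (if (\<forall>k\<in>J. 0 < y k) \<and> (\<Sum>k\<in>J. y k) < 1
             then Gamma (\<Sum>k\<in>A. a k) / (\<Prod>k\<in>A. Gamma (a k))
                  * (\<Prod>k\<in>J. y k powr (a k - 1)) * (1 - (\<Sum>k\<in>J. y k)) powr (a b - 1)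
             else 0)))
        (PiM A (\<lambda>_. borel))
        (\<lambda>y. y(b := 1 - (\<Sum>k\<in>J. y k))))"

text \<open>Documents are lists of words, so that the length \<open>N\<close> is implicit in the argument \<open>xs\<close> of the
  mass function. The Dirichlet variable is indexed by the atoms of \<open>G\<close> themselves; their weights
  are positive.\<close>

definition lda_mass :: "real \<Rightarrow> (real ^ 'v) pmf \<Rightarrow> 'v list \<Rightarrow> real" where
  "lda_mass \<alpha> G xs =
    (\<integral>q. (\<Prod>x\<leftarrow>xs. \<Sum>\<theta>\<in>set_pmf G. q \<theta> * \<theta> $ x) \<partial>dirichlet (set_pmf G) (\<lambda>\<theta>. \<alpha> * pmf G \<theta>))"

definition documents :: "nat \<Rightarrow> 'v list set" where
  "documents N = {xs. length xs = N}"

definition lda_measure :: "real \<Rightarrow> (real ^ 'v) pmf \<Rightarrow> nat \<Rightarrow> 'v list measure" where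
  "lda_measure \<alpha> G N = point_measure (documents N) (\<lambda>xs. ennreal (lda_mass \<alpha> G xs))"

definition hellinger_dist :: "'a set \<Rightarrow> ('a \<Rightarrow> real) \<Rightarrow> ('a \<Rightarrow> real) \<Rightarrow> real" where
  "hellinger_dist A p p' = sqrt (1 / 2 * (\<Sum>x\<in>A. (sqrt (p x) - sqrt (p' x))\<^sup>2))"

definition tv_dist :: "'a set \<Rightarrow> ('a \<Rightarrow> real) \<Rightarrow> ('a \<Rightarrow> real) \<Rightarrow> real" where
  "tv_dist A p p' = 1 / 2 * (\<Sum>x\<in>A. \<bar>p x - p' x\<bar>)"

text \<open>The minimal document lengths are extended naturals: they are \<open>\<infinity>\<close> if no length qualifies.\<close>

definition min_length1 :: "real \<Rightarrow> (real ^ 'v::finite) pmf \<Rightarrow> enat" where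
  "min_length1 \<alpha> G0 =
    (INF N\<in>{N. 1 \<le> N \<and> (\<exists>c>0. \<forall>G\<in>exact_mixing (card (set_pmf G0)).
        c * wasserstein 1 G G0 \<le> tv_dist (documents N) (lda_mass \<alpha> G0) (lda_mass \<alpha> G))}. enat N)"

definition min_length2 :: "real \<Rightarrow> (real ^ 'v::finite) pmf \<Rightarrow> nat \<Rightarrow> enat" where
  "min_length2 \<alpha> G0 K =
    (INF N\<in>{N. 1 \<le> N \<and> (\<exists>c>0. \<forall>G\<in>over_mixing K.
        c * (wasserstein 2 G G0)\<^sup>2 \<le> tv_dist (documents N) (lda_mass \<alpha> G0) (lda_mass \<alpha> G))}. enat N)"

text \<open>A probability measure whose space is the simplex, not the ambient vector space.\<close>

definition simplex_prob :: "(real ^ 'd::finite) measure \<Rightarrow> bool" where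
  "simplex_prob P \<longleftrightarrow> prob_space P \<and> sets P = sets (restrict_space borel prob_simplex)"

definition msupport :: "'a::metric_space measure \<Rightarrow> 'a set" where
  "msupport P = {x \<in> space P. \<forall>\<epsilon>>0. 0 < measure P {y \<in> space P. dist y x < \<epsilon>}}"

text \<open>Regularity is stated for \<open>\<Omega>\<close> the topological support of \<open>P\<close>. This is no restriction: if the bound
  holds for some measurable \<open>\<Omega>\<close> of full measure, then \<open>\<Omega>\<close> is dense in the support and the bound
  extends to it.\<close>

definition regular_prior :: "(real ^ 'd::finite) measure \<Rightarrow> bool" where
  "regular_prior P \<longleftrightarrow>
    (\<exists>c>0. \<forall>\<^sub>F \<epsilon> in at_right 0.
       c * \<epsilon> ^ (CARD('d) - 1) \<le>
       (INF \<eta>'\<in>msupport P. measure P {\<eta> \<in> msupport P. norm (\<eta> - \<eta>') < \<epsilon>}))"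

definition mixing_prior ::
  "(real ^ 'k::finite) measure \<Rightarrow> (real ^ 'v::finite) measure \<Rightarrow> (real ^ 'v) pmf measure" where
  "mixing_prior Pa Pt =
    distr (Pa \<Otimes>\<^sub>M (\<Pi>\<^sub>M k\<in>(UNIV :: 'k set). Pt)) (mixing_borel CARD('k))
      (\<lambda>(a, \<theta>). mixing_measure (\<lambda>k. a $ k) \<theta>)"

definition posterior ::
  "real \<Rightarrow> (real ^ 'v) pmf measure \<Rightarrow> nat \<Rightarrow> (nat \<Rightarrow> 'v list) \<Rightarrow> (real ^ 'v) pmf set \<Rightarrow> real" where
  "posterior \<alpha> P m X B =
    (LINT G:B|P. (\<Prod>i<m. lda_mass \<alpha> G (X i))) / (LINT G|P. (\<Prod>i<m. lda_mass \<alpha> G (X i)))"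

definition vanishes_in_prob :: "'a measure \<Rightarrow> (nat \<Rightarrow> 'a \<Rightarrow> real) \<Rightarrow> bool" where
  "vanishes_in_prob M Y \<longleftrightarrow>
    (\<forall>\<epsilon>>0. (\<lambda>m. measure M {\<omega> \<in> space M. \<epsilon> < \<bar>Y m \<omega>\<bar>}) \<longlonglongrightarrow> 0)"

end

theory Submission
  imports Defs
begin

text \<open>The posterior probability of a set \<open>B\<close> is a ratio of integrals of the likelihood ratio
  \<open>\<Prod>\<^sub>i p\<^sub>G(X\<^sub>i) / p\<^sub>G\<^sub>0(X\<^sub>i)\<close>. Both integrals are bounded by powers of \<open>m\<close>, and the constant \<open>C\<close> is
  chosen so that the power in the numerator wins. It must serve every document length \<open>N\<close> at
  once, so both exponents have to depend on the dimension of the weights and topics only, and not on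
  the size \<open>V\<^sup>N\<close> of the sample space; \<open>N\<close> may enter through multiplicative constants.

  The denominator needs no probability. There are finitely many documents, and (P1) bounds the mass
  of each below by \<open>c\<^sub>0\<^sup>N\<close>. If \<open>p\<^sub>G\<close> is within a factor \<open>1 \<plusminus> 1/(2m)\<close> of \<open>p\<^sub>G\<^sub>0\<close> on every document,
  the likelihood ratio is at least \<open>1/2\<close> for every sample. As \<open>p\<^sub>G\<close> is Lipschitz in the parameters,
  such \<open>G\<close> fill a ball of radius of order \<open>1/m\<close> around the truth, and regularity (P2) gives it prior
  mass at least a constant times \<open>m\<^sup>-\<^sup>d\<close> (\<open>prior_mass_lda_ball\<close>).

  For the numerator, the mass functions at Hellinger distance at least \<open>r\<close> from \<open>p\<^sub>G\<^sub>0\<close> are covered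
  by polynomially many cells, using a grid on the parameters (\<open>lda_mass_grid_cover\<close>). On one cell the
  likelihood is dominated by that of a single slightly enlarged mass function \<open>u\<close>, and the
  expectation of \<open>\<Prod>\<^sub>i sqrt (u(X\<^sub>i) / p\<^sub>G\<^sub>0(X\<^sub>i))\<close> is the \<open>m\<close>-th power of a Hellinger affinity, about
  \<open>(1 - r\<^sup>2)\<^sup>m\<close>. Markov's inequality and a union bound show that with high probability every
  likelihood ratio at distance \<open>r\<close> is at most \<open>exp(-m r\<^sup>2)\<close> (\<open>likelihood_ratio_deviation\<close>), which
  is the power of \<open>mN\<close> with exponent \<open>- C\<^sup>2\<close> for \<open>r = C sqrt(log(mN)/m)\<close>. This gives (a).

  Parts (b) and (c) follow because \<open>d\<^sub>T\<^sub>V \<le> \<surd>2 d\<^sub>H\<close> turns a large transport distance into a large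
  Hellinger distance. Two points need care. The total variation distance increases with the
  document length, so the constant at the minimal length serves all longer documents
  (\<open>tv_dist_mono\<close>). In (b) the prior may charge mixing measures with fewer than \<open>K\<^sub>0\<close> atoms, for which
  the definition of the minimal length says nothing; the inequality extends to them because they are
  limits of measures with exactly \<open>K\<^sub>0\<close> atoms (\<open>tv_dist_bound_over_mixing\<close>).

  All of this rests on one description of \<open>p\<^sub>G\<close>. Computing the Dirichlet moments shows that the topics
  of the words of a document are drawn from a Polya urn (\<open>dirichlet_moment\<close>). Integrating the draws
  out one by one expresses \<open>p\<^sub>G\<close> through the moments of \<open>G\<close> (\<open>block_mass_Cons\<close>), so that \<open>p\<^sub>G\<close> depends
  continuously on \<open>G\<close> also where atoms merge or weights vanish (\<open>block_mass_diff\<close>).\<close>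

section \<open>Moments of the Dirichlet distribution\<close>

lemma nn_integral_Beta_scaled:
  fixes a b s :: real
  assumes "0 < a" "0 < b" "0 < s"
  shows "(\<integral>\<^sup>+t. ennreal (if 0 < t \<and> t < s then t powr (a - 1) * (s - t) powr (b - 1) else 0) \<partial>lborel)
    = ennreal (s powr (a + b - 1) * Beta a b)"
proof -
  have unit: "(\<integral>\<^sup>+t. ennreal (indicator {0<..<1} t * (t powr (a - 1) * (1 - t) powr (b - 1))) \<partial>lborel)
      = ennreal (Beta a b)"
  proof -
    have "((\<lambda>t. t powr (a - 1) * (1 - t) powr (b - 1)) has_integral Beta a b) {0<..<1::real}"
      using has_integral_Beta_real[OF assms(1,2)] by (simp add: has_integral_Icc_iff_Ioo)
    from nn_integral_has_integral_lebesgue[OF _ this] show ?thesis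
      by simp
  qed
  have "(\<integral>\<^sup>+t. ennreal (if 0 < t \<and> t < s then t powr (a - 1) * (s - t) powr (b - 1) else 0) \<partial>lborel)
      = s * (\<integral>\<^sup>+t. ennreal (if 0 < 0 + s * t \<and> 0 + s * t < s
            then (0 + s * t) powr (a - 1) * (s - (0 + s * t)) powr (b - 1) else 0) \<partial>lborel)"
    using assms by (subst nn_integral_real_affine[where c = s and t = 0]) auto
  also have "\<dots> = s * (\<integral>\<^sup>+t. ennreal (s powr (a + b - 2)) *
        ennreal (indicator {0<..<1} t * (t powr (a - 1) * (1 - t) powr (b - 1))) \<partial>lborel)"
  proof (intro arg_cong[where f = "\<lambda>x. ennreal s * x"] nn_integral_cong)
    fix t :: real
    show "ennreal (if 0 < 0 + s * t \<and> 0 + s * t < s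
            then (0 + s * t) powr (a - 1) * (s - (0 + s * t)) powr (b - 1) else 0)
        = ennreal (s powr (a + b - 2)) *
          ennreal (indicator {0<..<1} t * (t powr (a - 1) * (1 - t) powr (b - 1)))"
    proof (cases "0 < t \<and> t < 1")
      case True
      have "(s - s * t) powr (b - 1) = s powr (b - 1) * (1 - t) powr (b - 1)"
        using True assms by (subst powr_mult[symmetric]) (auto simp: algebra_simps)
      moreover have "(s * t) powr (a - 1) = s powr (a - 1) * t powr (a - 1)"
        using True assms by (subst powr_mult) auto
      moreover have "s powr (a + b - 2) = s powr (a - 1) * s powr (b - 1)"
        by (simp add: powr_add[symmetric])
      ultimately show ?thesis
        using True assms by (simp add: ennreal_mult'[symmetric] mult_ac)
    next
      case False
      then show ?thesis
        using assms by (auto simp: zero_less_mult_iff)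
    qed
  qed
  also have "\<dots> = ennreal (s * (s powr (a + b - 2) * Beta a b))"
  proof -
    have "(\<integral>\<^sup>+t. ennreal (s powr (a + b - 2)) *
        ennreal (indicator {0<..<1} t * (t powr (a - 1) * (1 - t) powr (b - 1))) \<partial>lborel)
        = ennreal (s powr (a + b - 2)) * ennreal (Beta a b)"
      by (subst nn_integral_cmult) (measurable, simp only: unit)
    then show ?thesis using assms by (simp only: ennreal_mult' less_imp_le powr_ge_zero)
  qed
  also have "s * (s powr (a + b - 2) * Beta a b) = s powr (a + b - 1) * Beta a b"
  proof -
    have "s powr (a + b - 1) = s powr 1 * s powr (a + b - 2)"
      by (subst powr_add[symmetric]) simp
    then show ?thesis using assms by simp
  qed
  finally show ?thesis .
qed

lemma measurable_dirichlet_kernel [measurable]: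
  fixes e :: "'i \<Rightarrow> real"
  assumes "finite J" "J \<subseteq> I"
  shows "(\<lambda>y. if (\<forall>k\<in>J. 0 < y k) \<and> (\<Sum>k\<in>J. y k) < s
            then (\<Prod>k\<in>J. y k powr e k) * (s - (\<Sum>k\<in>J. y k)) powr \<beta> else 0)
    \<in> borel_measurable (\<Pi>\<^sub>M k\<in>I. lborel)"
proof -
  have c[measurable]: "(\<lambda>y. y k :: real) \<in> borel_measurable (\<Pi>\<^sub>M k\<in>I. lborel)" if "k \<in> J" for k
    using measurable_component_singleton[of k I "\<lambda>_. lborel"] that assms(2) by auto
  have s[measurable]: "(\<lambda>y. \<Sum>k\<in>J. y k :: real) \<in> borel_measurable (\<Pi>\<^sub>M k\<in>I. lborel)"
    by (intro borel_measurable_sum c)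
  have p[measurable]: "(\<lambda>y. \<Prod>k\<in>J. y k powr e k) \<in> borel_measurable (\<Pi>\<^sub>M k\<in>I. lborel)"
    by (intro borel_measurable_prod powr_real_measurable c) auto
  have [measurable]: "Measurable.pred (\<Pi>\<^sub>M k\<in>I. lborel) (\<lambda>y. \<forall>k\<in>J. 0 < (y k :: real))"
    using assms(1) by (intro pred_intros_finite borel_measurable_pred_less c borel_measurable_const) auto
  show ?thesis
    by measurable
qed

text \<open>The Dirichlet normalising constant, by induction on the number of coordinates. Fixing one
  coordinate at \<open>t\<close> leaves the same integral over a simplex of size \<open>s - t\<close>, which is why the size
  \<open>s\<close> is a parameter; the remaining integral over \<open>t\<close> is a Beta integral.\<close>

lemma nn_integral_dirichlet_kernel:
  fixes c :: "'i \<Rightarrow> real"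
  assumes "finite J" "\<And>k. k \<in> J \<Longrightarrow> 0 < c k" "0 < \<beta>" "0 < s"
  shows "(\<integral>\<^sup>+y. ennreal (if (\<forall>k\<in>J. 0 < y k) \<and> (\<Sum>k\<in>J. y k) < s
            then (\<Prod>k\<in>J. y k powr (c k - 1)) * (s - (\<Sum>k\<in>J. y k)) powr (\<beta> - 1) else 0)
          \<partial>(\<Pi>\<^sub>M k\<in>J. lborel))
    = ennreal (s powr ((\<Sum>k\<in>J. c k) + \<beta> - 1)
        * ((\<Prod>k\<in>J. Gamma (c k)) * Gamma \<beta> / Gamma ((\<Sum>k\<in>J. c k) + \<beta>)))"
  using assms
proof (induction J arbitrary: s rule: finite_induct)
  case empty
  then show ?case
    by (auto simp: PiM_empty nn_integral_count_space_finite Gamma_eq_zero_iff)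
next
  case (insert i J)
  interpret product_sigma_finite "\<lambda>_::'i. lborel :: real measure"
    by standard
  have pos: "0 < c i" "\<And>k. k \<in> J \<Longrightarrow> 0 < c k" using insert.prems by auto
  define S where "S = (\<Sum>k\<in>J. c k) + \<beta>"
  define R where "R = (\<Prod>k\<in>J. Gamma (c k)) * Gamma \<beta> / Gamma S"
  have S: "0 < S" unfolding S_def using pos(2) insert.prems by (intro add_nonneg_pos sum_nonneg less_imp_le) auto
  have R: "0 \<le> R" unfolding R_def using pos(2) S insert.prems
    by (intro divide_nonneg_nonneg mult_nonneg_nonneg prod_nonneg ballI less_imp_le Gamma_real_pos) auto
  let ?g = "\<lambda>s y. if (\<forall>k\<in>J. 0 < y k) \<and> (\<Sum>k\<in>J. y k) < s
            then (\<Prod>k\<in>J. y k powr (c k - 1)) * (s - (\<Sum>k\<in>J. y k)) powr (\<beta> - 1) else 0"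
  let ?f = "\<lambda>y. if (\<forall>k\<in>insert i J. 0 < y k) \<and> (\<Sum>k\<in>insert i J. y k) < s
            then (\<Prod>k\<in>insert i J. y k powr (c k - 1)) * (s - (\<Sum>k\<in>insert i J. y k)) powr (\<beta> - 1) else 0"
  have f[measurable]: "?f \<in> borel_measurable (\<Pi>\<^sub>M k\<in>insert i J. lborel)"
    using insert.hyps(1) by (intro measurable_dirichlet_kernel) auto
  have g[measurable]: "?g u \<in> borel_measurable (\<Pi>\<^sub>M k\<in>J. lborel)" for u
    using insert.hyps(1) by (intro measurable_dirichlet_kernel) auto
  have step: "?f (y(i := t)) = (if 0 < t \<and> t < s then t powr (c i - 1) * ?g (s - t) y else 0)" for y t
  proof -
    have eqs: "(\<Sum>k\<in>J. (y(i := t)) k) = (\<Sum>k\<in>J. y k)"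
      "(\<Prod>k\<in>J. (y(i := t)) k powr (c k - 1)) = (\<Prod>k\<in>J. y k powr (c k - 1))"
      "(\<forall>k\<in>insert i J. 0 < (y(i := t)) k) \<longleftrightarrow> 0 < t \<and> (\<forall>k\<in>J. 0 < y k)"
      using insert.hyps by (auto intro!: sum.cong prod.cong)
    have "0 \<le> (\<Sum>k\<in>J. y k)" if "\<forall>k\<in>J. 0 < y k"
      using that by (intro sum_nonneg) (auto intro: less_imp_le)
    then show ?thesis
      unfolding sum.insert[OF insert.hyps] prod.insert[OF insert.hyps] eqs fun_upd_same
      by (cases "\<forall>k\<in>J. 0 < y k") (auto simp: mult.assoc diff_diff_eq)
  qed
  have "(\<integral>\<^sup>+y. ennreal (?f y) \<partial>(\<Pi>\<^sub>M k\<in>insert i J. lborel))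
      = (\<integral>\<^sup>+t. (\<integral>\<^sup>+y. ennreal (?f (y(i := t))) \<partial>(\<Pi>\<^sub>M k\<in>J. lborel)) \<partial>lborel)"
    by (intro product_nn_integral_insert_rev insert.hyps) measurable
  also have "\<dots> = (\<integral>\<^sup>+t. ennreal R * ennreal (if 0 < t \<and> t < s then t powr (c i - 1) * (s - t) powr (S - 1) else 0) \<partial>lborel)"
  proof (rule nn_integral_cong)
    fix t :: real
    show "(\<integral>\<^sup>+y. ennreal (?f (y(i := t))) \<partial>(\<Pi>\<^sub>M k\<in>J. lborel))
      = ennreal R * ennreal (if 0 < t \<and> t < s then t powr (c i - 1) * (s - t) powr (S - 1) else 0)"
    proof (cases "0 < t \<and> t < s")
      case True
      have "(\<integral>\<^sup>+y. ennreal (?f (y(i := t))) \<partial>(\<Pi>\<^sub>M k\<in>J. lborel))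
          = (\<integral>\<^sup>+y. ennreal (t powr (c i - 1)) * ennreal (?g (s - t) y) \<partial>(\<Pi>\<^sub>M k\<in>J. lborel))"
        using True by (intro nn_integral_cong, subst step) (simp add: ennreal_mult' del: fun_upd_apply)
      also have "\<dots> = ennreal (t powr (c i - 1)) * ennreal ((s - t) powr (S - 1) * R)"
      proof -
        have "(\<integral>\<^sup>+y. ennreal (?g (s - t) y) \<partial>(\<Pi>\<^sub>M k\<in>J. lborel)) = ennreal ((s - t) powr (S - 1) * R)"
          unfolding S_def R_def by (rule insert.IH) (use True pos insert.prems in auto)
        then show ?thesis
          by (simp only: nn_integral_cmult[OF measurable_compose[OF g measurable_ennreal]])
      qed
      finally show ?thesis using True R by (simp add: ennreal_mult'[symmetric] mult_ac)
    next
      case False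
      show ?thesis unfolding step if_not_P[OF False] by simp
    qed
  qed
  also have "\<dots> = ennreal (R * (s powr (c i + S - 1) * Beta (c i) S))"
    using R pos S insert.prems
    by (subst nn_integral_cmult) (auto simp: nn_integral_Beta_scaled ennreal_mult')
  also have "R * (s powr (c i + S - 1) * Beta (c i) S) = s powr ((\<Sum>k\<in>insert i J. c k) + \<beta> - 1)
        * ((\<Prod>k\<in>insert i J. Gamma (c k)) * Gamma \<beta> / Gamma ((\<Sum>k\<in>insert i J. c k) + \<beta>))"
  proof -
    have "Gamma S \<noteq> 0" using Gamma_real_pos[OF S] by (metis less_irrefl)
    then show ?thesis using insert.hyps by (simp add: R_def S_def Beta_def field_simps)
  qed
  finally show ?case .
qed

text \<open>The probability of drawing the colours \<open>z\<close> from a Polya urn with initial weights \<open>a\<close> of total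
  \<open>s\<close>, where each drawn colour is returned with one more of its kind. The head of
  the list is the most recent draw.\<close>

fun urn :: "('i \<Rightarrow> real) \<Rightarrow> real \<Rightarrow> 'i list \<Rightarrow> real" where
  "urn a s [] = 1"
| "urn a s (k # z) = (a k + real (count_list z k)) / (s + real (length z)) * urn a s z"

lemma urn_nonneg:
  assumes "\<And>k. k \<in> set z \<Longrightarrow> 0 \<le> a k" "0 \<le> s"
  shows "0 \<le> urn a s z"
  using assms by (induction z) auto

lemma urn_conv_Gamma:
  assumes "finite A" "A \<noteq> {}" "\<And>k. k \<in> A \<Longrightarrow> 0 < a k" "set z \<subseteq> A"
  shows "urn a (sum a A) z = Gamma (sum a A) / (\<Prod>k\<in>A. Gamma (a k))
    * ((\<Prod>k\<in>A. Gamma (a k + real (count_list z k))) / Gamma (sum a A + real (length z)))"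
  using assms(4)
proof (induction z)
  case Nil
  have "Gamma (sum a A) \<noteq> 0" using Gamma_real_pos[OF sum_pos[OF assms(1,2)]] assms(3) by (metis less_irrefl)
  moreover have "(\<Prod>k\<in>A. Gamma (a k)) \<noteq> 0"
    using prod_pos[of A "\<lambda>k. Gamma (a k)"] Gamma_real_pos[OF assms(3)] by (metis less_irrefl)
  ultimately show ?case by simp
next
  case (Cons k z)
  have k: "k \<in> A" using Cons.prems by simp
  have s: "0 < sum a A" using assms by (intro sum_pos) auto
  have 1: "Gamma (sum a A + real (length (k # z)))
      = (sum a A + real (length z)) * Gamma (sum a A + real (length z))"
  proof -
    have "0 < sum a A + real (length z)" using s by simp
    then have "sum a A + real (length z) \<notin> \<int>\<^sub>\<le>\<^sub>0" by (metis nonpos_Ints_nonpos not_le)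
    from Gamma_plus1[OF this] show ?thesis by (simp add: add_ac)
  qed
  have 2: "(\<Prod>j\<in>A. Gamma (a j + real (count_list (k # z) j)))
      = (a k + real (count_list z k)) * (\<Prod>j\<in>A. Gamma (a j + real (count_list z j)))"
  proof -
    have "0 < a k + real (count_list z k)" using assms(3)[OF k] by simp
    then have "a k + real (count_list z k) \<notin> \<int>\<^sub>\<le>\<^sub>0" by (metis nonpos_Ints_nonpos not_le)
    from Gamma_plus1[OF this]
    have "Gamma (a k + real (count_list (k # z) k))
        = (a k + real (count_list z k)) * Gamma (a k + real (count_list z k))"
      by (simp add: add_ac)
    moreover have "(\<Prod>j\<in>A - {k}. Gamma (a j + real (count_list (k # z) j)))
        = (\<Prod>j\<in>A - {k}. Gamma (a j + real (count_list z j)))"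
      by (intro prod.cong) auto
    ultimately show ?thesis
      unfolding prod.remove[OF assms(1) k] by (simp only: mult.assoc)
  qed
  show ?case
    using Cons s unfolding 1 2 by (simp add: mult_ac)
qed

lemma prod_list_count:
  assumes "finite A" "set z \<subseteq> A"
  shows "(\<Prod>k\<leftarrow>z. q k :: real) = (\<Prod>k\<in>A. q k ^ count_list z k)"
  using assms(2)
proof (induction z)
  case (Cons k z)
  then have k: "k \<in> A" by simp
  have "(\<Prod>j\<in>A - {k}. q j ^ count_list (k # z) j) = (\<Prod>j\<in>A - {k}. q j ^ count_list z j)"
    by (intro prod.cong) auto
  with Cons show ?case
    unfolding prod.remove[OF assms(1) k] by simp
qed simp

text \<open>Multiplying the Dirichlet density by a monomial gives an unnormalised Dirichlet density with
  larger parameters, so a moment is a quotient of two normalising constants. By \<open>urn_conv_Gamma\<close>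
  that quotient is an urn probability.\<close>

lemma dirichlet_moment:
  assumes A: "finite A" "A \<noteq> {}" and a: "\<And>k. k \<in> A \<Longrightarrow> 0 < a k" and z: "set z \<subseteq> A"
  shows "has_bochner_integral (dirichlet A a) (\<lambda>q. \<Prod>k\<leftarrow>z. q k) (urn a (sum a A) z)"
proof -
  define b where "b = (SOME b. b \<in> A)"
  define J where "J = A - {b}"
  have b: "b \<in> A" unfolding b_def using A(2) by (simp add: some_in_eq)
  have J: "finite J" "b \<notin> J" "A = insert b J" using A b by (auto simp: J_def)
  define C where "C = Gamma (sum a A) / (\<Prod>k\<in>A. Gamma (a k))"
  have C: "0 \<le> C" unfolding C_def using A a
    by (intro divide_nonneg_nonneg prod_nonneg less_imp_le[OF Gamma_real_pos] ballI sum_pos) auto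
  define dens where "dens = (\<lambda>y. if (\<forall>k\<in>J. 0 < y k) \<and> (\<Sum>k\<in>J. y k) < 1
             then C * (\<Prod>k\<in>J. y k powr (a k - 1)) * (1 - (\<Sum>k\<in>J. y k)) powr (a b - 1) else 0)"
  define h where "h = (\<lambda>y::'a \<Rightarrow> real. y(b := 1 - (\<Sum>k\<in>J. y k)))"
  let ?M = "\<Pi>\<^sub>M k\<in>J. (lborel :: real measure)"
  have dir: "dirichlet A a = distr (density ?M (\<lambda>y. ennreal (dens y))) (\<Pi>\<^sub>M k\<in>A. borel) h"
    unfolding dirichlet_def Let_def dens_def h_def C_def J_def b_def ..
  have [measurable]: "dens \<in> borel_measurable ?M"
  proof -
    have "dens = (\<lambda>y. C * (if (\<forall>k\<in>J. 0 < y k) \<and> (\<Sum>k\<in>J. y k) < 1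
             then (\<Prod>k\<in>J. y k powr (a k - 1)) * (1 - (\<Sum>k\<in>J. y k)) powr (a b - 1) else 0))"
      by (auto simp: dens_def fun_eq_iff)
    then show ?thesis
      using J(1) by (simp only:) (intro borel_measurable_times borel_measurable_const measurable_dirichlet_kernel subset_refl)
  qed
  have h[measurable]: "h \<in> ?M \<rightarrow>\<^sub>M (\<Pi>\<^sub>M k\<in>A. borel)"
  proof -
    have "(\<lambda>y. \<Sum>k\<in>J. y k) \<in> borel_measurable ?M"
      by (intro borel_measurable_sum) measurable
    then show ?thesis
      unfolding h_def J(3)
      by (intro measurable_fun_upd[where J = J]) auto
  qed
  have [measurable]: "(\<lambda>q. \<Prod>k\<leftarrow>z. q k :: real) \<in> borel_measurable (\<Pi>\<^sub>M k\<in>A. borel)"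
    unfolding prod_list_count[OF A(1) z] using A(1) by measurable
  define n where "n = count_list z"
  \<comment> \<open>The parameters after absorbing the monomial.\<close>
  define c where "c k = a k + real (n k)" for k
  have c: "0 < c k" if "k \<in> A" for k using a[OF that] by (simp add: c_def)
  let ?ker = "\<lambda>y. if (\<forall>k\<in>J. 0 < y k) \<and> (\<Sum>k\<in>J. y k) < 1
            then (\<Prod>k\<in>J. y k powr (c k - 1)) * (1 - (\<Sum>k\<in>J. y k)) powr (c b - 1) else 0"
  have eq: "dens y * (\<Prod>k\<leftarrow>z. h y k) = C * ?ker y" for y
  proof (cases "(\<forall>k\<in>J. 0 < y k) \<and> (\<Sum>k\<in>J. y k) < 1")
    case True
    have p: "x powr (a k - 1) * x ^ n k = x powr (c k - 1)" if "0 < x" for x k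
      using that by (simp add: c_def powr_realpow[symmetric] powr_add[symmetric] algebra_simps)
    have "(\<Prod>k\<leftarrow>z. h y k) = (\<Prod>k\<in>insert b J. h y k ^ n k)"
      unfolding n_def using A(1) z J(3) by (subst prod_list_count[of A]) auto
    also have "\<dots> = (1 - (\<Sum>k\<in>J. y k)) ^ n b * (\<Prod>k\<in>J. y k ^ n k)"
    proof -
      have "(\<Prod>k\<in>J. h y k ^ n k) = (\<Prod>k\<in>J. y k ^ n k)"
        using J(2) by (intro prod.cong) (auto simp: h_def)
      then show ?thesis using J(1,2) by (simp add: h_def)
    qed
    finally have "dens y * (\<Prod>k\<leftarrow>z. h y k) = C * ((\<Prod>k\<in>J. y k powr (a k - 1) * y k ^ n k)
        * ((1 - (\<Sum>k\<in>J. y k)) powr (a b - 1) * (1 - (\<Sum>k\<in>J. y k)) ^ n b))"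
      using True by (simp add: dens_def prod.distrib)
    also have "\<dots> = C * ?ker y"
      using True by (simp add: p)
    finally show ?thesis .
  next
    case False
    then have "dens y = 0" "?ker y = 0" unfolding dens_def by (auto simp only: if_False)
    then show ?thesis by simp
  qed
  have ker_nonneg: "0 \<le> ?ker y" for y
    by (auto intro!: mult_nonneg_nonneg prod_nonneg)
  have ker[measurable]: "?ker \<in> borel_measurable ?M"
    using J(1) by (intro measurable_dirichlet_kernel) auto
  have sum_n: "(\<Sum>k\<in>A. real (n k)) = real (length z)"
  proof -
    have "(\<Sum>k\<in>A. n k) = (\<Sum>k\<in>set z. n k)"
      using A(1) z by (intro sum.mono_neutral_right) (auto simp: n_def count_list_0_iff)
    then show ?thesis
      by (simp add: n_def sum_count_set flip: of_nat_sum)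
  qed
  have sum_c: "(\<Sum>k\<in>J. c k) + c b = sum a A + real (length z)"
    using J sum_n by (simp add: c_def sum.distrib)
  have "(\<integral>\<^sup>+y. ennreal (dens y * (\<Prod>k\<leftarrow>z. h y k)) \<partial>?M) = (\<integral>\<^sup>+y. ennreal C * ennreal (?ker y) \<partial>?M)"
    unfolding eq using C by (simp only: ennreal_mult')
  also have "\<dots> = ennreal C * (\<integral>\<^sup>+y. ennreal (?ker y) \<partial>?M)"
    by (intro nn_integral_cmult) measurable
  also have "\<dots> = ennreal (C * ((\<Prod>k\<in>J. Gamma (c k)) * Gamma (c b) / Gamma (sum a A + real (length z))))"
    using nn_integral_dirichlet_kernel[OF J(1), of c "c b" 1] c b J(3) C
    unfolding sum_c by (simp add: ennreal_mult' times_divide_eq_right[symmetric] del: times_divide_eq_right)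
  also have "C * ((\<Prod>k\<in>J. Gamma (c k)) * Gamma (c b) / Gamma (sum a A + real (length z)))
      = urn a (sum a A) z"
  proof -
    have "(\<Prod>k\<in>A. Gamma (c k)) = Gamma (c b) * (\<Prod>k\<in>J. Gamma (c k))"
      unfolding J(3) using J(1,2) by simp
    with urn_conv_Gamma[OF A a z] show ?thesis
      by (simp add: C_def c_def n_def mult_ac)
  qed
  finally have int: "(\<integral>\<^sup>+y. ennreal (dens y * (\<Prod>k\<leftarrow>z. h y k)) \<partial>?M) = ennreal (urn a (sum a A) z)" .
  have urn_nonneg: "0 \<le> urn a (sum a A) z"
    using A a z by (intro urn_nonneg sum_nonneg) (auto intro: less_imp_le)
  have "has_bochner_integral ?M (\<lambda>y. dens y *\<^sub>R (\<Prod>k\<leftarrow>z. h y k)) (urn a (sum a A) z)"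
    unfolding real_scaleR_def eq
    by (rule has_bochner_integral_nn_integral[OF borel_measurable_times[OF borel_measurable_const ker]
          AE_I2[OF mult_nonneg_nonneg[OF C ker_nonneg]] urn_nonneg int[unfolded eq]])
  moreover have "0 \<le> dens y" for y
    unfolding dens_def using C by (auto intro!: mult_nonneg_nonneg prod_nonneg)
  ultimately have "has_bochner_integral (density ?M dens) (\<lambda>y. \<Prod>k\<leftarrow>z. h y k) (urn a (sum a A) z)"
    by (intro has_bochner_integral_density) auto
  then show ?thesis
    unfolding dir by (intro has_bochner_integral_distr) auto
qed

section \<open>The mass function of a document\<close>

definition words :: "'i set \<Rightarrow> nat \<Rightarrow> 'i list set" where
  "words A n = {z. set z \<subseteq> A \<and> length z = n}"

lemma finite_words: "finite A \<Longrightarrow> finite (words A n)"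
  unfolding words_def by (rule finite_lists_length_eq)

lemma documents_eq_words: "documents n = words UNIV n"
  by (simp add: documents_def words_def)

lemma words_0: "words A 0 = {[]}"
  by (auto simp: words_def)

lemma sum_words_Suc: "(\<Sum>z\<in>words A (Suc n). f z) = (\<Sum>k\<in>A. \<Sum>z\<in>words A n. f (k # z))"
proof -
  have "words A (Suc n) = (\<lambda>(k, z). k # z) ` (A \<times> words A n)"
    by (force simp: words_def length_Suc_conv image_iff)
  moreover have "inj_on (\<lambda>(k, z). k # z) (A \<times> words A n)"
    by (auto simp: inj_on_def)
  ultimately show ?thesis
    by (simp add: sum.reindex sum.cartesian_product case_prod_unfold)
qed

lemma prod_list_sum_expand:
  fixes g :: "'i \<Rightarrow> 'x \<Rightarrow> real"
  shows "(\<Prod>x\<leftarrow>xs. \<Sum>k\<in>A. g k x) = (\<Sum>z\<in>words A (length xs). \<Prod>i<length xs. g (z ! i) (xs ! i))"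
proof (induction xs)
  case Nil
  then show ?case by (simp add: words_0)
next
  case (Cons x xs)
  have "(\<Prod>x\<leftarrow>x # xs. \<Sum>k\<in>A. g k x)
      = (\<Sum>k\<in>A. \<Sum>z\<in>words A (length xs). g k x * (\<Prod>i<length xs. g (z ! i) (xs ! i)))"
    using Cons by (simp only: list.map prod_list.Cons sum_product)
  then show ?case
    by (simp add: sum_words_Suc prod.lessThan_Suc_shift del: prod.lessThan_Suc)
qed

lemma sum_add_count_list:
  fixes a g :: "'i \<Rightarrow> real"
  assumes "finite A" "set z \<subseteq> A"
  shows "(\<Sum>k\<in>A. (a k + real (count_list z k)) * g k) = (\<Sum>k\<in>A. a k * g k) + (\<Sum>i<length z. g (z ! i))"
proof -
  have "(\<Sum>k\<in>A. real (count_list z k) * g k) = (\<Sum>i<length z. g (z ! i))"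
    using assms(2)
  proof (induction z)
    case (Cons x z)
    have "(\<Sum>k\<in>A. real (count_list (x # z) k) * g k) = (\<Sum>k\<in>A. real (count_list z k) * g k + (if k = x then g k else 0))"
      by (intro sum.cong) (auto simp: algebra_simps)
    also have "\<dots> = (\<Sum>i<length z. g (z ! i)) + g x"
      using Cons assms(1) by (simp add: sum.distrib)
    finally show ?case by (simp add: sum.lessThan_Suc_shift del: sum.lessThan_Suc)
  qed simp
  then show ?thesis by (simp add: distrib_right sum.distrib)
qed

text \<open>Summing out the newest draw. Marginalising a document over one word comes down to this.\<close>

lemma sum_urn_Cons:
  assumes "finite A" "set z \<subseteq> A" "sum a A = s" "0 < s"
  shows "(\<Sum>k\<in>A. urn a s (k # z)) = urn a s z"
proof -
  have "(\<Sum>k\<in>A. a k + real (count_list z k)) = s + real (length z)"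
    using sum_add_count_list[OF assms(1,2), of a "\<lambda>_. 1"] assms(3) by simp
  moreover have "0 < s + real (length z)" using assms(4) by simp
  ultimately show ?thesis
    by (simp flip: sum_distrib_right sum_divide_distrib)
qed

lemma sum_urn_words:
  assumes "finite A" "sum a A = s" "0 < s"
  shows "(\<Sum>z\<in>words A n. urn a s z) = 1"
proof (induction n)
  case 0
  then show ?case by (simp add: words_0)
next
  case (Suc n)
  have "(\<Sum>z\<in>words A (Suc n). urn a s z) = (\<Sum>z\<in>words A n. \<Sum>k\<in>A. urn a s (k # z))"
    unfolding sum_words_Suc by (rule sum.swap)
  also have "\<dots> = (\<Sum>z\<in>words A n. urn a s z)"
    by (intro sum.cong refl sum_urn_Cons assms) (auto simp: words_def)
  finally show ?case using Suc by simp
qed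

definition topic_mixing :: "(real ^ 'v) pmf \<Rightarrow> bool" where
  "topic_mixing G \<longleftrightarrow> set_pmf G \<subseteq> prob_simplex \<and> finite (set_pmf G)"

lemma over_mixing_topic: "G \<in> over_mixing K \<Longrightarrow> topic_mixing G"
  by (auto simp: over_mixing_def exact_mixing_def topic_mixing_def)

lemma exact_mixing_topic: "G \<in> exact_mixing K \<Longrightarrow> topic_mixing G"
  by (auto simp: exact_mixing_def topic_mixing_def)

text \<open>A block is a list of words that share one topic draw \<open>\<theta>\<close>; its value is their joint
  probability given that draw.\<close>

definition block :: "'v list \<Rightarrow> real ^ 'v \<Rightarrow> real" where
  "block b \<theta> = (\<Prod>v\<leftarrow>b. \<theta> $ v)"

lemma block_append: "block (b @ c) \<theta> = block b \<theta> * block c \<theta>"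
  by (simp add: block_def)

lemma block_singleton: "block [v] \<theta> = \<theta> $ v"
  by (simp add: block_def)

lemma simplex_coord:
  fixes \<theta> :: "real ^ 'v::finite"
  assumes "\<theta> \<in> prob_simplex"
  shows "0 \<le> \<theta> $ v" "\<theta> $ v \<le> 1"
proof -
  show *: "0 \<le> \<theta> $ v" for v using assms by (simp add: prob_simplex_def)
  have "\<theta> $ v \<le> (\<Sum>i\<in>UNIV. \<theta> $ i)" by (rule member_le_sum) (use * in auto)
  then show "\<theta> $ v \<le> 1" using assms by (simp add: prob_simplex_def)
qed

lemma block_bounds:
  fixes \<theta> :: "real ^ 'v::finite"
  assumes "\<theta> \<in> prob_simplex"
  shows "0 \<le> block b \<theta>" "block b \<theta> \<le> 1"
proof -
  have "0 \<le> block b \<theta> \<and> block b \<theta> \<le> 1"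
    by (induction b) (auto simp: block_def simplex_coord[OF assms] intro: mult_le_one)
  then show "0 \<le> block b \<theta>" "block b \<theta> \<le> 1" by auto
qed

lemma block_diff:
  fixes \<theta> \<theta>' :: "real ^ 'v::finite"
  assumes "\<theta> \<in> prob_simplex" "\<theta>' \<in> prob_simplex" "\<And>v. \<bar>\<theta> $ v - \<theta>' $ v\<bar> \<le> d"
  shows "\<bar>block b \<theta> - block b \<theta>'\<bar> \<le> real (length b) * d"
proof (induction b)
  case Nil
  then show ?case by (simp add: block_def)
next
  case (Cons v b)
  have "block (v # b) \<theta> - block (v # b) \<theta>'
      = \<theta> $ v * (block b \<theta> - block b \<theta>') + (\<theta> $ v - \<theta>' $ v) * block b \<theta>'"
    by (simp add: block_def algebra_simps)
  also have "\<bar>\<dots>\<bar> \<le> \<bar>\<theta> $ v\<bar> * \<bar>block b \<theta> - block b \<theta>'\<bar> + \<bar>\<theta> $ v - \<theta>' $ v\<bar> * \<bar>block b \<theta>'\<bar>"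
    by (metis abs_mult abs_triangle_ineq)
  also have "\<dots> \<le> 1 * (real (length b) * d) + d * 1"
    using simplex_coord[OF assms(1), of v] block_bounds[OF assms(2), of b] Cons assms(3)[of v]
    by (intro add_mono mult_mono) auto
  finally show ?case by (simp add: algebra_simps)
qed

definition block_moment :: "(real ^ 'v) pmf \<Rightarrow> 'v list \<Rightarrow> real" where
  "block_moment G b = measure_pmf.expectation G (block b)"

text \<open>The mass of a document whose words are grouped into blocks, with one urn draw for each block.
  Ordinary documents have singleton blocks. Larger blocks arise when a draw repeats an earlier one,
  and with them the recursion \<open>block_mass_Cons\<close> closes.\<close>

definition block_mass :: "real \<Rightarrow> (real ^ 'v) pmf \<Rightarrow> 'v list list \<Rightarrow> real" where
  "block_mass \<alpha> G bs = (\<Sum>z\<in>words (set_pmf G) (length bs).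
     urn (\<lambda>\<theta>. \<alpha> * pmf G \<theta>) \<alpha> z * (\<Prod>i<length bs. block (bs ! i) (z ! i)))"

lemma sum_urn_weights:
  assumes "finite (set_pmf G)"
  shows "(\<Sum>\<theta>\<in>set_pmf G. \<alpha> * pmf G \<theta>) = \<alpha>"
  using sum_pmf_eq_1[OF assms, of G] by (simp flip: sum_distrib_left)

text \<open>Expanding the product of sums under the Dirichlet integral leaves monomials in the topic
  proportions.\<close>

lemma lda_mass_eq_block_mass:
  fixes G :: "(real ^ 'v::finite) pmf"
  assumes "0 < \<alpha>" "topic_mixing G"
  shows "lda_mass \<alpha> G xs = block_mass \<alpha> G (map (\<lambda>x. [x]) xs)"
proof -
  let ?A = "set_pmf G" and ?a = "\<lambda>\<theta>. \<alpha> * pmf G \<theta>"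
  have A: "finite ?A" "?A \<noteq> {}" using assms(2) by (auto simp: topic_mixing_def set_pmf_not_empty)
  have s: "(\<Sum>\<theta>\<in>?A. ?a \<theta>) = \<alpha>" using A(1) by (rule sum_urn_weights)
  have pos: "0 < ?a \<theta>" if "\<theta> \<in> ?A" for \<theta> using that assms(1) by (simp add: pmf_positive)
  have "(\<Prod>x\<leftarrow>xs. \<Sum>\<theta>\<in>?A. q \<theta> * \<theta> $ x)
      = (\<Sum>z\<in>words ?A (length xs). (\<Prod>\<theta>\<leftarrow>z. q \<theta>) * (\<Prod>i<length xs. z ! i $ xs ! i))" for q
    unfolding prod_list_sum_expand
  proof (intro sum.cong refl)
    fix z assume "z \<in> words ?A (length xs)"
    then have "(\<Prod>\<theta>\<leftarrow>z. q \<theta>) = (\<Prod>i<length xs. q (z ! i))"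
      by (subst prod.list_conv_set_nth) (auto simp: words_def atLeast0LessThan)
    then show "(\<Prod>i<length xs. q (z ! i) * z ! i $ xs ! i) = (\<Prod>\<theta>\<leftarrow>z. q \<theta>) * (\<Prod>i<length xs. z ! i $ xs ! i)"
      by (simp add: prod.distrib)
  qed
  moreover have "has_bochner_integral (dirichlet ?A ?a)
      (\<lambda>q. \<Sum>z\<in>words ?A (length xs). (\<Prod>\<theta>\<leftarrow>z. q \<theta>) * (\<Prod>i<length xs. z ! i $ xs ! i))
      (\<Sum>z\<in>words ?A (length xs). urn ?a (sum ?a ?A) z * (\<Prod>i<length xs. z ! i $ xs ! i))"
  proof (rule has_bochner_integral_sum)
    fix z assume "z \<in> words ?A (length xs)"
    then have "set z \<subseteq> ?A" by (simp add: words_def)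
    show "has_bochner_integral (dirichlet ?A ?a) (\<lambda>q. (\<Prod>\<theta>\<leftarrow>z. q \<theta>) * (\<Prod>i<length xs. z ! i $ xs ! i))
      (urn ?a (sum ?a ?A) z * (\<Prod>i<length xs. z ! i $ xs ! i))"
      using \<open>set z \<subseteq> ?A\<close> by (intro has_bochner_integral_mult_left dirichlet_moment A pos)
  qed
  ultimately have "lda_mass \<alpha> G xs
      = (\<Sum>z\<in>words ?A (length xs). urn ?a \<alpha> z * (\<Prod>i<length xs. z ! i $ xs ! i))"
    unfolding lda_mass_def s by (simp only: has_bochner_integral_integral_eq)
  then show ?thesis
    by (simp add: block_mass_def block_singleton)
qed

lemma urn_weight_nonneg: "0 < \<alpha> \<Longrightarrow> 0 \<le> urn (\<lambda>\<theta>. \<alpha> * pmf G \<theta>) \<alpha> z"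
  by (intro urn_nonneg) auto

lemma block_mass_bounds:
  fixes G :: "(real ^ 'v::finite) pmf"
  assumes "0 < \<alpha>" "topic_mixing G"
  shows "0 \<le> block_mass \<alpha> G bs" "block_mass \<alpha> G bs \<le> 1"
proof -
  have fin: "finite (set_pmf G)" using assms(2) by (simp add: topic_mixing_def)
  have *: "z ! i \<in> prob_simplex" if "z \<in> words (set_pmf G) (length bs)" "i < length bs" for z i
  proof -
    have "z ! i \<in> set z" using that by (intro nth_mem) (simp add: words_def)
    then show ?thesis using that assms(2) unfolding words_def topic_mixing_def by blast
  qed
  show "0 \<le> block_mass \<alpha> G bs"
    unfolding block_mass_def using assms(1)
    by (intro sum_nonneg mult_nonneg_nonneg urn_weight_nonneg prod_nonneg block_bounds *) auto
  have "block_mass \<alpha> G bs \<le> (\<Sum>z\<in>words (set_pmf G) (length bs). urn (\<lambda>\<theta>. \<alpha> * pmf G \<theta>) \<alpha> z * 1)"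
    unfolding block_mass_def using assms(1)
    by (intro sum_mono mult_left_mono urn_weight_nonneg prod_le_1) (auto intro!: block_bounds *)
  also have "\<dots> = 1"
    using sum_urn_words[OF fin sum_urn_weights[OF fin] assms(1)] by simp
  finally show "block_mass \<alpha> G bs \<le> 1" .
qed

lemma lda_mass_bounds:
  fixes G :: "(real ^ 'v::finite) pmf"
  assumes "0 < \<alpha>" "topic_mixing G"
  shows "0 \<le> lda_mass \<alpha> G xs" "lda_mass \<alpha> G xs \<le> 1"
  by (simp_all add: lda_mass_eq_block_mass[OF assms] block_mass_bounds[OF assms])

text \<open>The mass is an average, with urn weights, of products of topic probabilities.\<close>

lemma lda_mass_lower_bound:
  fixes G :: "(real ^ 'v::finite) pmf"
  assumes "0 < \<alpha>" "topic_mixing G" "0 \<le> c" "\<And>\<theta> v. \<theta> \<in> set_pmf G \<Longrightarrow> c \<le> \<theta> $ v"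
  shows "c ^ length xs \<le> lda_mass \<alpha> G xs"
proof -
  have fin: "finite (set_pmf G)" using assms(2) by (simp add: topic_mixing_def)
  let ?W = "words (set_pmf G) (length xs)" and ?u = "urn (\<lambda>\<theta>. \<alpha> * pmf G \<theta>) \<alpha>"
  have "c ^ length xs = (\<Sum>z\<in>?W. ?u z * c ^ length xs)"
    using sum_urn_words[OF fin sum_urn_weights[OF fin] assms(1)] by (simp flip: sum_distrib_right)
  also have "\<dots> \<le> (\<Sum>z\<in>?W. ?u z * (\<Prod>i<length xs. z ! i $ xs ! i))"
  proof (intro sum_mono mult_left_mono urn_weight_nonneg assms(1))
    fix z assume "z \<in> ?W"
    then have "z ! i \<in> set_pmf G" if "i < length xs" for i
      using that nth_mem[of i z] by (auto simp: words_def)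
    then have "(\<Prod>i<length xs. c) \<le> (\<Prod>i<length xs. z ! i $ xs ! i)"
      using assms(3,4) by (intro prod_mono) auto
    then show "c ^ length xs \<le> (\<Prod>i<length xs. z ! i $ xs ! i)" by simp
  qed
  finally show ?thesis
    by (simp add: lda_mass_eq_block_mass[OF assms(1,2)] block_mass_def block_singleton)
qed

lemma sum_lda_mass_Cons:
  fixes G :: "(real ^ 'v::finite) pmf"
  assumes "0 < \<alpha>" "topic_mixing G"
  shows "(\<Sum>v\<in>UNIV. lda_mass \<alpha> G (v # xs)) = lda_mass \<alpha> G xs"
proof -
  have fin: "finite (set_pmf G)" using assms(2) by (simp add: topic_mixing_def)
  let ?A = "set_pmf G" and ?u = "urn (\<lambda>\<theta>. \<alpha> * pmf G \<theta>) \<alpha>"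
  let ?W = "words ?A (length xs)" and ?p = "\<lambda>z. \<Prod>i<length xs. z ! i $ xs ! i"
  have "(\<Sum>v\<in>UNIV. lda_mass \<alpha> G (v # xs)) = (\<Sum>v\<in>UNIV. \<Sum>\<theta>\<in>?A. \<Sum>z\<in>?W. ?u (\<theta> # z) * (\<theta> $ v * ?p z))"
    by (simp add: lda_mass_eq_block_mass[OF assms] block_mass_def block_singleton sum_words_Suc
        prod.lessThan_Suc_shift del: prod.lessThan_Suc urn.simps)
  also have "\<dots> = (\<Sum>\<theta>\<in>?A. \<Sum>v\<in>UNIV. \<Sum>z\<in>?W. ?u (\<theta> # z) * (\<theta> $ v * ?p z))"
    by (rule sum.swap)
  also have "\<dots> = (\<Sum>\<theta>\<in>?A. \<Sum>z\<in>?W. \<Sum>v\<in>UNIV. ?u (\<theta> # z) * (\<theta> $ v * ?p z))"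
    by (intro sum.cong refl sum.swap)
  also have "\<dots> = (\<Sum>\<theta>\<in>?A. \<Sum>z\<in>?W. ?u (\<theta> # z) * ?p z)"
  proof (intro sum.cong refl)
    fix \<theta> z assume "\<theta> \<in> ?A"
    then have "(\<Sum>v\<in>UNIV. \<theta> $ v) = 1" using assms(2) by (auto simp: topic_mixing_def prob_simplex_def)
    then show "(\<Sum>v\<in>UNIV. ?u (\<theta> # z) * (\<theta> $ v * ?p z)) = ?u (\<theta> # z) * ?p z"
      by (simp del: urn.simps flip: sum_distrib_left sum_distrib_right)
  qed
  also have "\<dots> = (\<Sum>z\<in>?W. \<Sum>\<theta>\<in>?A. ?u (\<theta> # z) * ?p z)"
    by (rule sum.swap)
  also have "\<dots> = (\<Sum>z\<in>?W. ?u z * ?p z)"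
  proof (intro sum.cong refl)
    fix z assume "z \<in> ?W"
    then have "set z \<subseteq> ?A" by (simp add: words_def)
    from sum_urn_Cons[OF fin this sum_urn_weights[OF fin] assms(1)]
    show "(\<Sum>\<theta>\<in>?A. ?u (\<theta> # z) * ?p z) = ?u z * ?p z"
      by (simp del: urn.simps flip: sum_distrib_right)
  qed
  also have "\<dots> = lda_mass \<alpha> G xs"
    by (simp add: lda_mass_eq_block_mass[OF assms] block_mass_def block_singleton)
  finally show ?thesis .
qed

lemma sum_documents_Suc: "(\<Sum>xs\<in>documents (Suc n). f xs) = (\<Sum>xs\<in>documents n. \<Sum>v\<in>UNIV. f (v # xs))"
  unfolding documents_eq_words sum_words_Suc by (rule sum.swap)

lemma sum_lda_mass:
  fixes G :: "(real ^ 'v::finite) pmf"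
  assumes "0 < \<alpha>" "topic_mixing G"
  shows "(\<Sum>xs\<in>documents N. lda_mass \<alpha> G xs) = 1"
proof (induction N)
  case 0
  have "documents 0 = {[] :: 'v list}" by (auto simp: documents_def)
  then show ?case by (simp add: lda_mass_eq_block_mass[OF assms] block_mass_def words_0)
next
  case (Suc N)
  then show ?case by (simp add: sum_documents_Suc sum_lda_mass_Cons[OF assms])
qed

text \<open>Shorter documents are marginals of longer ones (\<open>sum_lda_mass_Cons\<close>), and marginalising cannot
  increase the total variation distance.\<close>

lemma tv_dist_mono:
  fixes G G' :: "(real ^ 'v::finite) pmf"
  assumes "0 < \<alpha>" "topic_mixing G" "topic_mixing G'" "n \<le> N"
  shows "tv_dist (documents n) (lda_mass \<alpha> G) (lda_mass \<alpha> G')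
    \<le> tv_dist (documents N) (lda_mass \<alpha> G) (lda_mass \<alpha> G')"
  using assms(4)
proof (induction N rule: dec_induct)
  case (step N)
  have "(\<Sum>xs\<in>documents N. \<bar>lda_mass \<alpha> G xs - lda_mass \<alpha> G' xs\<bar>)
      \<le> (\<Sum>xs\<in>documents N. \<Sum>v\<in>UNIV. \<bar>lda_mass \<alpha> G (v # xs) - lda_mass \<alpha> G' (v # xs)\<bar>)"
  proof (rule sum_mono)
    fix xs :: "'v list"
    have "lda_mass \<alpha> G xs - lda_mass \<alpha> G' xs = (\<Sum>v\<in>UNIV. lda_mass \<alpha> G (v # xs) - lda_mass \<alpha> G' (v # xs))"
      by (simp add: sum_subtractf sum_lda_mass_Cons[OF assms(1)] assms(2,3))
    then show "\<bar>lda_mass \<alpha> G xs - lda_mass \<alpha> G' xs\<bar>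
        \<le> (\<Sum>v\<in>UNIV. \<bar>lda_mass \<alpha> G (v # xs) - lda_mass \<alpha> G' (v # xs)\<bar>)"
      by (simp add: sum_abs)
  qed
  with step.IH show ?case
    by (simp add: tv_dist_def sum_documents_Suc)
qed simp

lemma block_moment_bounds:
  fixes G :: "(real ^ 'v::finite) pmf"
  assumes "topic_mixing G"
  shows "0 \<le> block_moment G b" "block_moment G b \<le> 1"
proof -
  have *: "block_moment G b = (\<Sum>\<theta>\<in>set_pmf G. block b \<theta> * pmf G \<theta>)"
    unfolding block_moment_def using assms
    by (intro integral_measure_pmf_real) (auto simp: topic_mixing_def)
  have "\<theta> \<in> set_pmf G \<Longrightarrow> \<theta> \<in> prob_simplex" for \<theta> using assms by (auto simp: topic_mixing_def)
  note b = block_bounds[OF this]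
  show "0 \<le> block_moment G b" unfolding * by (intro sum_nonneg mult_nonneg_nonneg b) auto
  have "block_moment G b \<le> (\<Sum>\<theta>\<in>set_pmf G. 1 * pmf G \<theta>)"
    unfolding * by (intro sum_mono mult_right_mono b) auto
  also have "\<dots> = 1" using assms sum_pmf_eq_1[of "set_pmf G" G] by (simp add: topic_mixing_def)
  finally show "block_moment G b \<le> 1" .
qed

text \<open>The newest urn draw is either a fresh draw from \<open>G\<close>, with probability \<open>\<alpha> / (\<alpha> + n)\<close>, or it
  repeats one of the \<open>n\<close> other draws, in which case its block merges with that block. Unfolding this
  recursion expresses the mass by the numbers \<open>block_moment G b\<close> alone. These are insensitive to how
  \<open>G\<close> is written as a mixture, unlike the sum over atoms that defines the mass.\<close>

lemma block_mass_Cons: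
  fixes G :: "(real ^ 'v::finite) pmf"
  assumes "0 < \<alpha>" "topic_mixing G"
  shows "block_mass \<alpha> G (b # bs)
    = (\<alpha> * block_moment G b * block_mass \<alpha> G bs
       + (\<Sum>j<length bs. block_mass \<alpha> G (bs[j := b @ bs ! j]))) / (\<alpha> + real (length bs))"
proof -
  have fin: "finite (set_pmf G)" using assms(2) by (simp add: topic_mixing_def)
  let ?A = "set_pmf G" and ?a = "\<lambda>\<theta>. \<alpha> * pmf G \<theta>" and ?n = "length bs"
  let ?u = "urn ?a \<alpha>" and ?W = "words ?A ?n"
  let ?p = "\<lambda>bs z. \<Prod>i<?n. block (bs ! i) (z ! i)"
  have mom: "(\<Sum>\<theta>\<in>?A. ?a \<theta> * block b \<theta>) = \<alpha> * block_moment G b"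
    unfolding block_moment_def using fin
    by (subst integral_measure_pmf_real[of ?A]) (auto simp: sum_distrib_left mult_ac)
  have upd: "block b (z ! j) * ?p bs z = ?p (bs[j := b @ bs ! j]) z" if "j < ?n" for z j
  proof -
    have "(\<Prod>i\<in>{..<?n} - {j}. block (bs[j := b @ bs ! j] ! i) (z ! i)) = (\<Prod>i\<in>{..<?n} - {j}. block (bs ! i) (z ! i))"
      by (intro prod.cong) auto
    then show ?thesis
      using that prod.remove[of "{..<?n}" j "\<lambda>i. block (bs ! i) (z ! i)"]
        prod.remove[of "{..<?n}" j "\<lambda>i. block (bs[j := b @ bs ! j] ! i) (z ! i)"]
      by (simp add: block_append)
  qed
  have "block_mass \<alpha> G (b # bs) = (\<Sum>\<theta>\<in>?A. \<Sum>z\<in>?W. ?u (\<theta> # z) * (block b \<theta> * ?p bs z))"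
    by (simp add: block_mass_def sum_words_Suc prod.lessThan_Suc_shift del: prod.lessThan_Suc urn.simps)
  also have "\<dots> = (\<Sum>z\<in>?W. \<Sum>\<theta>\<in>?A. ?u (\<theta> # z) * (block b \<theta> * ?p bs z))"
    by (rule sum.swap)
  also have "\<dots> = (\<Sum>z\<in>?W. ?u z * (\<alpha> * block_moment G b * ?p bs z
      + (\<Sum>j<?n. ?p (bs[j := b @ bs ! j]) z)) / (\<alpha> + real ?n))"
  proof (intro sum.cong refl)
    fix z assume "z \<in> ?W"
    then have z: "set z \<subseteq> ?A" "length z = ?n" by (auto simp: words_def)
    have "(\<Sum>\<theta>\<in>?A. ?u (\<theta> # z) * (block b \<theta> * ?p bs z))
        = ?u z / (\<alpha> + real ?n) * (?p bs z * (\<Sum>\<theta>\<in>?A. (?a \<theta> + real (count_list z \<theta>)) * block b \<theta>))"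
      using z(2) by (simp add: sum_distrib_left mult_ac)
    also have "?p bs z * (\<Sum>\<theta>\<in>?A. (?a \<theta> + real (count_list z \<theta>)) * block b \<theta>)
        = \<alpha> * block_moment G b * ?p bs z + (\<Sum>j<?n. block b (z ! j) * ?p bs z)"
      unfolding sum_add_count_list[OF fin z(1)] mom z(2)
      by (simp add: distrib_left sum_distrib_right mult_ac)
    also have "(\<Sum>j<?n. block b (z ! j) * ?p bs z) = (\<Sum>j<?n. ?p (bs[j := b @ bs ! j]) z)"
      by (intro sum.cong refl upd) auto
    finally show "(\<Sum>\<theta>\<in>?A. ?u (\<theta> # z) * (block b \<theta> * ?p bs z))
       = ?u z * (\<alpha> * block_moment G b * ?p bs z + (\<Sum>j<?n. ?p (bs[j := b @ bs ! j]) z)) / (\<alpha> + real ?n)"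
      by simp
  qed
  also have "\<dots> = (\<alpha> * block_moment G b * (\<Sum>z\<in>?W. ?u z * ?p bs z)
      + (\<Sum>j<?n. \<Sum>z\<in>?W. ?u z * ?p (bs[j := b @ bs ! j]) z)) / (\<alpha> + real ?n)"
  proof -
    have "(\<Sum>j<?n. \<Sum>z\<in>?W. ?u z * ?p (bs[j := b @ bs ! j]) z)
        = (\<Sum>z\<in>?W. \<Sum>j<?n. ?u z * ?p (bs[j := b @ bs ! j]) z)"
      by (rule sum.swap)
    then show ?thesis
      by (simp add: sum_distrib_left distrib_left sum.distrib mult_ac flip: sum_divide_distrib)
  qed
  finally show ?thesis
    by (simp add: block_mass_def)
qed

text \<open>Mixing measures with similar moments give similar masses. The recursion is a weighted mean, with
  weights summing to 1, of one term that involves a moment and of terms with one block fewer, so each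
  block contributes at most \<open>\<delta>\<close>. Merging preserves the total length, hence only moments of order at
  most \<open>N\<close> occur.\<close>

lemma block_mass_diff:
  fixes G G' :: "(real ^ 'v::finite) pmf"
  assumes "0 < \<alpha>" "topic_mixing G" "topic_mixing G'"
    and "\<And>b. length b \<le> N \<Longrightarrow> \<bar>block_moment G b - block_moment G' b\<bar> \<le> \<delta>"
    and "length (concat bs) \<le> N"
  shows "\<bar>block_mass \<alpha> G bs - block_mass \<alpha> G' bs\<bar> \<le> real (length bs) * \<delta>"
  using assms(5)
proof (induction "length bs" arbitrary: bs)
  case 0
  then show ?case by (simp add: block_mass_def words_0)
next
  case (Suc n)
  from Suc.hyps(2) obtain b cs where bs: "bs = b # cs" "length cs = n" by (cases bs) auto
  let ?d = "\<lambda>bs. block_mass \<alpha> G bs - block_mass \<alpha> G' bs"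
  let ?e = "block_moment G b - block_moment G' b"
  have len: "length (concat (cs[j := b @ cs ! j])) = length (concat bs)" if "j < n" for j
  proof -
    have "length (concat cs) = (\<Sum>i<n. length (cs ! i))" "length (concat (cs[j := b @ cs ! j])) = (\<Sum>i<n. length (cs[j := b @ cs ! j] ! i))"
      using bs(2) by (auto simp: length_concat sum_list_sum_nth atLeast0LessThan)
    moreover have "(\<Sum>i\<in>{..<n} - {j}. length (cs[j := b @ cs ! j] ! i)) = (\<Sum>i\<in>{..<n} - {j}. length (cs ! i))"
      by (intro sum.cong) auto
    ultimately show ?thesis
      using that bs sum.remove[of "{..<n}" j "\<lambda>i. length (cs ! i)"]
        sum.remove[of "{..<n}" j "\<lambda>i. length (cs[j := b @ cs ! j] ! i)"]
      by simp
  qed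
  have IH: "\<bar>?d cs\<bar> \<le> real n * \<delta>" "\<And>j. j < n \<Longrightarrow> \<bar>?d (cs[j := b @ cs ! j])\<bar> \<le> real n * \<delta>"
    using Suc.hyps(1)[of cs] Suc.hyps(1)[of "cs[j := b @ cs ! j]" for j] Suc.prems bs len by auto
  have e: "\<bar>?e\<bar> \<le> \<delta>" using assms(4)[of b] Suc.prems bs by simp
  have eq: "?d bs = (\<alpha> * (block_moment G b * ?d cs + ?e * block_mass \<alpha> G' cs)
      + (\<Sum>j<n. ?d (cs[j := b @ cs ! j]))) / (\<alpha> + real n)"
    unfolding bs(1) block_mass_Cons[OF assms(1,2)] block_mass_Cons[OF assms(1,3)] bs(2)
    by (simp add: sum_subtractf algebra_simps diff_divide_distrib add_divide_distrib)
  have "\<bar>block_moment G b * ?d cs + ?e * block_mass \<alpha> G' cs\<bar>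
      \<le> \<bar>block_moment G b\<bar> * \<bar>?d cs\<bar> + \<bar>?e\<bar> * \<bar>block_mass \<alpha> G' cs\<bar>"
    by (metis abs_mult abs_triangle_ineq)
  also have "\<dots> \<le> 1 * (real n * \<delta>) + \<delta> * 1"
    using block_moment_bounds[OF assms(2), of b] block_mass_bounds[OF assms(1,3), of cs] IH(1) e
    by (intro add_mono mult_mono) auto
  finally have 1: "\<bar>block_moment G b * ?d cs + ?e * block_mass \<alpha> G' cs\<bar> \<le> (real n + 1) * \<delta>"
    by (simp add: algebra_simps)
  have 2: "\<bar>\<Sum>j<n. ?d (cs[j := b @ cs ! j])\<bar> \<le> real n * ((real n + 1) * \<delta>)"
  proof -
    have "0 \<le> \<delta>" using e by linarith
    then have "\<bar>?d (cs[j := b @ cs ! j])\<bar> \<le> (real n + 1) * \<delta>" if "j < n" for j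
      using IH(2)[OF that] by (simp add: algebra_simps)
    then have "(\<Sum>j<n. \<bar>?d (cs[j := b @ cs ! j])\<bar>) \<le> (\<Sum>j<n. (real n + 1) * \<delta>)"
      by (intro sum_mono) auto
    then show ?thesis by (intro order_trans[OF sum_abs]) simp
  qed
  have "\<bar>?d bs\<bar> \<le> (\<alpha> * ((real n + 1) * \<delta>) + real n * ((real n + 1) * \<delta>)) / (\<alpha> + real n)"
    unfolding eq abs_divide using assms(1) 1 2
    by (intro divide_mono order_trans[OF abs_triangle_ineq] add_mono) (auto simp: abs_mult intro!: mult_left_mono)
  also have "\<dots> = (real n + 1) * \<delta>"
    using assms(1) by (simp add: field_simps)
  finally show ?case using Suc.hyps(2) by (simp flip: Suc.hyps(2) add: add.commute)
qed

lemma lda_mass_diff: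
  fixes G G' :: "(real ^ 'v::finite) pmf"
  assumes "0 < \<alpha>" "topic_mixing G" "topic_mixing G'"
    and "\<And>b. length b \<le> length xs \<Longrightarrow> \<bar>block_moment G b - block_moment G' b\<bar> \<le> \<delta>"
  shows "\<bar>lda_mass \<alpha> G xs - lda_mass \<alpha> G' xs\<bar> \<le> real (length xs) * \<delta>"
  using block_mass_diff[OF assms, of "length xs" "map (\<lambda>x. [x]) xs"]
  by (simp add: lda_mass_eq_block_mass[OF assms(1)] assms(2,3) length_concat comp_def sum_list_triv)

section \<open>Transport distance and the Borel sets of mixing measures\<close>

lemma expectation_mono_finite:
  fixes f g :: "'a \<Rightarrow> real"
  assumes "finite (set_pmf q)" "\<And>x. x \<in> set_pmf q \<Longrightarrow> f x \<le> g x"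
  shows "measure_pmf.expectation q f \<le> measure_pmf.expectation q g"
  using assms by (intro integral_mono_AE integrable_measure_pmf_finite) (auto simp: AE_measure_pmf_iff)

definition transport :: "'a pmf \<Rightarrow> 'a pmf \<Rightarrow> ('a \<times> 'a) pmf set" where
  "transport G G' = {q. map_pmf fst q = G \<and> map_pmf snd q = G'}"

definition transport_cost :: "('a::metric_space \<times> 'a) pmf \<Rightarrow> real" where
  "transport_cost q = measure_pmf.expectation q (\<lambda>(x, y). dist x y)"

lemma transport_cost_nonneg: "0 \<le> transport_cost q"
  unfolding transport_cost_def by (intro integral_nonneg_AE) auto

lemma transport_nonempty: "transport G G' \<noteq> {}"
  using map_fst_pair_pmf[of G G'] map_snd_pair_pmf[of G G'] by (auto simp: transport_def)

lemma finite_set_pmf_coupling: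
  assumes "finite (set_pmf (map_pmf fst q))" "finite (set_pmf (map_pmf snd q))"
  shows "finite (set_pmf q)"
  by (rule finite_subset[OF subset_fst_snd]) (use assms in auto)

lemma wasserstein1_eq: "wasserstein 1 G G' = (INF q\<in>transport G G'. transport_cost q)"
proof -
  have "0 \<le> (INF q\<in>transport G G'. transport_cost q)"
    by (intro cINF_greatest transport_nonempty transport_cost_nonneg)
  then show ?thesis
    unfolding wasserstein_def transport_def transport_cost_def by simp
qed

lemma bdd_below_transport_cost: "bdd_below (transport_cost ` S)"
  by (rule bdd_belowI2[of _ 0]) (rule transport_cost_nonneg)

lemma wasserstein1_le: "q \<in> transport G G' \<Longrightarrow> wasserstein 1 G G' \<le> transport_cost q"
  unfolding wasserstein1_eq by (intro cINF_lower bdd_below_transport_cost)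

lemma wasserstein1_ge: "(\<And>q. q \<in> transport G G' \<Longrightarrow> c \<le> transport_cost q) \<Longrightarrow> c \<le> wasserstein 1 G G'"
  unfolding wasserstein1_eq by (intro cINF_greatest transport_nonempty)

lemma wasserstein1_nonneg: "0 \<le> wasserstein 1 G G'"
  by (intro wasserstein1_ge transport_cost_nonneg)

lemma wasserstein1_commute: "wasserstein 1 G G' = wasserstein 1 G' G"
proof -
  have "wasserstein 1 G G' \<le> wasserstein 1 G' G" for G G' :: "'a pmf"
  proof (rule wasserstein1_ge)
    fix q assume "q \<in> transport G' G"
    then have "map_pmf prod.swap q \<in> transport G G'"
      by (simp add: transport_def map_pmf_comp)
    moreover have "transport_cost (map_pmf prod.swap q) = transport_cost q"
      by (simp add: transport_cost_def case_prod_unfold dist_commute)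
    ultimately show "wasserstein 1 G G' \<le> transport_cost q"
      using wasserstein1_le by metis
  qed
  then show ?thesis by (intro antisym)
qed

text \<open>Two couplings that share a middle marginal are marginals of one distribution on quadruples whose
  two middle components agree. This is the coupling of \<open>p\<close> and \<open>q\<close> provided by the relator of the type
  of probability mass functions.\<close>

lemma transport_glue:
  assumes "p \<in> transport F G" "q \<in> transport G H"
  obtains r where "map_pmf fst r = p" "map_pmf snd r = q" "\<And>z. z \<in> set_pmf r \<Longrightarrow> snd (fst z) = fst (snd z)"
proof -
  have "rel_pmf (=) (map_pmf snd p) (map_pmf fst q)"
    using assms by (simp add: transport_def pmf.rel_eq)
  then have "rel_pmf (\<lambda>x y. snd x = fst y) p q"
    by (simp add: pmf.rel_map)
  then show ?thesis
    by (elim rel_pmf.cases) (use that in force)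
qed

lemma wasserstein1_triangle:
  assumes "finite (set_pmf F)" "finite (set_pmf G)" "finite (set_pmf H)"
  shows "wasserstein 1 F H \<le> wasserstein 1 F G + wasserstein 1 G H"
proof -
  have *: "wasserstein 1 F H \<le> transport_cost p + transport_cost q"
    if p: "p \<in> transport F G" and q: "q \<in> transport G H" for p q
  proof -
    obtain r where r: "map_pmf fst r = p" "map_pmf snd r = q"
        "\<And>z. z \<in> set_pmf r \<Longrightarrow> snd (fst z) = fst (snd z)"
      using transport_glue[OF p q] by blast
    have fin: "finite (set_pmf r)"
      using p q assms r(1,2) by (intro finite_set_pmf_coupling) (auto simp: transport_def intro!: finite_set_pmf_coupling simp del: set_map_pmf)
    have "map_pmf (\<lambda>z. (fst (fst z), snd (snd z))) r \<in> transport F H"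
      using p q unfolding transport_def r(1)[symmetric] r(2)[symmetric] by (auto simp: map_pmf_comp)
    then have "wasserstein 1 F H \<le> transport_cost (map_pmf (\<lambda>z. (fst (fst z), snd (snd z))) r)"
      by (rule wasserstein1_le)
    also have "\<dots> = measure_pmf.expectation r (\<lambda>z. dist (fst (fst z)) (snd (snd z)))"
      by (simp add: transport_cost_def)
    also have "\<dots> \<le> measure_pmf.expectation r (\<lambda>z. dist (fst (fst z)) (snd (fst z)) + dist (fst (snd z)) (snd (snd z)))"
    proof (rule expectation_mono_finite[OF fin])
      fix z assume "z \<in> set_pmf r"
      then show "dist (fst (fst z)) (snd (snd z)) \<le> dist (fst (fst z)) (snd (fst z)) + dist (fst (snd z)) (snd (snd z))"
        using r(3)[of z] dist_triangle by metis
    qed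
    also have "\<dots> = transport_cost p + transport_cost q"
      unfolding transport_cost_def r(1)[symmetric] r(2)[symmetric]
      by (simp add: case_prod_unfold integrable_measure_pmf_finite[OF fin])
    finally show ?thesis .
  qed
  have "wasserstein 1 F H - transport_cost q \<le> wasserstein 1 F G" if "q \<in> transport G H" for q
    using *[OF _ that] by (intro wasserstein1_ge) (simp add: algebra_simps)
  then have "wasserstein 1 F H - wasserstein 1 F G \<le> wasserstein 1 G H"
    by (intro wasserstein1_ge) (simp add: algebra_simps)
  then show ?thesis by simp
qed

text \<open>The easy half of Kantorovich duality. The Lipschitz condition is only imposed on the supports,
  so on finite supports it is met by every function; \<open>wasserstein1_eq_0\<close> uses this with indicators of
  points.\<close>

lemma expectation_diff_le_wasserstein1:
  fixes f :: "'a::metric_space \<Rightarrow> real"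
  assumes "finite (set_pmf G)" "finite (set_pmf G')" "0 \<le> L"
    and "\<And>x y. x \<in> set_pmf G \<Longrightarrow> y \<in> set_pmf G' \<Longrightarrow> \<bar>f x - f y\<bar> \<le> L * dist x y"
  shows "\<bar>measure_pmf.expectation G f - measure_pmf.expectation G' f\<bar> \<le> L * wasserstein 1 G G'"
proof -
  let ?d = "\<bar>measure_pmf.expectation G f - measure_pmf.expectation G' f\<bar>"
  have *: "?d \<le> L * transport_cost q" if q: "q \<in> transport G G'" for q
  proof -
    have G: "G = map_pmf fst q" "G' = map_pmf snd q" using q by (auto simp: transport_def)
    have fin: "finite (set_pmf q)" using assms(1,2) G by (intro finite_set_pmf_coupling) simp_all
    have "measure_pmf.expectation G f - measure_pmf.expectation G' f
        = measure_pmf.expectation q (\<lambda>z. f (fst z) - f (snd z))"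
      unfolding G by (simp add: integrable_measure_pmf_finite[OF fin])
    also have "\<bar>\<dots>\<bar> \<le> measure_pmf.expectation q (\<lambda>z. \<bar>f (fst z) - f (snd z)\<bar>)"
      by (rule integral_abs_bound)
    also have "\<dots> \<le> measure_pmf.expectation q (\<lambda>z. L * dist (fst z) (snd z))"
      by (intro expectation_mono_finite fin assms(4)) (auto simp: G)
    also have "\<dots> = L * transport_cost q"
      by (simp add: transport_cost_def case_prod_unfold)
    finally show ?thesis .
  qed
  show ?thesis
  proof (cases "L = 0")
    case True
    then show ?thesis using * transport_nonempty[of G G'] by force
  next
    case False
    then have "?d / L \<le> wasserstein 1 G G'"
      using * assms(3) by (intro wasserstein1_ge) (simp add: divide_le_eq mult.commute)
    then show ?thesis using False assms(3) by (simp add: divide_le_eq mult.commute)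
  qed
qed

lemma wasserstein1_refl: "wasserstein 1 G G = 0"
proof -
  have "map_pmf (\<lambda>x. (x, x)) G \<in> transport G G"
    by (simp add: transport_def map_pmf_comp)
  from wasserstein1_le[OF this] have "wasserstein 1 G G \<le> 0"
    by (simp add: transport_cost_def)
  then show ?thesis using wasserstein1_nonneg[of G G] by simp
qed

lemma wasserstein1_eq_0:
  fixes G G' :: "'a::metric_space pmf"
  assumes fin: "finite (set_pmf G)" "finite (set_pmf G')" and W: "wasserstein 1 G G' = 0"
  shows "G = G'"
proof (rule pmf_eqI)
  fix t :: 'a
  let ?f = "\<lambda>x. indicator {t} x :: real"
  let ?S = "set_pmf G \<times> set_pmf G'"
  \<comment> \<open>A Lipschitz constant on the finite supports; the terms with \<open>x = y\<close> vanish.\<close>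
  define L where "L = (\<Sum>(x, y)\<in>?S. \<bar>?f x - ?f y\<bar> / dist x y)"
  have "\<bar>?f x - ?f y\<bar> \<le> L * dist x y" if "x \<in> set_pmf G" "y \<in> set_pmf G'" for x y
  proof (cases "x = y")
    case False
    have "\<bar>?f x - ?f y\<bar> / dist x y \<le> L"
      unfolding L_def using that fin
      by (intro member_le_sum[where i = "(x, y)" and f = "\<lambda>(x, y). \<bar>?f x - ?f y\<bar> / dist x y", simplified]) auto
    then show ?thesis using False by (simp add: pos_divide_le_eq)
  qed simp
  moreover have "0 \<le> L" unfolding L_def by (intro sum_nonneg) auto
  ultimately have "\<bar>measure_pmf.expectation G ?f - measure_pmf.expectation G' ?f\<bar> \<le> L * wasserstein 1 G G'"
    using fin by (intro expectation_diff_le_wasserstein1) auto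
  then show "pmf G t = pmf G' t"
    by (simp add: W measure_pmf_single)
qed

text \<open>This makes the topology in \<^const>\<open>mixing_borel\<close> the one whose open sets are described by balls
  (\<open>openin_wasserstein1\<close>).\<close>

lemma Metric_space_wasserstein1: "Metric_space (over_mixing K) (wasserstein 1)"
proof
  fix F G H :: "(real ^ 'a) pmf"
  show "0 \<le> wasserstein 1 F G" by (rule wasserstein1_nonneg)
  show "wasserstein 1 F G = wasserstein 1 G F" by (rule wasserstein1_commute)
  assume FG: "F \<in> over_mixing K" "G \<in> over_mixing K"
  then have fin: "finite (set_pmf F)" "finite (set_pmf G)"
    by (auto dest!: over_mixing_topic simp: topic_mixing_def)
  then show "wasserstein 1 F G = 0 \<longleftrightarrow> F = G"
    using wasserstein1_eq_0 wasserstein1_refl by auto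
  assume "H \<in> over_mixing K"
  then have "finite (set_pmf H)"
    by (auto dest!: over_mixing_topic simp: topic_mixing_def)
  with fin show "wasserstein 1 F H \<le> wasserstein 1 F G + wasserstein 1 G H"
    by (intro wasserstein1_triangle)
qed

lemma openin_wasserstein1:
  "openin (Metric_space.mtopology (over_mixing K) (wasserstein 1)) U \<longleftrightarrow>
    U \<subseteq> over_mixing K \<and>
    (\<forall>G\<in>U. \<exists>r>0. \<forall>G'\<in>over_mixing K. wasserstein 1 G G' < r \<longrightarrow> G' \<in> U)"
proof -
  interpret Metric_space "over_mixing K" "wasserstein 1 :: (real ^ 'a) pmf \<Rightarrow> _"
    by (rule Metric_space_wasserstein1)
  have *: "mball G r \<subseteq> U \<longleftrightarrow> (\<forall>G'\<in>over_mixing K. wasserstein 1 G G' < r \<longrightarrow> G' \<in> U)"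
    if "G \<in> over_mixing K" for G r
    using that by (auto simp: subset_iff)
  show ?thesis
  proof (cases "U \<subseteq> over_mixing K")
    case True
    then have "(\<forall>G. G \<in> U \<longrightarrow> (\<exists>r>0. mball G r \<subseteq> U)) \<longleftrightarrow>
        (\<forall>G\<in>U. \<exists>r>0. \<forall>G'\<in>over_mixing K. wasserstein 1 G G' < r \<longrightarrow> G' \<in> U)"
      unfolding Ball_def[of U] by (intro all_cong1 imp_cong refl ex_cong1 conj_cong *) blast
    then show ?thesis unfolding openin_mtopology using True by blast
  next
    case False
    then show ?thesis unfolding openin_mtopology by blast
  qed
qed

lemma space_mixing_borel [simp]: "space (mixing_borel K) = over_mixing K"
  by (simp add: mixing_borel_def space_measure_of_conv)

lemma sets_mixing_borel:
  "sets (mixing_borel K) = sigma_sets (over_mixing K)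
    {U. openin (Metric_space.mtopology (over_mixing K) (wasserstein 1)) U}"
  unfolding mixing_borel_def by (rule sets_measure_of) (auto simp: openin_wasserstein1)

lemma block_moment_diff_le_wasserstein1:
  fixes G G' :: "(real ^ 'v::finite) pmf"
  assumes "topic_mixing G" "topic_mixing G'"
  shows "\<bar>block_moment G b - block_moment G' b\<bar> \<le> real (length b) * wasserstein 1 G G'"
  unfolding block_moment_def
proof (rule expectation_diff_le_wasserstein1)
  fix x y assume "x \<in> set_pmf G" "y \<in> set_pmf G'"
  then show "\<bar>block b x - block b y\<bar> \<le> real (length b) * dist x y"
    using assms by (intro block_diff) (auto simp: topic_mixing_def dist_norm component_le_norm_cart simp flip: vector_minus_component)
qed (use assms in \<open>auto simp: topic_mixing_def\<close>)

lemma lda_mass_diff_le_wasserstein1: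
  fixes G G' :: "(real ^ 'v::finite) pmf"
  assumes "0 < \<alpha>" "topic_mixing G" "topic_mixing G'"
  shows "\<bar>lda_mass \<alpha> G xs - lda_mass \<alpha> G' xs\<bar> \<le> (real (length xs))\<^sup>2 * wasserstein 1 G G'"
proof -
  have "\<bar>lda_mass \<alpha> G xs - lda_mass \<alpha> G' xs\<bar> \<le> real (length xs) * (real (length xs) * wasserstein 1 G G')"
  proof (rule lda_mass_diff[OF assms])
    fix b :: "'v list" assume "length b \<le> length xs"
    then have "real (length b) * wasserstein 1 G G' \<le> real (length xs) * wasserstein 1 G G'"
      by (intro mult_right_mono wasserstein1_nonneg) auto
    then show "\<bar>block_moment G b - block_moment G' b\<bar> \<le> real (length xs) * wasserstein 1 G G'"
      using block_moment_diff_le_wasserstein1[OF assms(2,3), of b] by linarith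
  qed
  then show ?thesis by (simp add: power2_eq_square mult.assoc)
qed

text \<open>The mass is Lipschitz in the transport distance, since the moments are.\<close>

lemma measurable_lda_mass:
  fixes xs :: "'v::finite list"
  assumes "0 < \<alpha>"
  shows "(\<lambda>G. lda_mass \<alpha> G xs) \<in> borel_measurable (mixing_borel K)"
proof (rule borel_measurableI)
  fix S :: "real set" assume S: "open S"
  let ?U = "(\<lambda>G. lda_mass \<alpha> G xs) -` S \<inter> over_mixing K"
  have "openin (Metric_space.mtopology (over_mixing K) (wasserstein 1)) ?U"
    unfolding openin_wasserstein1
  proof (intro conjI ballI)
    fix G assume G: "G \<in> ?U"
    then obtain e where e: "0 < e" "\<And>y. dist y (lda_mass \<alpha> G xs) < e \<Longrightarrow> y \<in> S"
      using S by (auto simp: open_dist)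
    define r where "r = e / ((real (length xs))\<^sup>2 + 1)"
    have "G' \<in> ?U" if G': "G' \<in> over_mixing K" and W: "wasserstein 1 G G' < r" for G'
    proof -
      have "\<bar>lda_mass \<alpha> G xs - lda_mass \<alpha> G' xs\<bar> \<le> (real (length xs))\<^sup>2 * wasserstein 1 G G'"
        using G G' by (intro lda_mass_diff_le_wasserstein1 assms) (auto dest: over_mixing_topic)
      also have "\<dots> \<le> ((real (length xs))\<^sup>2 + 1) * wasserstein 1 G G'"
        by (intro mult_right_mono wasserstein1_nonneg) auto
      also have "\<dots> < e"
      proof -
        have "0 < (real (length xs))\<^sup>2 + 1" by (simp add: add_nonneg_pos)
        then show ?thesis using W by (simp add: r_def pos_less_divide_eq mult.commute)
      qed
      finally show ?thesis
        using G' e(2)[of "lda_mass \<alpha> G' xs"] by (auto simp: dist_real_def abs_minus_commute)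
    qed
    moreover have "0 < r" using e(1) by (simp add: r_def add_nonneg_pos)
    ultimately show "\<exists>r>0. \<forall>G'\<in>over_mixing K. wasserstein 1 G G' < r \<longrightarrow> G' \<in> ?U" by blast
  qed auto
  then show "(\<lambda>G. lda_mass \<alpha> G xs) -` S \<inter> space (mixing_borel K) \<in> sets (mixing_borel K)"
    unfolding sets_mixing_borel by (auto intro!: sigma_sets.Basic)
qed

text \<open>Probability weights supported in a finite index set. The set is explicit so that the weights of
  the true measure, indexed by all natural numbers, are covered together with those indexed by a
  finite type.\<close>

definition weights :: "'i set \<Rightarrow> ('i \<Rightarrow> real) \<Rightarrow> bool" where
  "weights I w \<longleftrightarrow> finite I \<and> (\<forall>k. 0 \<le> w k) \<and> (\<forall>k. k \<notin> I \<longrightarrow> w k = 0) \<and> sum w I = 1"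

lemma nn_integral_weights:
  assumes "weights I w"
  shows "(\<integral>\<^sup>+k. ennreal (w k) \<partial>count_space UNIV) = 1"
proof -
  have "(\<integral>\<^sup>+k. ennreal (w k) \<partial>count_space UNIV) = (\<Sum>k\<in>I. ennreal (w k))"
    using assms by (intro nn_integral_count_space') (auto simp: weights_def)
  then show ?thesis using assms by (simp add: weights_def)
qed

lemma pmf_embed_weights: "weights I w \<Longrightarrow> pmf (embed_pmf w) k = w k"
  by (intro pmf_embed_pmf nn_integral_weights) (auto simp: weights_def)

lemma set_embed_weights: "weights I w \<Longrightarrow> set_pmf (embed_pmf w) = {k \<in> I. w k \<noteq> 0}"
  by (subst set_embed_pmf) (auto simp: weights_def nn_integral_weights)

lemma set_mixing_measure: "weights I w \<Longrightarrow> set_pmf (mixing_measure w \<theta>) = \<theta> ` {k \<in> I. w k \<noteq> 0}"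
  by (simp add: mixing_measure_def set_embed_weights)

lemma expectation_mixing_measure:
  fixes f :: "'a \<Rightarrow> real"
  assumes "weights I w"
  shows "measure_pmf.expectation (mixing_measure w \<theta>) f = (\<Sum>k\<in>I. w k * f (\<theta> k))"
proof -
  have "measure_pmf.expectation (embed_pmf w) (\<lambda>k. f (\<theta> k)) = (\<Sum>k\<in>I. f (\<theta> k) * pmf (embed_pmf w) k)"
    using assms by (intro integral_measure_pmf_real) (auto simp: weights_def set_embed_weights)
  then show ?thesis
    by (simp add: mixing_measure_def pmf_embed_weights[OF assms] mult.commute)
qed

lemma mixing_measure_in_over_mixing:
  fixes \<theta> :: "'i \<Rightarrow> real ^ 'v"
  assumes "weights I w" "\<And>k. k \<in> I \<Longrightarrow> \<theta> k \<in> prob_simplex"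
  shows "mixing_measure w \<theta> \<in> over_mixing (card I)"
proof -
  let ?S = "\<theta> ` {k \<in> I. w k \<noteq> 0}"
  have fin: "finite I" using assms by (simp add: weights_def)
  have "?S \<noteq> {}" using set_mixing_measure[OF assms(1), of \<theta>] set_pmf_not_empty by metis
  then have "1 \<le> card ?S" using fin by (simp add: Suc_le_eq card_gt_0_iff)
  moreover have "card ?S \<le> card I"
    by (rule order_trans[OF card_image_le card_mono]) (use fin in auto)
  ultimately show ?thesis
    using fin assms(2) by (auto simp: over_mixing_def exact_mixing_def set_mixing_measure[OF assms(1)])
qed

text \<open>The coupling keeps the common mass \<open>min (a k) (a' k)\<close> of each index in place, where it travels at
  most \<open>d\<close>, and spreads the excess \<open>u\<close> of \<open>a\<close> over \<open>a'\<close> onto the deficit \<open>v\<close> in proportion, where it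
  travels at most \<open>D\<close>.\<close>

lemma wasserstein1_mixing_measure_le:
  fixes a a' :: "'k::finite \<Rightarrow> real" and \<theta> \<theta>' :: "'k \<Rightarrow> 'a::metric_space"
  assumes a: "weights UNIV a" "weights UNIV a'"
    and d: "\<And>k. dist (\<theta> k) (\<theta>' k) \<le> d"
    and D: "\<And>i j. dist (\<theta> i) (\<theta>' j) \<le> D"
  shows "wasserstein 1 (mixing_measure a \<theta>) (mixing_measure a' \<theta>') \<le> d + D * (\<Sum>k\<in>UNIV. \<bar>a k - a' k\<bar>)"
proof -
  have an: "0 \<le> a k" "0 \<le> a' k" and as: "sum a UNIV = 1" "sum a' UNIV = 1" for k
    using a by (auto simp: weights_def)
  define u where "u k = max 0 (a k - a' k)" for k
  define v where "v k = max 0 (a' k - a k)" for k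
  define t where "t = sum u UNIV"
  have uv: "u k - v k = a k - a' k" "0 \<le> u k" "0 \<le> v k" "min (a k) (a' k) + u k = a k"
    "min (a k) (a' k) + v k = a' k" for k
    by (auto simp: u_def v_def)
  have "t - sum v UNIV = 0"
    unfolding t_def sum_subtractf[symmetric] uv(1) by (simp add: sum_subtractf as)
  then have tv: "sum v UNIV = t" by simp
  have t0: "0 \<le> t" unfolding t_def by (intro sum_nonneg uv)
  \<comment> \<open>If \<open>t = 0\<close> then \<open>u\<close> and \<open>v\<close> vanish, and so does this quotient.\<close>
  define r where "r i j = u i * v j / t" for i j
  have r0: "0 \<le> r i j" for i j unfolding r_def using uv t0 by simp
  have r1: "(\<Sum>j\<in>UNIV. r i j) = u i" for i
  proof (cases "t = 0")
    case True
    then have "u i = 0" unfolding t_def using uv by (simp add: sum_nonneg_eq_0_iff)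
    then show ?thesis by (simp add: r_def)
  next
    case False
    then show ?thesis unfolding r_def by (simp add: tv flip: sum_divide_distrib sum_distrib_left)
  qed
  have r2: "(\<Sum>i\<in>UNIV. r i j) = v j" for j
  proof (cases "t = 0")
    case True
    then have "v j = 0" using uv tv by (simp add: sum_nonneg_eq_0_iff)
    then show ?thesis by (simp add: r_def)
  next
    case False
    then show ?thesis unfolding r_def
      by (simp add: t_def[symmetric] flip: sum_divide_distrib sum_distrib_right)
  qed
  define c where "c = (\<lambda>(i, j). (if i = j then min (a i) (a' i) else 0) + r i j)"
  have row: "(\<Sum>j\<in>UNIV. c (i, j)) = a i" for i
    by (simp add: c_def sum.distrib r1 uv)
  have col: "(\<Sum>i\<in>UNIV. c (i, j)) = a' j" for j
    by (simp add: c_def sum.distrib r2 uv)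
  have c: "weights UNIV c"
  proof -
    have "sum c UNIV = (\<Sum>i\<in>UNIV. \<Sum>j\<in>UNIV. c (i, j))"
      by (simp add: sum.cartesian_product)
    then have "sum c UNIV = 1" by (simp add: row as)
    moreover have "0 \<le> c z" for z using an r0 by (cases z) (simp add: c_def)
    ultimately show ?thesis by (simp add: weights_def)
  qed
  define q where "q = embed_pmf c"
  have pq: "pmf q z = c z" for z unfolding q_def by (rule pmf_embed_weights[OF c])
  have "map_pmf fst q = embed_pmf a"
  proof (rule pmf_eqI)
    fix i :: 'k
    have "fst -` {i} = Pair i ` (UNIV :: 'k set)" by auto
    then show "pmf (map_pmf fst q) i = pmf (embed_pmf a) i"
      by (simp add: pmf_map measure_measure_pmf_finite pq pmf_embed_weights[OF a(1)] sum.reindex inj_on_def row)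
  qed
  moreover have "map_pmf snd q = embed_pmf a'"
  proof (rule pmf_eqI)
    fix j :: 'k
    have "snd -` {j} = (\<lambda>i. (i, j)) ` (UNIV :: 'k set)" by auto
    then show "pmf (map_pmf snd q) j = pmf (embed_pmf a') j"
      by (simp add: pmf_map measure_measure_pmf_finite pq pmf_embed_weights[OF a(2)] sum.reindex inj_on_def col)
  qed
  ultimately have "map_pmf (map_prod \<theta> \<theta>') q \<in> transport (mixing_measure a \<theta>) (mixing_measure a' \<theta>')"
    unfolding transport_def mixing_measure_def
    by (auto simp: map_pmf_comp simp flip: map_pmf_comp[of _ fst] map_pmf_comp[of _ snd])
  then have "wasserstein 1 (mixing_measure a \<theta>) (mixing_measure a' \<theta>') \<le> transport_cost (map_pmf (map_prod \<theta> \<theta>') q)"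
    by (rule wasserstein1_le)
  also have "\<dots> = measure_pmf.expectation q (\<lambda>(i, j). dist (\<theta> i) (\<theta>' j))"
    by (simp add: transport_cost_def case_prod_unfold)
  also have "\<dots> = (\<Sum>z\<in>UNIV. (case z of (i, j) \<Rightarrow> dist (\<theta> i) (\<theta>' j)) * c z)"
    by (subst integral_measure_pmf_real[where A = UNIV]) (auto simp: pq)
  also have "\<dots> = (\<Sum>i\<in>UNIV. \<Sum>j\<in>UNIV. dist (\<theta> i) (\<theta>' j) * c (i, j))"
    by (simp add: sum.cartesian_product case_prod_unfold)
  also have "\<dots> = (\<Sum>i\<in>UNIV. dist (\<theta> i) (\<theta>' i) * min (a i) (a' i)) + (\<Sum>i\<in>UNIV. \<Sum>j\<in>UNIV. dist (\<theta> i) (\<theta>' j) * r i j)"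
    by (simp add: c_def distrib_left sum.distrib if_distrib[of "\<lambda>x. _ * x"] cong: if_cong)
  also have "\<dots> \<le> (\<Sum>i\<in>UNIV. d * a i) + (\<Sum>i\<in>UNIV. \<Sum>j\<in>UNIV. D * r i j)"
  proof (intro add_mono sum_mono)
    fix i j :: 'k
    have "0 \<le> d" using d[of i] zero_le_dist order_trans by blast
    then show "dist (\<theta> i) (\<theta>' i) * min (a i) (a' i) \<le> d * a i"
      using an by (intro mult_mono d) auto
    show "dist (\<theta> i) (\<theta>' j) * r i j \<le> D * r i j"
      by (intro mult_right_mono D r0)
  qed
  also have "\<dots> = d + D * t"
    by (simp add: r1 t_def as flip: sum_distrib_left)
  also have "\<dots> \<le> d + D * (\<Sum>k\<in>UNIV. \<bar>a k - a' k\<bar>)"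
  proof -
    have "0 \<le> D" using D zero_le_dist order_trans by blast
    moreover have "t \<le> (\<Sum>k\<in>UNIV. \<bar>a k - a' k\<bar>)"
      unfolding t_def by (intro sum_mono) (auto simp: u_def)
    ultimately show ?thesis by (intro add_left_mono mult_left_mono)
  qed
  finally show ?thesis .
qed

lemma dist_simplex_le_2:
  fixes x y :: "real ^ 'v::finite"
  assumes "x \<in> prob_simplex" "y \<in> prob_simplex"
  shows "dist x y \<le> 2"
proof -
  have "norm z \<le> 1" if "z \<in> prob_simplex" for z :: "real ^ 'v"
    using norm_le_l1_cart[of z] that by (simp add: prob_simplex_def)
  from this[OF assms(1)] this[OF assms(2)] show ?thesis
    using norm_triangle_ineq4[of x y] by (simp add: dist_norm)
qed

lemma weights_simplex:
  fixes a :: "real ^ 'k::finite"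
  shows "a \<in> prob_simplex \<Longrightarrow> weights UNIV (\<lambda>k. a $ k)"
  by (simp add: weights_def prob_simplex_def)

lemma space_simplex_prob: "simplex_prob P \<Longrightarrow> space P = prob_simplex"
  unfolding simplex_prob_def by (auto dest: sets_eq_imp_space_eq simp: space_restrict_space)

lemma measurable_simplex_prob_borel: "simplex_prob P \<Longrightarrow> (\<lambda>x. x) \<in> borel_measurable P"
  unfolding simplex_prob_def
  by (subst measurable_cong_sets[where M' = "restrict_space borel prob_simplex"])
    (auto intro: measurable_restrict_space1)

text \<open>The parametrisation is continuous, so preimages of open sets are traces on the parameter set of
  open sets of the Euclidean product. That product is second countable, which makes its Borel sets
  the product sigma-algebra.\<close>

lemma measurable_mixing_measure:
  fixes Pa :: "(real ^ 'k::finite) measure" and Pt :: "(real ^ 'v::finite) measure"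
  assumes Pa: "simplex_prob Pa" and Pt: "simplex_prob Pt"
  shows "(\<lambda>(a, \<theta>). mixing_measure (\<lambda>k. a $ k) \<theta>)
    \<in> Pa \<Otimes>\<^sub>M (\<Pi>\<^sub>M k\<in>(UNIV :: 'k set). Pt) \<rightarrow>\<^sub>M mixing_borel CARD('k)"
proof -
  let ?M = "Pa \<Otimes>\<^sub>M (\<Pi>\<^sub>M k\<in>(UNIV :: 'k set). Pt)"
  let ?f = "\<lambda>(a :: real ^ 'k, \<theta>). mixing_measure (\<lambda>k. a $ k) \<theta> :: (real ^ 'v) pmf"
  define S where "S = {(a :: real ^ 'k, \<theta> :: 'k \<Rightarrow> real ^ 'v). a \<in> prob_simplex \<and> (\<forall>k. \<theta> k \<in> prob_simplex)}"
  have space: "space ?M = S"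
    by (auto simp: S_def space_pair_measure space_PiM PiE_def space_simplex_prob[OF Pa] space_simplex_prob[OF Pt])
  have f: "?f x \<in> over_mixing CARD('k)" if "x \<in> S" for x
    using that by (auto simp: S_def intro!: mixing_measure_in_over_mixing weights_simplex)
  have id: "(\<lambda>x. x) \<in> borel_measurable ?M"
  proof -
    have "(\<lambda>x. snd x) \<in> ?M \<rightarrow>\<^sub>M (\<Pi>\<^sub>M k\<in>(UNIV :: 'k set). (borel :: (real ^ 'v) measure))"
    proof (rule measurable_PiM_single')
      fix k :: 'k
      have "(\<lambda>x. snd x k) \<in> ?M \<rightarrow>\<^sub>M Pt" by measurable
      from measurable_compose[OF this measurable_simplex_prob_borel[OF Pt]]
      show "(\<lambda>x. snd x k) \<in> borel_measurable ?M" .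
    qed auto
    then have 2: "(\<lambda>x. snd x) \<in> borel_measurable ?M"
      using measurable_cong_sets[OF refl sets_PiM_equal_borel, where M = ?M] by blast
    have 1: "(\<lambda>x. fst x) \<in> borel_measurable ?M"
      using measurable_compose[OF measurable_fst measurable_simplex_prob_borel[OF Pa]] .
    show ?thesis using borel_measurable_Pair[OF 1 2] by simp
  qed
  show ?thesis
    unfolding mixing_borel_def
  proof (rule measurable_measure_of)
    fix U :: "(real ^ 'v) pmf set"
    assume "U \<in> {U. openin (Metric_space.mtopology (over_mixing CARD('k)) (wasserstein 1)) U}"
    then have U: "U \<subseteq> over_mixing CARD('k)"
      "\<And>G. G \<in> U \<Longrightarrow> \<exists>r>0. \<forall>G'\<in>over_mixing CARD('k). wasserstein 1 G G' < r \<longrightarrow> G' \<in> U"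
      by (auto simp: openin_wasserstein1)
    define V where "V = \<Union>{W. open W \<and> W \<inter> S \<subseteq> ?f -` U}"
    have "open V" unfolding V_def by blast
    have "?f -` U \<inter> S \<subseteq> V"
    proof
      fix x assume x: "x \<in> ?f -` U \<inter> S"
      obtain a \<theta> where x_eq: "x = (a, \<theta>)" by (cases x)
      have aS: "a \<in> prob_simplex" and \<theta>S: "\<And>k. \<theta> k \<in> prob_simplex"
        using x by (auto simp: S_def x_eq)
      obtain r where r: "0 < r" "\<And>G'. G' \<in> over_mixing CARD('k) \<Longrightarrow> wasserstein 1 (?f x) G' < r \<Longrightarrow> G' \<in> U"
        using U(2)[of "?f x"] x by auto
      define s where "s = r / 2 / (1 + 2 * real CARD('k))"
      have s: "0 < s" using r(1) by (simp add: s_def)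
      let ?W = "ball a s \<times> Pi\<^sub>E UNIV (\<lambda>k. ball (\<theta> k) s)"
      have "open ?W" by (intro open_Times open_PiE) auto
      moreover have "x \<in> ?W" using s by (auto simp: x_eq)
      moreover have "?W \<inter> S \<subseteq> ?f -` U"
      proof
        fix y assume y: "y \<in> ?W \<inter> S"
        obtain a' \<theta>' where y_eq: "y = (a', \<theta>')" by (cases y)
        have a'S: "a' \<in> prob_simplex" and \<theta>'S: "\<And>k. \<theta>' k \<in> prob_simplex"
          using y by (auto simp: S_def y_eq)
        have da: "\<bar>a $ k - a' $ k\<bar> \<le> s" for k
          using y component_le_norm_cart[of "a - a'" k] by (auto simp: y_eq dist_norm)
        have "wasserstein 1 (?f x) (?f y) \<le> s + 2 * (\<Sum>k\<in>UNIV. \<bar>a $ k - a' $ k\<bar>)"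
          using y unfolding x_eq y_eq prod.case
          by (intro wasserstein1_mixing_measure_le weights_simplex aS a'S dist_simplex_le_2 \<theta>S \<theta>'S)
            (auto simp: PiE_def Pi_def less_imp_le)
        also have "\<dots> \<le> s + 2 * (\<Sum>k\<in>(UNIV :: 'k set). s)"
          by (intro add_left_mono mult_left_mono sum_mono da) auto
        also have "\<dots> = r / 2"
        proof -
          have "1 + 2 * real CARD('k) \<noteq> 0" by linarith
          then have "s * (1 + 2 * real CARD('k)) = r / 2" unfolding s_def by (rule nonzero_eq_divide_eq[THEN iffD1, OF _ refl])
          then show ?thesis by (simp add: algebra_simps)
        qed
        also have "\<dots> < r" using r(1) by simp
        finally show "y \<in> ?f -` U" using r(2)[OF f] y by auto
      qed
      ultimately show "x \<in> V" unfolding V_def by blast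
    qed
    then have "?f -` U \<inter> space ?M = V \<inter> space ?M" unfolding space V_def by blast
    also have "\<dots> \<in> sets ?M" using measurable_sets[OF id, of V] \<open>open V\<close> by simp
    finally show "?f -` U \<inter> space ?M \<in> sets ?M" .
  qed (use f space in \<open>auto simp: openin_wasserstein1\<close>)
qed

lemma simplex_point_near:
  fixes \<theta> :: "real ^ 'v::finite"
  assumes "\<theta> \<in> prob_simplex" "\<theta>' \<in> prob_simplex" "\<theta>' \<noteq> \<theta>" "finite S" "0 < e"
  obtains \<eta> where "\<eta> \<in> prob_simplex" "\<eta> \<notin> S" "dist \<theta> \<eta> \<le> e"
proof -
  define p where "p t = \<theta> + t *\<^sub>R (\<theta>' - \<theta>)" for t :: real
  define u where "u = min 1 (e / dist \<theta> \<theta>')"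
  have u: "0 < u" using assms by (simp add: u_def)
  have inj: "inj_on p {0<..<u}" using assms(3) by (auto simp: inj_on_def p_def)
  have "infinite (p ` {0<..<u})"
    using u by (simp add: finite_image_iff[OF inj] infinite_Ioo)
  then obtain \<eta> where "\<eta> \<in> p ` {0<..<u}" "\<eta> \<notin> S"
    using assms(4) by (meson finite_subset subsetI)
  then obtain t where t: "0 < t" "t < u" and \<eta>: "\<eta> = p t" "\<eta> \<notin> S" by auto
  have "p t \<in> prob_simplex"
  proof -
    have eq: "p t $ i = (1 - t) * \<theta> $ i + t * \<theta>' $ i" for i
      by (simp add: p_def algebra_simps)
    have "(\<Sum>i\<in>UNIV. p t $ i) = (1 - t) * (\<Sum>i\<in>UNIV. \<theta> $ i) + t * (\<Sum>i\<in>UNIV. \<theta>' $ i)"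
      unfolding eq by (simp add: sum.distrib sum_distrib_left)
    moreover have "0 \<le> p t $ i" for i
      unfolding eq using assms(1,2) t by (intro add_nonneg_nonneg mult_nonneg_nonneg) (auto simp: u_def prob_simplex_def)
    ultimately show ?thesis
      using assms(1,2) by (simp add: prob_simplex_def)
  qed
  moreover have "dist \<theta> (p t) \<le> e"
  proof -
    have "dist \<theta> (p t) = t * dist \<theta> \<theta>'"
      using t(1) by (simp add: p_def dist_norm norm_minus_commute)
    also have "\<dots> \<le> (e / dist \<theta> \<theta>') * dist \<theta> \<theta>'"
      using t by (intro mult_right_mono) (auto simp: u_def)
    finally show ?thesis using assms(3) by simp
  qed
  ultimately show ?thesis using that \<eta> by blast
qed

text \<open>Half of the mass of one atom is moved to a new atom nearby. The map \<open>g\<close> that moves it back provides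
  the coupling.\<close>

lemma exact_mixing_split_atom:
  fixes G :: "(real ^ 'v::finite) pmf" and x y :: "real ^ 'v"
  assumes "G \<in> exact_mixing j" "x \<in> prob_simplex" "y \<in> prob_simplex" "x \<noteq> y" "0 < e"
  obtains G' where "G' \<in> exact_mixing (Suc j)" "wasserstein 1 G G' \<le> e"
proof -
  have fin: "finite (set_pmf G)" using assms(1) by (simp add: exact_mixing_def)
  obtain \<theta> where \<theta>: "\<theta> \<in> set_pmf G" using set_pmf_not_empty[of G] by blast
  have \<theta>S: "\<theta> \<in> prob_simplex" using assms(1) \<theta> by (auto simp: exact_mixing_def)
  obtain \<theta>' where "\<theta>' \<in> prob_simplex" "\<theta>' \<noteq> \<theta>" using assms(2-4) by (cases "x = \<theta>") auto
  then obtain \<eta> where \<eta>: "\<eta> \<in> prob_simplex" "\<eta> \<notin> set_pmf G" "dist \<theta> \<eta> \<le> e"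
    using simplex_point_near[OF \<theta>S _ _ fin assms(5)] by blast
  define G' where "G' = bind_pmf G (\<lambda>x. if x = \<theta> then pmf_of_set {\<theta>, \<eta>} else return_pmf x)"
  define g where "g y = (if y = \<eta> then \<theta> else y)" for y
  have set: "set_pmf G' = insert \<eta> (set_pmf G)"
    using \<theta> by (auto simp: G'_def split: if_splits)
  have "map_pmf g G' = bind_pmf G return_pmf"
    unfolding G'_def map_bind_pmf
  proof (rule bind_pmf_cong[OF refl])
    fix x assume x: "x \<in> set_pmf G"
    have "map_pmf g (pmf_of_set {\<theta>, \<eta>}) = map_pmf (\<lambda>_. \<theta>) (pmf_of_set {\<theta>, \<eta>})"
      by (intro map_pmf_cong) (auto simp: g_def)
    moreover have "x \<noteq> \<eta>" using x \<eta>(2) by auto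
    ultimately show "map_pmf g (if x = \<theta> then pmf_of_set {\<theta>, \<eta>} else return_pmf x) = return_pmf x"
      by (simp add: g_def)
  qed
  then have gG: "map_pmf g G' = G" by (simp add: bind_return_pmf')
  have "map_pmf (\<lambda>y. (g y, y)) G' \<in> transport G G'"
    by (simp add: transport_def map_pmf_comp gG)
  then have "wasserstein 1 G G' \<le> transport_cost (map_pmf (\<lambda>y. (g y, y)) G')"
    by (rule wasserstein1_le)
  also have "\<dots> = measure_pmf.expectation G' (\<lambda>y. dist (g y) y)"
    by (simp add: transport_cost_def)
  also have "\<dots> \<le> measure_pmf.expectation G' (\<lambda>_. e)"
    using fin set \<eta>(3) assms(5) by (intro expectation_mono_finite) (auto simp: g_def)
  finally have "wasserstein 1 G G' \<le> e" by simp
  moreover have "G' \<in> exact_mixing (Suc j)"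
    using assms(1) \<eta> fin by (simp add: exact_mixing_def set)
  ultimately show ?thesis using that by blast
qed

lemma exact_mixing_dense:
  fixes G :: "(real ^ 'v::finite) pmf" and x y :: "real ^ 'v"
  assumes "G \<in> exact_mixing j" "j \<le> k" "x \<in> prob_simplex" "y \<in> prob_simplex" "x \<noteq> y" "0 < e"
  obtains G' where "G' \<in> exact_mixing k" "wasserstein 1 G G' \<le> e"
proof -
  have "\<exists>G'\<in>exact_mixing k. wasserstein 1 G G' \<le> e"
    using assms(2,6)
  proof (induction k arbitrary: e rule: dec_induct)
    case base
    then show ?case using assms(1) wasserstein1_refl[of G] by (intro bexI[of _ G]) auto
  next
    case (step k)
    obtain F where F: "F \<in> exact_mixing k" "wasserstein 1 G F \<le> e / 2"
      using step.IH[of "e / 2"] step.prems by auto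
    obtain H where H: "H \<in> exact_mixing (Suc k)" "wasserstein 1 F H \<le> e / 2"
      using exact_mixing_split_atom[OF F(1) assms(3-5), of "e / 2"] step.prems by auto
    have "wasserstein 1 G H \<le> wasserstein 1 G F + wasserstein 1 F H"
      using assms(1) F(1) H(1) by (intro wasserstein1_triangle) (auto simp: exact_mixing_def)
    then show ?case using F(2) H by (intro bexI[of _ H]) auto
  qed
  then show ?thesis using that by blast
qed

section \<open>Covering the model by a grid\<close>

text \<open>Every mixing measure with at most \<open>K\<close> atoms is written with exactly \<open>K\<close> labels: the atoms are
  labelled injectively, and the spare labels get weight 0 and an arbitrary atom.\<close>

lemma mixing_representation:
  fixes G :: "(real ^ 'v) pmf"
  assumes "G \<in> over_mixing CARD('k::finite)"
  obtains a :: "'k::finite \<Rightarrow> real" and \<theta> :: "'k::finite \<Rightarrow> real ^ 'v"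
  where "weights UNIV a" "\<And>k. \<theta> k \<in> prob_simplex" "G = mixing_measure a \<theta>"
proof -
  let ?S = "set_pmf G"
  have S: "finite ?S" "card ?S \<le> CARD('k)" "?S \<subseteq> prob_simplex"
    using assms by (auto simp: over_mixing_def exact_mixing_def)
  obtain h :: "real ^ 'v \<Rightarrow> 'k" where h: "inj_on h ?S"
    using card_le_inj[OF S(1) finite S(2)] by blast
  obtain s where s: "s \<in> ?S" using set_pmf_not_empty[of G] by blast
  define a where "a = pmf (map_pmf h G)"
  define \<theta> where "\<theta> k = (if k \<in> h ` ?S then inv_into ?S h k else s)" for k
  have a: "weights UNIV a"
    by (simp add: weights_def a_def sum_pmf_eq_1)
  have "embed_pmf a = map_pmf h G"
    by (rule pmf_eqI) (simp only: pmf_embed_weights[OF a], simp add: a_def)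
  then have "mixing_measure a \<theta> = map_pmf (\<lambda>x. \<theta> (h x)) G"
    by (simp add: mixing_measure_def map_pmf_comp)
  also have "\<dots> = map_pmf (\<lambda>x. x) G"
    by (intro map_pmf_cong refl) (simp add: \<theta>_def inv_into_f_f[OF h])
  finally have "G = mixing_measure a \<theta>" by simp
  moreover have "\<theta> k \<in> prob_simplex" for k
    using S(3) s inv_into_into[of k h ?S] by (auto simp: \<theta>_def)
  ultimately show ?thesis using that a by blast
qed

lemma block_moment_mixing_measure_diff:
  fixes a a' :: "'k::finite \<Rightarrow> real" and \<theta> \<theta>' :: "'k \<Rightarrow> real ^ 'v::finite"
  assumes a: "weights UNIV a" "weights UNIV a'"
    and \<theta>: "\<And>k. \<theta> k \<in> prob_simplex" "\<And>k. \<theta>' k \<in> prob_simplex"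
    and d: "\<And>k. \<bar>a k - a' k\<bar> \<le> d" "\<And>k v. \<bar>\<theta> k $ v - \<theta>' k $ v\<bar> \<le> d"
  shows "\<bar>block_moment (mixing_measure a \<theta>) b - block_moment (mixing_measure a' \<theta>') b\<bar>
    \<le> (real CARD('k) + real (length b)) * d"
proof -
  have "block_moment (mixing_measure a \<theta>) b - block_moment (mixing_measure a' \<theta>') b
      = (\<Sum>k\<in>UNIV. a k * block b (\<theta> k) - a' k * block b (\<theta>' k))"
    by (simp add: block_moment_def expectation_mixing_measure[OF a(1)]
        expectation_mixing_measure[OF a(2)] sum_subtractf)
  also have "\<bar>\<dots>\<bar> \<le> (\<Sum>k\<in>UNIV. d + a' k * (real (length b) * d))"
  proof (rule order_trans[OF sum_abs sum_mono])
    fix k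
    have "a k * block b (\<theta> k) - a' k * block b (\<theta>' k)
        = (a k - a' k) * block b (\<theta> k) + a' k * (block b (\<theta> k) - block b (\<theta>' k))"
      by (simp add: algebra_simps)
    also have "\<bar>\<dots>\<bar> \<le> \<bar>a k - a' k\<bar> * \<bar>block b (\<theta> k)\<bar> + \<bar>a' k\<bar> * \<bar>block b (\<theta> k) - block b (\<theta>' k)\<bar>"
      by (metis abs_mult abs_triangle_ineq)
    also have "\<dots> \<le> d * 1 + a' k * (real (length b) * d)"
    proof (intro add_mono mult_mono)
      show "\<bar>a' k\<bar> \<le> a' k" "0 \<le> a' k" using a(2) by (auto simp: weights_def)
      show "\<bar>block b (\<theta> k)\<bar> \<le> 1" using block_bounds[OF \<theta>(1)[of k], of b] by simp
      show "0 \<le> d" using d(1)[of k] by simp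
    qed (use d block_diff[OF \<theta> d(2)] in auto)
    finally show "\<bar>a k * block b (\<theta> k) - a' k * block b (\<theta>' k)\<bar> \<le> d + a' k * (real (length b) * d)"
      by simp
  qed
  also have "\<dots> = (real CARD('k) + real (length b)) * d"
  proof -
    have "(\<Sum>k\<in>UNIV. a' k * (real (length b) * d)) = real (length b) * d"
      using a(2) by (simp add: weights_def flip: sum_distrib_right)
    then show ?thesis by (simp add: sum.distrib algebra_simps)
  qed
  finally show ?thesis .
qed

lemma lda_mass_mixing_measure_diff:
  fixes a a' :: "'k::finite \<Rightarrow> real" and \<theta> \<theta>' :: "'k \<Rightarrow> real ^ 'v::finite"
  assumes "0 < \<alpha>"
    and a: "weights UNIV a" "weights UNIV a'"
    and \<theta>: "\<And>k. \<theta> k \<in> prob_simplex" "\<And>k. \<theta>' k \<in> prob_simplex"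
    and d: "\<And>k. \<bar>a k - a' k\<bar> \<le> d" "\<And>k v. \<bar>\<theta> k $ v - \<theta>' k $ v\<bar> \<le> d"
  shows "\<bar>lda_mass \<alpha> (mixing_measure a \<theta>) xs - lda_mass \<alpha> (mixing_measure a' \<theta>') xs\<bar>
    \<le> real (length xs) * ((real CARD('k) + real (length xs)) * d)"
proof (rule lda_mass_diff[OF assms(1)])
  show "topic_mixing (mixing_measure a \<theta>)" "topic_mixing (mixing_measure a' \<theta>')"
    using a \<theta> by (blast intro: over_mixing_topic mixing_measure_in_over_mixing)+
  fix b :: "'v list" assume "length b \<le> length xs"
  moreover have "0 \<le> d" using d(1)[of undefined] by simp
  ultimately have "(real CARD('k) + real (length b)) * d \<le> (real CARD('k) + real (length xs)) * d"
    by (intro mult_right_mono) auto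
  then show "\<bar>block_moment (mixing_measure a \<theta>) b - block_moment (mixing_measure a' \<theta>') b\<bar>
      \<le> (real CARD('k) + real (length xs)) * d"
    using order_trans[OF block_moment_mixing_measure_diff[OF a]] \<theta> d by blast
qed

text \<open>The code of \<open>G\<close> rounds the coordinates of one fixed representation to a grid of mesh \<open>1 / M\<close>. There
  are \<open>K + K V\<close> coordinates, whatever the document length, so the number of codes is a power of \<open>M + 1\<close>
  with an exponent independent of \<open>N\<close>.\<close>

lemma lda_mass_grid_cover:
  fixes \<alpha> :: real and M :: nat
  assumes "0 < \<alpha>" "0 < M"
  obtains code :: "(real ^ 'v::finite) pmf \<Rightarrow> ('k::finite + 'k::finite \<times> 'v::finite \<Rightarrow> nat)"
  where "\<And>G. G \<in> over_mixing CARD('k::finite) \<Longrightarrow> code G \<in> Pi\<^sub>E UNIV (\<lambda>_. {..M})"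
    and "\<And>G G' xs. G \<in> over_mixing CARD('k::finite) \<Longrightarrow> G' \<in> over_mixing CARD('k::finite) \<Longrightarrow> code G = code G' \<Longrightarrow>
      \<bar>lda_mass \<alpha> G xs - lda_mass \<alpha> G' xs\<bar>
        \<le> real (length xs) * ((real CARD('k::finite) + real (length xs)) * (1 / real M))"
proof -
  define Q where "Q G r \<longleftrightarrow> weights UNIV (fst r) \<and> (\<forall>k. snd r k \<in> prob_simplex) \<and> G = mixing_measure (fst r) (snd r)"
    for G and r :: "('k \<Rightarrow> real) \<times> ('k \<Rightarrow> real ^ 'v)"
  define rep where "rep G = (SOME r. Q G r)" for G
  have rep: "weights UNIV (fst (rep G)) \<and> (\<forall>k. snd (rep G) k \<in> prob_simplex)
      \<and> G = mixing_measure (fst (rep G)) (snd (rep G))"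
    if G: "G \<in> over_mixing CARD('k)" for G
  proof -
    obtain a :: "'k \<Rightarrow> real" and \<theta> where "weights UNIV a" "\<And>k. \<theta> k \<in> prob_simplex" "G = mixing_measure a \<theta>"
      using mixing_representation[OF G] by blast
    then have "Q G (a, \<theta>)" by (simp add: Q_def)
    then have "Q G (rep G)" unfolding rep_def by (rule someI)
    then show ?thesis unfolding Q_def .
  qed
  define cell where "cell x = nat \<lfloor>real M * x\<rfloor>" for x
  have cell_le: "cell x \<le> M" if "x \<le> 1" for x
  proof -
    have "\<lfloor>real M * x\<rfloor> \<le> \<lfloor>real M * 1\<rfloor>" using that by (intro floor_mono mult_left_mono) auto
    then show ?thesis by (simp add: cell_def)
  qed
  have cell_eq: "\<bar>x - y\<bar> \<le> 1 / real M" if "cell x = cell y" "0 \<le> x" "0 \<le> y" for x y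
  proof -
    have "\<lfloor>real M * x\<rfloor> = \<lfloor>real M * y\<rfloor>"
      using that by (simp add: cell_def eq_nat_nat_iff)
    then have "\<bar>real M * x - real M * y\<bar> \<le> 1" by linarith
    then have "real M * \<bar>x - y\<bar> \<le> 1" by (simp add: abs_mult flip: right_diff_distrib)
    then show ?thesis using assms(2) by (simp add: field_simps)
  qed
  define code where "code G z = (case z of Inl k \<Rightarrow> cell (fst (rep G) k) | Inr (k, v) \<Rightarrow> cell (snd (rep G) k $ v))" for G z
  show ?thesis
  proof (rule that[of code])
    fix G :: "(real ^ 'v) pmf" assume G: "G \<in> over_mixing CARD('k)"
    have "fst (rep G) k \<le> 1" for k
    proof -
      have "fst (rep G) k \<le> sum (fst (rep G)) UNIV"
        using rep[OF G] by (intro member_le_sum) (auto simp: weights_def)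
      then show ?thesis using rep[OF G] by (simp add: weights_def)
    qed
    moreover have "snd (rep G) k $ v \<le> 1" for k v
      using rep[OF G] by (intro simplex_coord) auto
    ultimately show "code G \<in> Pi\<^sub>E UNIV (\<lambda>_. {..M})"
      by (auto simp: code_def cell_le split: sum.split)
  next
    fix G G' :: "(real ^ 'v) pmf" and xs :: "'v list"
    assume G: "G \<in> over_mixing CARD('k)" "G' \<in> over_mixing CARD('k)" and eq: "code G = code G'"
    have 1: "\<bar>fst (rep G) k - fst (rep G') k\<bar> \<le> 1 / real M" for k
      using fun_cong[OF eq, of "Inl k"] rep[OF G(1)] rep[OF G(2)]
      by (intro cell_eq) (auto simp: code_def weights_def)
    have 2: "\<bar>snd (rep G) k $ v - snd (rep G') k $ v\<bar> \<le> 1 / real M" for k v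
      using fun_cong[OF eq, of "Inr (k, v)"] rep[OF G(1)] rep[OF G(2)]
      by (intro cell_eq simplex_coord) (auto simp: code_def)
    have "\<bar>lda_mass \<alpha> (mixing_measure (fst (rep G)) (snd (rep G))) xs
        - lda_mass \<alpha> (mixing_measure (fst (rep G')) (snd (rep G'))) xs\<bar>
        \<le> real (length xs) * ((real CARD('k) + real (length xs)) * (1 / real M))"
      by (rule lda_mass_mixing_measure_diff[OF assms(1)]) (use rep[OF G(1)] rep[OF G(2)] 1 2 in auto)
    then show "\<bar>lda_mass \<alpha> G xs - lda_mass \<alpha> G' xs\<bar>
        \<le> real (length xs) * ((real CARD('k) + real (length xs)) * (1 / real M))"
      using rep[OF G(1)] rep[OF G(2)] by simp
  qed
qed

section \<open>Prior mass near the truth\<close>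

lemma regular_prior_ball:
  fixes P :: "(real ^ 'd::finite) measure"
  assumes P: "simplex_prob P" and "regular_prior P"
  obtains c where "0 < c"
    "\<forall>\<^sub>F \<epsilon> in at_right 0. \<forall>\<eta>\<in>msupport P. c * \<epsilon> ^ (CARD('d) - 1) \<le> measure P {x \<in> space P. dist x \<eta> < \<epsilon>}"
proof -
  interpret prob_space P using P by (simp add: simplex_prob_def)
  obtain c where c: "0 < c" "\<forall>\<^sub>F \<epsilon> in at_right 0. c * \<epsilon> ^ (CARD('d) - 1) \<le>
       (INF \<eta>'\<in>msupport P. measure P {\<eta> \<in> msupport P. norm (\<eta> - \<eta>') < \<epsilon>})"
    using assms(2) by (auto simp: regular_prior_def)
  note [measurable] = measurable_simplex_prob_borel[OF P]
  have "measure P {x \<in> msupport P. norm (x - \<eta>) < \<epsilon>} \<le> measure P {x \<in> space P. dist x \<eta> < \<epsilon>}" for \<eta> \<epsilon>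
    by (rule finite_measure_mono) (auto simp: msupport_def dist_norm)
  moreover have "(INF \<eta>'\<in>msupport P. measure P {\<eta> \<in> msupport P. norm (\<eta> - \<eta>') < \<epsilon>})
      \<le> measure P {x \<in> msupport P. norm (x - \<eta>) < \<epsilon>}" if "\<eta> \<in> msupport P" for \<eta> \<epsilon>
    using that by (intro cINF_lower bdd_belowI2[of _ 0]) auto
  ultimately have "\<forall>\<^sub>F \<epsilon> in at_right 0. \<forall>\<eta>\<in>msupport P. c * \<epsilon> ^ (CARD('d) - 1) \<le> measure P {x \<in> space P. dist x \<eta> < \<epsilon>}"
    using c(2) by (elim eventually_mono) (meson order_trans)
  then show ?thesis using that c(1) by blast
qed

lemma prob_space_topics:
  "simplex_prob Pt \<Longrightarrow> prob_space (\<Pi>\<^sub>M k\<in>I. Pt)"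
  by (intro prob_space_PiM) (simp add: simplex_prob_def)

lemma prob_space_parameters:
  "simplex_prob Pa \<Longrightarrow> simplex_prob Pt \<Longrightarrow> prob_space (Pa \<Otimes>\<^sub>M (\<Pi>\<^sub>M k\<in>I. Pt))"
  by (intro prob_space_pair prob_space_topics) (auto simp: simplex_prob_def)

lemma prob_space_mixing_prior:
  fixes Pa :: "(real ^ 'k::finite) measure" and Pt :: "(real ^ 'v::finite) measure"
  assumes "simplex_prob Pa" "simplex_prob Pt"
  shows "prob_space (mixing_prior Pa Pt)"
  unfolding mixing_prior_def
  by (rule prob_space.prob_space_distr[OF prob_space_parameters measurable_mixing_measure]) fact+

lemma sets_mixing_prior [simp]:
  "sets (mixing_prior (Pa :: (real ^ 'k::finite) measure) Pt) = sets (mixing_borel CARD('k))"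
  by (simp add: mixing_prior_def)

lemma space_mixing_prior [simp]:
  "space (mixing_prior (Pa :: (real ^ 'k::finite) measure) Pt) = over_mixing CARD('k)"
  by (simp add: mixing_prior_def)

text \<open>Neighbourhoods in the relative sup distance between mass functions.\<close>

definition lda_ball :: "real \<Rightarrow> nat \<Rightarrow> nat \<Rightarrow> (real ^ 'v) pmf \<Rightarrow> real \<Rightarrow> (real ^ 'v) pmf set" where
  "lda_ball \<alpha> K N G0 s = {G \<in> over_mixing K. \<forall>xs\<in>documents N. \<bar>lda_mass \<alpha> G xs - lda_mass \<alpha> G0 xs\<bar> \<le> s * lda_mass \<alpha> G0 xs}"

lemma finite_documents: "finite (documents N :: 'v::finite list set)"
  unfolding documents_eq_words by (intro finite_words) auto

lemma sets_lda_ball: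
  fixes G0 :: "(real ^ 'v::finite) pmf"
  assumes "0 < \<alpha>"
  shows "lda_ball \<alpha> K N G0 s \<in> sets (mixing_borel K)"
proof -
  have "{G \<in> space (mixing_borel K). \<forall>xs\<in>documents N. \<bar>lda_mass \<alpha> G xs - lda_mass \<alpha> G0 xs\<bar> \<le> s * lda_mass \<alpha> G0 xs}
      \<in> sets (mixing_borel K)"
  proof (rule sets.sets_Collect_finite_All'[OF _ finite_documents])
    fix xs :: "'v list"
    note [measurable] = measurable_lda_mass[OF assms, of xs K]
    show "{G \<in> space (mixing_borel K). \<bar>lda_mass \<alpha> G xs - lda_mass \<alpha> G0 xs\<bar> \<le> s * lda_mass \<alpha> G0 xs} \<in> sets (mixing_borel K)"
      by measurable
  qed (auto simp: documents_def intro!: exI[of _ "replicate N _"])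
  then show ?thesis by (simp add: lda_ball_def)
qed

text \<open>Parameters within \<open>h m\<close> of the truth, a constant multiple of \<open>1 / m\<close>, change every mass by at most a
  constant times \<open>h m\<close>, while every mass of the truth is at least \<open>c0 ^ N\<close>. By independence the prior
  mass of these parameters is a product, whose factors are bounded below by regularity.\<close>

lemma prior_mass_lda_ball:
  fixes Pa :: "(real ^ 'k::finite) measure" and Pt :: "(real ^ 'v::finite) measure"
  assumes "0 < \<alpha>" and P: "simplex_prob Pa" "simplex_prob Pt" and reg: "regular_prior Pa" "regular_prior Pt"
    and a0: "a0 \<in> msupport Pa" and t0: "\<And>k. t0 k \<in> msupport Pt"
    and G0: "G0 = mixing_measure (\<lambda>k. a0 $ k) t0"
    and c0: "0 < c0" "\<And>k v. c0 \<le> t0 k $ v" and N: "1 \<le> N"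
  obtains c where "0 < c" "\<forall>\<^sub>F m in sequentially.
    c * (1 / real m) ^ ((CARD('k) - 1) + (CARD('v) - 1) * CARD('k))
      \<le> measure (mixing_prior Pa Pt) (lda_ball \<alpha> CARD('k) N G0 (1 / (2 * real m)))"
proof -
  interpret Pa: prob_space Pa using P(1) by (simp add: simplex_prob_def)
  interpret Pt: prob_space Pt using P(2) by (simp add: simplex_prob_def)
  let ?T = "\<Pi>\<^sub>M k\<in>(UNIV :: 'k set). Pt"
  interpret T: prob_space ?T by (rule prob_space_topics[OF P(2)])
  interpret PT: pair_prob_space Pa ?T ..
  note [measurable] = measurable_simplex_prob_borel[OF P(1)] measurable_simplex_prob_borel[OF P(2)]
  have a0S: "a0 \<in> prob_simplex" using a0 space_simplex_prob[OF P(1)] by (simp add: msupport_def)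
  have t0S: "t0 k \<in> prob_simplex" for k using t0[of k] space_simplex_prob[OF P(2)] by (simp add: msupport_def)
  have G0o: "G0 \<in> over_mixing CARD('k)"
    unfolding G0 by (intro mixing_measure_in_over_mixing weights_simplex a0S t0S)
  have p0: "c0 ^ N \<le> lda_mass \<alpha> G0 xs" if "xs \<in> documents N" for xs
  proof -
    have "c0 ^ length xs \<le> lda_mass \<alpha> G0 xs"
      using c0 set_mixing_measure[OF weights_simplex[OF a0S], of t0]
      by (intro lda_mass_lower_bound assms(1) over_mixing_topic[OF G0o]) (auto simp: G0)
    then show ?thesis using that by (simp add: documents_def)
  qed
  obtain ca where ca: "0 < ca" "\<forall>\<^sub>F \<epsilon> in at_right 0. \<forall>\<eta>\<in>msupport Pa.
      ca * \<epsilon> ^ (CARD('k) - 1) \<le> measure Pa {x \<in> space Pa. dist x \<eta> < \<epsilon>}"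
    using regular_prior_ball[OF P(1) reg(1)] .
  obtain ct where ct: "0 < ct" "\<forall>\<^sub>F \<epsilon> in at_right 0. \<forall>\<eta>\<in>msupport Pt.
      ct * \<epsilon> ^ (CARD('v) - 1) \<le> measure Pt {x \<in> space Pt. dist x \<eta> < \<epsilon>}"
    using regular_prior_ball[OF P(2) reg(2)] .
  \<comment> \<open>Chosen so that the Lipschitz bound at radius \<open>q / m\<close> equals \<open>c0 ^ N / (2 * m)\<close>.\<close>
  define q where "q = c0 ^ N / (2 * (real N * (real CARD('k) + real N)))"
  have q: "0 < q" using c0(1) N by (simp add: q_def)
  define h where "h m = q * (1 / real m)" for m
  have h_lim: "filterlim h (at_right 0) sequentially"
  proof -
    have "h \<longlonglongrightarrow> q * 0" unfolding h_def by (intro tendsto_mult tendsto_const lim_1_over_n)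
    moreover have "\<forall>\<^sub>F m in sequentially. h m \<in> {0<..} \<and> h m \<noteq> 0"
      using eventually_gt_at_top[of 0] by eventually_elim (use q in \<open>simp add: h_def\<close>)
    ultimately show ?thesis by (simp add: filterlim_at)
  qed
  define c where "c = ca * q ^ (CARD('k) - 1) * (ct * q ^ (CARD('v) - 1)) ^ CARD('k)"
  have c: "0 < c" using ca(1) ct(1) q by (simp add: c_def)
  have "\<forall>\<^sub>F m in sequentially. c * (1 / real m) ^ ((CARD('k) - 1) + (CARD('v) - 1) * CARD('k))
      \<le> measure (mixing_prior Pa Pt) (lda_ball \<alpha> CARD('k) N G0 (1 / (2 * real m)))"
    using eventually_compose_filterlim[OF ca(2) h_lim] eventually_compose_filterlim[OF ct(2) h_lim]
      eventually_gt_at_top[of 0]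
  proof eventually_elim
    case (elim m)
    let ?A = "{x \<in> space Pa. dist x a0 < h m}"
    let ?B = "\<lambda>k. {x \<in> space Pt. dist x (t0 k) < h m}"
    let ?L = "lda_ball \<alpha> CARD('k) N G0 (1 / (2 * real m))"
    let ?f = "\<lambda>(a :: real ^ 'k, \<theta>). mixing_measure (\<lambda>k. a $ k) \<theta> :: (real ^ 'v) pmf"
    have h0: "0 < h m" using elim(3) q by (simp add: h_def)
    have [measurable]: "?A \<in> sets Pa" "?B k \<in> sets Pt" for k by measurable
    have sub: "?A \<times> Pi\<^sub>E UNIV ?B \<subseteq> ?f -` ?L \<inter> space (Pa \<Otimes>\<^sub>M ?T)"
    proof
      fix z assume z: "z \<in> ?A \<times> Pi\<^sub>E UNIV ?B"
      obtain a \<theta> where zeq: "z = (a, \<theta>)" by (cases z)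
      have a: "a \<in> prob_simplex" "dist a a0 < h m" and \<theta>: "\<And>k. \<theta> k \<in> prob_simplex" "\<And>k. dist (\<theta> k) (t0 k) < h m"
        using z space_simplex_prob[OF P(1)] space_simplex_prob[OF P(2)] by (auto simp: zeq PiE_def Pi_def)
      have d: "\<bar>a $ k - a0 $ k\<bar> \<le> h m" for k
        using a(2) component_le_norm_cart[of "a - a0" k] by (simp add: dist_norm)
      have d': "\<bar>\<theta> k $ v - t0 k $ v\<bar> \<le> h m" for k v
        using \<theta>(2)[of k] component_le_norm_cart[of "\<theta> k - t0 k" v] by (simp add: dist_norm)
      have "?f z \<in> ?L"
        unfolding lda_ball_def zeq prod.case
      proof (intro CollectI conjI ballI)
        show "mixing_measure (\<lambda>k. a $ k) \<theta> \<in> over_mixing CARD('k)"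
          by (intro mixing_measure_in_over_mixing weights_simplex a \<theta>)
        fix xs :: "'v list" assume xs: "xs \<in> documents N"
        have "\<bar>lda_mass \<alpha> (mixing_measure (\<lambda>k. a $ k) \<theta>) xs - lda_mass \<alpha> G0 xs\<bar>
            \<le> real (length xs) * ((real CARD('k) + real (length xs)) * h m)"
          unfolding G0 by (intro lda_mass_mixing_measure_diff assms(1) weights_simplex a a0S \<theta> t0S d d')
        also have "\<dots> = c0 ^ N / (2 * real m)"
        proof -
          have "real N * (real CARD('k) + real N) \<noteq> 0" using N by simp
          then show ?thesis using xs by (simp add: documents_def h_def q_def)
        qed
        also have "\<dots> \<le> 1 / (2 * real m) * lda_mass \<alpha> G0 xs"
          using p0[OF xs] by (simp add: divide_right_mono)
        finally show "\<bar>lda_mass \<alpha> (mixing_measure (\<lambda>k. a $ k) \<theta>) xs - lda_mass \<alpha> G0 xs\<bar>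
          \<le> 1 / (2 * real m) * lda_mass \<alpha> G0 xs" .
      qed
      then show "z \<in> ?f -` ?L \<inter> space (Pa \<Otimes>\<^sub>M ?T)"
        using z by (auto simp: space_pair_measure space_PiM zeq PiE_def Pi_def)
    qed
    have "c * (1 / real m) ^ ((CARD('k) - 1) + (CARD('v) - 1) * CARD('k))
        = (ca * h m ^ (CARD('k) - 1)) * (ct * h m ^ (CARD('v) - 1)) ^ CARD('k)"
    proof -
      have "ca * q ^ i * (ct * q ^ j) ^ k * x ^ (i + j * k) = (ca * (q * x) ^ i) * (ct * (q * x) ^ j) ^ k"
        for i j k and x :: real
        by (simp add: power_add power_mult power_mult_distrib)
      then show ?thesis unfolding c_def h_def .
    qed
    also have "\<dots> = (ca * h m ^ (CARD('k) - 1)) * (\<Prod>k\<in>(UNIV :: 'k set). ct * h m ^ (CARD('v) - 1))"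
      by simp
    also have "\<dots> \<le> measure Pa ?A * (\<Prod>k\<in>UNIV. measure Pt (?B k))"
      using elim(1,2) a0 t0 ca(1) ct(1) h0
      by (intro mult_mono prod_mono prod_nonneg conjI ballI) (auto intro!: mult_nonneg_nonneg)
    also have "\<dots> = measure (Pa \<Otimes>\<^sub>M ?T) (?A \<times> Pi\<^sub>E UNIV ?B)"
    proof -
      interpret F: finite_product_prob_space "\<lambda>_. Pt" "UNIV :: 'k set"
        by standard auto
      have "measure (Pa \<Otimes>\<^sub>M ?T) (?A \<times> Pi\<^sub>E UNIV ?B) = measure Pa ?A * measure ?T (Pi\<^sub>E UNIV ?B)"
        unfolding measure_def by (subst T.emeasure_pair_measure_Times) (auto simp: enn2real_mult)
      also have "measure ?T (Pi\<^sub>E UNIV ?B) = (\<Prod>k\<in>UNIV. measure Pt (?B k))"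
        by (rule F.prob_times) simp
      finally show ?thesis by simp
    qed
    also have "\<dots> \<le> measure (Pa \<Otimes>\<^sub>M ?T) (?f -` ?L \<inter> space (Pa \<Otimes>\<^sub>M ?T))"
      by (intro PT.finite_measure_mono sub measurable_sets[OF measurable_mixing_measure[OF P]] sets_lda_ball assms(1))
    also have "\<dots> = measure (mixing_prior Pa Pt) ?L"
      unfolding mixing_prior_def
      by (rule measure_distr[symmetric]) (intro measurable_mixing_measure P sets_lda_ball assms(1))+
    finally show ?case .
  qed
  then show ?thesis using that c by blast
qed

section \<open>Uniform control of likelihood ratios\<close>

text \<open>Markov's inequality for a product over independent observations.\<close>

lemma prob_prod_ge_le:
  fixes p0 f :: "'x \<Rightarrow> real"
  assumes "finite \<Omega>" and p0: "\<And>x. x \<in> \<Omega> \<Longrightarrow> 0 \<le> p0 x" "sum p0 \<Omega> = 1"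
    and f: "\<And>x. x \<in> \<Omega> \<Longrightarrow> 0 \<le> f x" and "0 < t"
  defines "P \<equiv> \<Pi>\<^sub>M i\<in>(UNIV :: nat set). point_measure \<Omega> (\<lambda>x. ennreal (p0 x))"
  shows "{X \<in> space P. t \<le> (\<Prod>i<m. f (X i))} \<in> sets P"
    and "measure P {X \<in> space P. t \<le> (\<Prod>i<m. f (X i))} \<le> (\<Sum>x\<in>\<Omega>. f x * p0 x) ^ m / t"
proof -
  let ?\<mu> = "point_measure \<Omega> (\<lambda>x. ennreal (p0 x))"
  have prob: "prob_space ?\<mu>"
  proof
    have "(\<Sum>x\<in>\<Omega>. ennreal (p0 x)) = ennreal (sum p0 \<Omega>)" using p0 by (intro sum_ennreal) auto
    then show "emeasure ?\<mu> (space ?\<mu>) = 1"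
      using assms(1) p0(2) by (simp add: space_point_measure emeasure_point_measure_finite)
  qed
  interpret prob_space ?\<mu> by (rule prob)
  interpret product_prob_space "\<lambda>_::nat. ?\<mu>" UNIV
    by standard
  have fm: "g \<in> borel_measurable ?\<mu>" for g :: "'x \<Rightarrow> real"
    by (simp add: measurable_point_measure_eq1)
  have fX[measurable]: "(\<lambda>X. f (X i)) \<in> borel_measurable P" for i
  proof -
    have "(\<lambda>X. X i) \<in> P \<rightarrow>\<^sub>M ?\<mu>" unfolding P_def by (rule measurable_component_singleton) simp
    from measurable_compose[OF this fm] show ?thesis .
  qed
  have sp: "X i \<in> \<Omega>" if "X \<in> space P" for X i
    using that by (auto simp: P_def space_PiM space_point_measure PiE_def Pi_def)
  show "{X \<in> space P. t \<le> (\<Prod>i<m. f (X i))} \<in> sets P"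
    by measurable
  let ?g = "\<lambda>x. ennreal (f x)"
  have "(\<integral>\<^sup>+X. (\<Prod>i<m. ?g (X i)) \<partial>P) = (\<integral>\<^sup>+X. (\<Prod>i<m. ?g (restrict X {..<m} i)) \<partial>P)"
    by (intro nn_integral_cong prod.cong) auto
  also have "\<dots> = (\<integral>\<^sup>+X. (\<Prod>i<m. ?g (X i)) \<partial>distr P (\<Pi>\<^sub>M i\<in>{..<m}. ?\<mu>) (\<lambda>X. restrict X {..<m}))"
  proof (rule nn_integral_distr[symmetric])
    show "(\<lambda>X. restrict X {..<m}) \<in> P \<rightarrow>\<^sub>M (\<Pi>\<^sub>M i\<in>{..<m}. ?\<mu>)"
      unfolding P_def by (rule measurable_restrict_subset) simp
    have "(\<lambda>X. \<Prod>i<m. ?g (X i)) \<in> borel_measurable (\<Pi>\<^sub>M i\<in>{..<m}. ?\<mu>)"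
    proof (intro borel_measurable_prod_ennreal)
      fix i assume "i \<in> {..<m}"
      then have "(\<lambda>X. X i) \<in> (\<Pi>\<^sub>M i\<in>{..<m}. ?\<mu>) \<rightarrow>\<^sub>M ?\<mu>" by (rule measurable_component_singleton)
      from measurable_compose[OF this measurable_compose[OF fm measurable_ennreal]]
      show "(\<lambda>X. ?g (X i)) \<in> borel_measurable (\<Pi>\<^sub>M i\<in>{..<m}. ?\<mu>)" .
    qed
    then show "(\<lambda>X. \<Prod>i<m. ?g (X i))
        \<in> borel_measurable (distr P (\<Pi>\<^sub>M i\<in>{..<m}. ?\<mu>) (\<lambda>X. restrict X {..<m}))"
      by simp
  qed
  also have "distr P (\<Pi>\<^sub>M i\<in>{..<m}. ?\<mu>) (\<lambda>X. restrict X {..<m}) = (\<Pi>\<^sub>M i\<in>{..<m}. ?\<mu>)"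
    unfolding P_def by (rule distr_PiM_restrict_finite) auto
  also have "(\<integral>\<^sup>+X. (\<Prod>i<m. ?g (X i)) \<partial>(\<Pi>\<^sub>M i\<in>{..<m}. ?\<mu>)) = (\<Prod>i<m. (\<integral>\<^sup>+x. ?g x \<partial>?\<mu>))"
    by (rule product_nn_integral_prod) (auto intro: measurable_compose[OF fm measurable_ennreal])
  also have "(\<integral>\<^sup>+x. ?g x \<partial>?\<mu>) = ennreal (\<Sum>x\<in>\<Omega>. f x * p0 x)"
  proof -
    have "(\<integral>\<^sup>+x. ?g x \<partial>?\<mu>) = (\<Sum>x\<in>\<Omega>. ennreal (p0 x) * ?g x)"
      by (rule nn_integral_point_measure_finite[OF assms(1)])
    also have "\<dots> = (\<Sum>x\<in>\<Omega>. ennreal (f x * p0 x))"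
      using f p0 by (intro sum.cong refl) (simp add: ennreal_mult' mult.commute)
    also have "\<dots> = ennreal (\<Sum>x\<in>\<Omega>. f x * p0 x)"
      using f p0 by (intro sum_ennreal) auto
    finally show ?thesis .
  qed
  finally have int: "(\<integral>\<^sup>+X. (\<Prod>i<m. ?g (X i)) \<partial>P) = ennreal ((\<Sum>x\<in>\<Omega>. f x * p0 x) ^ m)"
    using f p0 by (simp add: ennreal_power sum_nonneg)
  have "{X \<in> space P. t \<le> (\<Prod>i<m. f (X i))} \<subseteq> {X \<in> space P. 1 \<le> ennreal (1 / t) * (\<Prod>i<m. ?g (X i))}"
  proof safe
    fix X assume X: "X \<in> space P" and t: "t \<le> (\<Prod>i<m. f (X i))"
    have "(\<Prod>i<m. ?g (X i)) = ennreal (\<Prod>i<m. f (X i))"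
      using f sp[OF X] by (intro prod_ennreal) auto
    moreover have "1 \<le> 1 / t * (\<Prod>i<m. f (X i))" using t assms(5) by simp
    ultimately show "1 \<le> ennreal (1 / t) * (\<Prod>i<m. ?g (X i))"
      using assms(5) by (simp flip: ennreal_mult' ennreal_1)
  qed
  then have "emeasure P {X \<in> space P. t \<le> (\<Prod>i<m. f (X i))}
      \<le> emeasure P {X \<in> space P. 1 \<le> ennreal (1 / t) * (\<Prod>i<m. ?g (X i))}"
    by (rule emeasure_mono) measurable
  also have "\<dots> \<le> ennreal (1 / t) * (\<integral>\<^sup>+X. (\<Prod>i<m. ?g (X i)) * indicator (space P) X \<partial>P)"
    by (rule nn_integral_Markov_inequality) measurable
  also have "(\<integral>\<^sup>+X. (\<Prod>i<m. ?g (X i)) * indicator (space P) X \<partial>P) = (\<integral>\<^sup>+X. (\<Prod>i<m. ?g (X i)) \<partial>P)"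
    by (intro nn_integral_cong) auto
  finally have "emeasure P {X \<in> space P. t \<le> (\<Prod>i<m. f (X i))} \<le> ennreal (1 / t * (\<Sum>x\<in>\<Omega>. f x * p0 x) ^ m)"
    unfolding int using assms(5) by (simp only: ennreal_mult' zero_le_divide_1_iff less_imp_le)
  then have "enn2real (emeasure P {X \<in> space P. t \<le> (\<Prod>i<m. f (X i))}) \<le> 1 / t * (\<Sum>x\<in>\<Omega>. f x * p0 x) ^ m"
    using f p0 assms(5)
    by (intro enn2real_leI mult_nonneg_nonneg zero_le_power sum_nonneg) auto
  then show "measure P {X \<in> space P. t \<le> (\<Prod>i<m. f (X i))} \<le> (\<Sum>x\<in>\<Omega>. f x * p0 x) ^ m / t"
    by (simp add: measure_def)
qed

lemma hellinger_affinity: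
  assumes "finite \<Omega>" "\<And>x. x \<in> \<Omega> \<Longrightarrow> 0 \<le> p x" "\<And>x. x \<in> \<Omega> \<Longrightarrow> 0 \<le> p' x"
    and "sum p \<Omega> = 1" "sum p' \<Omega> = 1"
  shows "(\<Sum>x\<in>\<Omega>. sqrt (p x * p' x)) = 1 - (hellinger_dist \<Omega> p p')\<^sup>2"
proof -
  have "(hellinger_dist \<Omega> p p')\<^sup>2 = 1 / 2 * (\<Sum>x\<in>\<Omega>. (sqrt (p x) - sqrt (p' x))\<^sup>2)"
    unfolding hellinger_dist_def by (intro real_sqrt_pow2 mult_nonneg_nonneg sum_nonneg) auto
  also have "(\<Sum>x\<in>\<Omega>. (sqrt (p x) - sqrt (p' x))\<^sup>2) = (\<Sum>x\<in>\<Omega>. p x + p' x - 2 * sqrt (p x * p' x))"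
    using assms by (intro sum.cong) (auto simp: power2_diff real_sqrt_mult)
  also have "\<dots> = 2 - 2 * (\<Sum>x\<in>\<Omega>. sqrt (p x * p' x))"
    using assms by (simp add: sum.distrib sum_subtractf flip: sum_distrib_left)
  finally show ?thesis by simp
qed

lemma tv_dist_le_hellinger:
  assumes "finite \<Omega>" "\<And>x. x \<in> \<Omega> \<Longrightarrow> 0 \<le> p x" "\<And>x. x \<in> \<Omega> \<Longrightarrow> 0 \<le> p' x"
    and "sum p \<Omega> = 1" "sum p' \<Omega> = 1"
  shows "tv_dist \<Omega> p p' \<le> sqrt 2 * hellinger_dist \<Omega> p p'"
proof -
  let ?d = "\<lambda>x. \<bar>sqrt (p x) - sqrt (p' x)\<bar>" and ?s = "\<lambda>x. sqrt (p x) + sqrt (p' x)"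
  have h: "(hellinger_dist \<Omega> p p')\<^sup>2 = 1 / 2 * (\<Sum>x\<in>\<Omega>. (?d x)\<^sup>2)"
    unfolding hellinger_dist_def by (subst real_sqrt_pow2) (auto intro!: sum_nonneg)
  have "(\<Sum>x\<in>\<Omega>. \<bar>p x - p' x\<bar>) = (\<Sum>x\<in>\<Omega>. ?d x * ?s x)"
  proof (intro sum.cong refl)
    fix x assume "x \<in> \<Omega>"
    then have "p x - p' x = (sqrt (p x) - sqrt (p' x)) * ?s x"
      using assms(2,3)[of x] by (simp add: algebra_simps)
    then show "\<bar>p x - p' x\<bar> = ?d x * ?s x"
      using assms(2,3)[OF \<open>x \<in> \<Omega>\<close>] by (simp add: abs_mult)
  qed
  then have "(\<Sum>x\<in>\<Omega>. \<bar>p x - p' x\<bar>)\<^sup>2 \<le> (\<Sum>x\<in>\<Omega>. (?d x)\<^sup>2) * (\<Sum>x\<in>\<Omega>. (?s x)\<^sup>2)"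
    using Cauchy_Schwarz_ineq_sum[of ?d ?s \<Omega>] by simp
  also have "\<dots> \<le> (\<Sum>x\<in>\<Omega>. (?d x)\<^sup>2) * 4"
  proof (intro mult_left_mono sum_nonneg)
    have "(\<Sum>x\<in>\<Omega>. (?s x)\<^sup>2) \<le> (\<Sum>x\<in>\<Omega>. 2 * p x + 2 * p' x)"
    proof (rule sum_mono)
      fix x assume x: "x \<in> \<Omega>"
      have "(?s x)\<^sup>2 \<le> 2 * (sqrt (p x))\<^sup>2 + 2 * (sqrt (p' x))\<^sup>2"
        using zero_le_power2[of "sqrt (p x) - sqrt (p' x)"] by (simp only: power2_sum power2_diff)
      then show "(?s x)\<^sup>2 \<le> 2 * p x + 2 * p' x" using assms(2,3)[OF x] by simp
    qed
    then show "(\<Sum>x\<in>\<Omega>. (?s x)\<^sup>2) \<le> 4"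
      using assms(4,5) by (simp add: sum.distrib flip: sum_distrib_left)
  qed auto
  also have "\<dots> = (2 * (sqrt 2 * hellinger_dist \<Omega> p p'))\<^sup>2"
    unfolding power_mult_distrib h by simp
  finally have "(\<Sum>x\<in>\<Omega>. \<bar>p x - p' x\<bar>) \<le> 2 * (sqrt 2 * hellinger_dist \<Omega> p p')"
    by (rule power2_le_imp_le) (simp add: hellinger_dist_def sum_nonneg)
  then show ?thesis by (simp add: tv_dist_def)
qed

text \<open>One fixed mass function far from \<open>p0\<close> is unlikely to fit the sample well, because the expected
  square root of its likelihood ratio is the \<open>m\<close>-th power of its affinity with \<open>p0\<close>. To control all of
  \<open>A\<close> at once, each cell of the covering is dominated by one representative plus \<open>\<delta>\<close>. The bound on
  \<open>\<delta>\<close> keeps the resulting change of the \<open>m\<close>-th power below a factor \<open>exp 1\<close>.\<close>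

lemma likelihood_ratio_deviation:
  fixes p0 :: "'x \<Rightarrow> real" and p :: "'g \<Rightarrow> 'x \<Rightarrow> real" and code :: "'g \<Rightarrow> 'c"
  assumes \<Omega>: "finite \<Omega>"
    and p0: "\<And>x. x \<in> \<Omega> \<Longrightarrow> 0 < p0 x" "sum p0 \<Omega> = 1"
    and p: "\<And>G x. G \<in> A \<Longrightarrow> x \<in> \<Omega> \<Longrightarrow> 0 \<le> p G x" "\<And>G. G \<in> A \<Longrightarrow> sum (p G) \<Omega> = 1"
    and far: "\<And>G. G \<in> A \<Longrightarrow> r \<le> hellinger_dist \<Omega> (p G) p0" "0 \<le> r"
    and code: "code ` A \<subseteq> Z" "finite Z"
      "\<And>G G' x. G \<in> A \<Longrightarrow> G' \<in> A \<Longrightarrow> code G = code G' \<Longrightarrow> x \<in> \<Omega> \<Longrightarrow> \<bar>p G x - p G' x\<bar> \<le> \<delta>"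
    and \<delta>: "0 \<le> \<delta>" "sqrt \<delta> * real (card \<Omega>) \<le> 1 / real m" and m: "0 < m"
  defines "P \<equiv> \<Pi>\<^sub>M i\<in>(UNIV :: nat set). point_measure \<Omega> (\<lambda>x. ennreal (p0 x))"
  obtains E where "E \<in> sets P" "measure P E \<le> real (card Z) * exp (1 - real m * r\<^sup>2 / 2)"
    "\<And>X G. X \<in> space P - E \<Longrightarrow> G \<in> A \<Longrightarrow>
      (\<Prod>i<m. p G (X i)) \<le> exp (- (real m * r\<^sup>2)) * (\<Prod>i<m. p0 (X i))"
proof -
  define rep where "rep c = (SOME G. G \<in> A \<and> code G = c)" for c
  have rep: "rep c \<in> A" "code (rep c) = c" if "c \<in> code ` A" for c
  proof -
    have "\<exists>G. G \<in> A \<and> code G = c" using that by auto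
    from someI_ex[OF this] show "rep c \<in> A" "code (rep c) = c" by (auto simp: rep_def)
  qed
  define f where "f c x = sqrt ((p (rep c) x + \<delta>) / p0 x)" for c x
  \<comment> \<open>The square root of the level for the likelihood ratio, as \<open>f\<close> is a square root.\<close>
  define t where "t = exp (- (real m * r\<^sup>2 / 2))"
  define F where "F c = {X \<in> space P. t \<le> (\<Prod>i<m. f c (X i))}" for c
  define E where "E = (\<Union>c\<in>code ` A. F c)"
  have fin: "finite (code ` A)" using code(1,2) by (rule finite_subset)
  have f0: "0 \<le> f c x" if "c \<in> code ` A" "x \<in> \<Omega>" for c x
    using p(1)[OF rep(1)[OF that(1)] that(2)] p0(1)[OF that(2)] \<delta>(1) by (simp add: f_def)
  have t0: "0 < t" by (simp add: t_def)
  have F: "F c \<in> sets P" "measure P (F c) \<le> exp (1 - real m * r\<^sup>2 / 2)" if c: "c \<in> code ` A" for c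
  proof -
    have p00: "0 \<le> p0 x" if "x \<in> \<Omega>" for x using p0(1)[OF that] by simp
    have f00: "0 \<le> f c x" if "x \<in> \<Omega>" for x using f0[OF c that] .
    show "F c \<in> sets P" unfolding F_def P_def by (rule prob_prod_ge_le[OF \<Omega> p00 p0(2) f00 t0])
    have M: "measure P (F c) \<le> (\<Sum>x\<in>\<Omega>. f c x * p0 x) ^ m / t"
      unfolding F_def P_def by (rule prob_prod_ge_le[OF \<Omega> p00 p0(2) f00 t0])
    have p0_le: "p0 x \<le> 1" if "x \<in> \<Omega>" for x
      using member_le_sum[of x \<Omega> p0] that p0 \<Omega> by (simp add: less_imp_le)
    have "(\<Sum>x\<in>\<Omega>. f c x * p0 x) \<le> (\<Sum>x\<in>\<Omega>. sqrt (p (rep c) x * p0 x) + sqrt \<delta>)"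
    proof (rule sum_mono)
      fix x assume x: "x \<in> \<Omega>"
      have pos: "0 \<le> p (rep c) x" "0 < p0 x" using p(1) rep(1)[OF c] p0(1) x by auto
      have "f c x * p0 x = sqrt ((p (rep c) x + \<delta>) / p0 x * (p0 x)\<^sup>2)"
        unfolding real_sqrt_mult f_def using pos by simp
      also have "(p (rep c) x + \<delta>) / p0 x * (p0 x)\<^sup>2 = p (rep c) x * p0 x + \<delta> * p0 x"
        using pos by (simp add: power2_eq_square field_simps)
      also have "sqrt \<dots> \<le> sqrt (p (rep c) x * p0 x) + sqrt (\<delta> * p0 x)"
        using pos \<delta>(1) by (intro sqrt_add_le_add_sqrt) auto
      also have "sqrt (\<delta> * p0 x) \<le> sqrt \<delta>"
        using \<delta>(1) p0_le[OF x] pos by (intro real_sqrt_le_mono) (simp add: mult_left_le)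
      finally show "f c x * p0 x \<le> sqrt (p (rep c) x * p0 x) + sqrt \<delta>" by simp
    qed
    also have "\<dots> = 1 - (hellinger_dist \<Omega> (p (rep c)) p0)\<^sup>2 + sqrt \<delta> * real (card \<Omega>)"
      using rep(1)[OF c] p0(1) by (simp add: sum.distrib hellinger_affinity[OF \<Omega> p(1) less_imp_le[OF p0(1)] p(2) p0(2)])
    also have "\<dots> \<le> 1 + (1 / real m - r\<^sup>2)"
      using \<delta>(2) power_mono[OF far(1)[OF rep(1)[OF c]] far(2), of 2] by simp
    also have "\<dots> \<le> exp (1 / real m - r\<^sup>2)" by (rule exp_ge_add_one_self)
    finally have "(\<Sum>x\<in>\<Omega>. f c x * p0 x) ^ m \<le> exp (1 / real m - r\<^sup>2) ^ m"
      using f0[OF c] p0(1) by (intro power_mono sum_nonneg mult_nonneg_nonneg) (auto intro: less_imp_le)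
    also have "\<dots> = exp (1 - real m * r\<^sup>2)"
      using m by (simp add: algebra_simps flip: exp_of_nat_mult)
    finally have "(\<Sum>x\<in>\<Omega>. f c x * p0 x) ^ m / t \<le> exp (1 - real m * r\<^sup>2) / t"
      using t0 by (intro divide_right_mono) auto
    also have "\<dots> = exp (1 - real m * r\<^sup>2 / 2)"
      by (simp add: t_def flip: exp_diff)
    finally show "measure P (F c) \<le> exp (1 - real m * r\<^sup>2 / 2)"
      using M by linarith
  qed
  show ?thesis
  proof (rule that)
    show "E \<in> sets P" unfolding E_def using fin F(1) by (intro sets.finite_UN)
    have "measure P E \<le> (\<Sum>c\<in>code ` A. measure P (F c))"
      unfolding E_def using fin F(1) by (intro measure_UNION_le) auto
    also have "\<dots> \<le> (\<Sum>c\<in>code ` A. exp (1 - real m * r\<^sup>2 / 2))"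
      by (intro sum_mono F(2))
    also have "\<dots> \<le> real (card Z) * exp (1 - real m * r\<^sup>2 / 2)"
      using card_mono[OF code(2,1)] by (simp add: mult_right_mono)
    finally show "measure P E \<le> real (card Z) * exp (1 - real m * r\<^sup>2 / 2)" .
  next
    fix X G assume X: "X \<in> space P - E" and G: "G \<in> A"
    let ?c = "code G"
    have c: "?c \<in> code ` A" using G by simp
    have X\<Omega>: "X i \<in> \<Omega>" for i
      using X by (auto simp: P_def space_PiM space_point_measure PiE_def Pi_def)
    have "(\<Prod>i<m. f ?c (X i)) \<le> t"
      using X c by (auto simp: E_def F_def)
    then have sq: "(\<Prod>i<m. f ?c (X i))\<^sup>2 \<le> t\<^sup>2"
      using f0[OF c X\<Omega>] by (intro power_mono prod_nonneg) auto
    have "(\<Prod>i<m. p G (X i)) \<le> (\<Prod>i<m. (f ?c (X i))\<^sup>2 * p0 (X i))"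
    proof (intro prod_mono conjI)
      fix i
      have "p G (X i) \<le> p (rep ?c) (X i) + \<delta>"
        using code(3)[OF G rep(1)[OF c] rep(2)[OF c, symmetric] X\<Omega>[of i]] by linarith
      also have "\<dots> = (f ?c (X i))\<^sup>2 * p0 (X i)"
        using p(1)[OF rep(1)[OF c] X\<Omega>[of i]] p0(1)[OF X\<Omega>[of i]] \<delta>(1) by (simp add: f_def)
      finally show "p G (X i) \<le> (f ?c (X i))\<^sup>2 * p0 (X i)" .
    qed (use p(1)[OF G X\<Omega>] in auto)
    also have "\<dots> = (\<Prod>i<m. f ?c (X i))\<^sup>2 * (\<Prod>i<m. p0 (X i))"
      by (simp add: prod.distrib prod_power_distrib)
    also have "\<dots> \<le> t\<^sup>2 * (\<Prod>i<m. p0 (X i))"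
      using p0(1)[OF X\<Omega>] by (intro mult_right_mono sq prod_nonneg) (auto intro: less_imp_le)
    also have "t\<^sup>2 = exp (- (real m * r\<^sup>2))"
      by (simp add: t_def power2_eq_square flip: exp_add)
    finally show "(\<Prod>i<m. p G (X i)) \<le> exp (- (real m * r\<^sup>2)) * (\<Prod>i<m. p0 (X i))" .
  qed
qed

section \<open>Posterior contraction\<close>

text \<open>The factor 2 is Bernoulli's inequality \<open>(1 - 1 / (2 * m)) ^ m \<ge> 1 / 2\<close>, applied to the likelihood
  ratio on the neighbourhood. The set \<open>B\<close> is arbitrary: if the integrand over \<open>B\<close> fails to be integrable,
  its integral is 0 by convention and the bound still holds.\<close>

lemma posterior_le:
  fixes Q :: "(real ^ 'v::finite) pmf measure" and X :: "nat \<Rightarrow> 'v list"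
  assumes "0 < \<alpha>" and Q: "prob_space Q" "sets Q = sets (mixing_borel K)"
    and X: "\<And>i. X i \<in> documents N" and m: "0 < m"
    and p0: "\<And>xs. xs \<in> documents N \<Longrightarrow> 0 < lda_mass \<alpha> G0 xs"
    and ball: "0 < b" "b \<le> measure Q (lda_ball \<alpha> K N G0 (1 / (2 * real m)))"
    and s: "0 \<le> s" "\<And>G. G \<in> over_mixing K \<Longrightarrow> G \<in> B \<Longrightarrow>
      (\<Prod>i<m. lda_mass \<alpha> G (X i)) \<le> s * (\<Prod>i<m. lda_mass \<alpha> G0 (X i))"
  shows "\<bar>posterior \<alpha> Q m X B\<bar> \<le> 2 * s / b"
proof -
  interpret prob_space Q by (rule Q(1))
  define q where "q = (\<Prod>i<m. lda_mass \<alpha> G0 (X i))"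
  let ?f = "\<lambda>G. \<Prod>i<m. lda_mass \<alpha> G (X i)"
  let ?L = "lda_ball \<alpha> K N G0 (1 / (2 * real m))"
  have sp: "space Q = over_mixing K" using sets_eq_imp_space_eq[OF Q(2)] by simp
  have q: "0 < q" unfolding q_def using p0 X by (intro prod_pos) auto
  have [measurable]: "(\<lambda>G. lda_mass \<alpha> G xs) \<in> borel_measurable Q" for xs
    using measurable_lda_mass[OF assms(1)] by (subst measurable_cong_sets[OF Q(2) refl])
  have L[measurable]: "?L \<in> sets Q" using sets_lda_ball[OF assms(1)] by (simp add: Q(2))
  have f01: "0 \<le> ?f G" "?f G \<le> 1" if "G \<in> over_mixing K" for G
    using lda_mass_bounds[OF assms(1) over_mixing_topic[OF that]] by (auto intro!: prod_nonneg prod_le_1)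
  have int: "integrable Q ?f"
    by (rule integrable_const_bound[of _ 1]) (use f01 in \<open>auto simp: sp intro!: AE_I2\<close>)
  have num0: "0 \<le> (LINT G:B|Q. ?f G)"
    unfolding set_lebesgue_integral_def using f01 by (intro integral_nonneg_AE AE_I2) (auto simp: sp indicator_def)
  have num: "(LINT G:B|Q. ?f G) \<le> s * q"
  proof (cases "integrable Q (\<lambda>G. indicator B G *\<^sub>R ?f G)")
    case True
    have "(LINT G|Q. indicator B G *\<^sub>R ?f G) \<le> (LINT G|Q. s * q)"
      using s q by (intro integral_mono True) (auto simp: sp q_def indicator_def)
    then show ?thesis by (simp add: set_lebesgue_integral_def prob_space)
  next
    case False
    then show ?thesis
      using s(1) q by (simp add: set_lebesgue_integral_def not_integrable_integral_eq)
  qed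
  have low: "q / 2 \<le> ?f G" if G: "G \<in> ?L" for G
  proof -
    have "1 / 2 \<le> (1 - 1 / (2 * real m)) ^ m"
      using Bernoulli_inequality[of "- (1 / (2 * real m))" m] m by (simp add: divide_le_eq)
    then have "q / 2 \<le> q * (1 - 1 / (2 * real m)) ^ m"
      using q by (simp add: mult_left_mono[of "1/2"])
    also have "\<dots> = (\<Prod>i<m. lda_mass \<alpha> G0 (X i) * (1 - 1 / (2 * real m)))"
      by (simp add: q_def prod.distrib)
    also have "\<dots> \<le> ?f G"
    proof (intro prod_mono conjI mult_nonneg_nonneg)
      fix i
      show "0 \<le> lda_mass \<alpha> G0 (X i)" using p0[OF X[of i]] by simp
      show "0 \<le> 1 - 1 / (2 * real m)" using m by simp
      have "\<bar>lda_mass \<alpha> G (X i) - lda_mass \<alpha> G0 (X i)\<bar> \<le> 1 / (2 * real m) * lda_mass \<alpha> G0 (X i)"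
        using G X by (simp add: lda_ball_def)
      then show "lda_mass \<alpha> G0 (X i) * (1 - 1 / (2 * real m)) \<le> lda_mass \<alpha> G (X i)"
        by (simp add: algebra_simps abs_le_iff)
    qed
    finally show ?thesis .
  qed
  have "b * (q / 2) \<le> measure Q ?L * (q / 2)"
    using ball(2) q by (intro mult_right_mono) auto
  also have "\<dots> = (LINT G|Q. indicator ?L G * (q / 2))"
    by simp
  also have "\<dots> \<le> (LINT G|Q. ?f G)"
  proof (rule integral_mono[OF _ int])
    show "integrable Q (\<lambda>G. indicator ?L G * (q / 2))" 
      by (intro integrable_mult_left integrable_real_indicator) (auto simp: less_top[symmetric])
    show "indicator ?L G * (q / 2) \<le> ?f G" if "G \<in> space Q" for G
      using low[of G] f01[of G] that by (auto simp: sp indicator_def)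
  qed
  finally have den: "b * (q / 2) \<le> (LINT G|Q. ?f G)" .
  have "\<bar>posterior \<alpha> Q m X B\<bar> = (LINT G:B|Q. ?f G) / (LINT G|Q. ?f G)"
  proof -
    have "0 \<le> b * (q / 2)" using ball(1) q by simp
    then have "0 \<le> (LINT G|Q. ?f G)" using den by linarith
    then show ?thesis using num0 unfolding posterior_def by simp
  qed
  also have "\<dots> \<le> s * q / (b * (q / 2))"
    using num0 num den ball(1) q s(1) by (intro frac_le) auto
  also have "\<dots> = 2 * s / b"
    using q ball(1) by (simp add: field_simps)
  finally show ?thesis .
qed

text \<open>The true measure, given by a sequence of topics, in terms of the labels of the prior. Labels
  beyond \<open>K0\<close> have weight 0, so their topics are arbitrary.\<close>

lemma mixing_measure_reindex:
  fixes w0 :: "nat \<Rightarrow> real" and \<theta>0 :: "nat \<Rightarrow> 'a" and num :: "'k::finite \<Rightarrow> nat"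
  assumes w0: "weights {..<K0} w0" and num: "bij_betw num UNIV {..<K}" and "K0 \<le> K"
    and t0: "\<And>k. num k < K0 \<Longrightarrow> t0 k = \<theta>0 (num k)"
  shows "mixing_measure w0 \<theta>0 = mixing_measure (\<lambda>k. w0 (num k)) t0"
proof -
  have inj: "inj num" and range: "range num = {..<K}" using num by (auto simp: bij_betw_def)
  have w0': "0 \<le> w0 i" "i \<notin> {..<K0} \<Longrightarrow> w0 i = 0" for i using w0 unfolding weights_def by blast+
  have "(\<Sum>k\<in>UNIV. w0 (num k)) = (\<Sum>i<K. w0 i)"
    by (rule sum.reindex_bij_betw[OF num])
  also have "\<dots> = (\<Sum>i<K0. w0 i)"
    using assms(3) w0' by (intro sum.mono_neutral_right) auto
  also have "\<dots> = 1" using w0 by (simp add: weights_def)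
  finally have w: "weights UNIV (\<lambda>k. w0 (num k))"
    using w0' by (simp add: weights_def)
  have reindex: "map_pmf num (embed_pmf (\<lambda>k. w0 (num k))) = embed_pmf w0"
  proof (rule pmf_eqI)
    fix i
    show "pmf (map_pmf num (embed_pmf (\<lambda>k. w0 (num k)))) i = pmf (embed_pmf w0) i"
    proof (cases "i \<in> range num")
      case True
      then obtain k where i: "i = num k" by blast
      show ?thesis
        unfolding i by (simp add: pmf_map_inj'[OF inj] pmf_embed_weights[OF w] pmf_embed_weights[OF w0])
    next
      case False
      then have "w0 i = 0" using range assms(3) by (intro w0'(2)) auto
      moreover have "pmf (map_pmf num (embed_pmf (\<lambda>k. w0 (num k)))) i = 0"
        using False by (intro pmf_map_outside) auto
      ultimately show ?thesis by (simp add: pmf_embed_weights[OF w0])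
    qed
  qed
  have "mixing_measure w0 \<theta>0 = map_pmf (\<lambda>k. \<theta>0 (num k)) (embed_pmf (\<lambda>k. w0 (num k)))"
    unfolding mixing_measure_def by (simp only: map_pmf_comp flip: reindex)
  also have "\<dots> = map_pmf t0 (embed_pmf (\<lambda>k. w0 (num k)))"
  proof (rule map_pmf_cong[OF refl])
    fix k assume "k \<in> set_pmf (embed_pmf (\<lambda>k. w0 (num k)))"
    then have "w0 (num k) \<noteq> 0" by (simp add: set_embed_weights[OF w])
    then have "num k < K0" using w0'(2)[of "num k"] by fastforce
    then show "\<theta>0 (num k) = t0 k" by (simp add: t0)
  qed
  finally show ?thesis by (simp add: mixing_measure_def)
qed

lemma tv_dist_lda_le_hellinger:
  fixes G G' :: "(real ^ 'v::finite) pmf"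
  assumes "0 < \<alpha>" "topic_mixing G" "topic_mixing G'"
  shows "tv_dist (documents N) (lda_mass \<alpha> G') (lda_mass \<alpha> G)
    \<le> sqrt 2 * hellinger_dist (documents N) (lda_mass \<alpha> G) (lda_mass \<alpha> G')"
proof -
  have "tv_dist (documents N) (lda_mass \<alpha> G') (lda_mass \<alpha> G) = tv_dist (documents N) (lda_mass \<alpha> G) (lda_mass \<alpha> G')"
    by (simp add: tv_dist_def abs_minus_commute)
  then show ?thesis
    using assms tv_dist_le_hellinger[OF finite_documents, of N "lda_mass \<alpha> G" "lda_mass \<alpha> G'"]
    by (simp add: lda_mass_bounds sum_lda_mass)
qed

text \<open>With \<open>D\<close> the exponent of the covering number in the grid size, of order \<open>m\<^sup>2\<close>, and \<open>d\<close> the exponent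
  of the prior mass, the choice \<open>C\<^sup>2 = 2 (2 D + 1 + d)\<close> makes the exceptional probability and the
  posterior outside of it both \<open>O(1 / m)\<close>. The sets \<open>B m\<close> are left general so that sets described
  by a transport distance can be used in their place.\<close>

theorem posterior_contraction_hellinger:
  fixes Pa :: "(real ^ 'k::finite) measure" and Pt :: "(real ^ 'v::finite) measure"
  assumes "0 < \<alpha>" and P: "simplex_prob Pa" "simplex_prob Pt" and reg: "regular_prior Pa" "regular_prior Pt"
    and a0: "a0 \<in> msupport Pa" and t0: "\<And>k. t0 k \<in> msupport Pt"
    and G0: "G0 = mixing_measure (\<lambda>k. a0 $ k) t0"
    and c0: "0 < c0" "\<And>k v. c0 \<le> t0 k $ v"
  obtains C where "0 < C"
    "\<And>N B. 1 \<le> N \<Longrightarrow>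
      (\<And>m G. G \<in> B m \<Longrightarrow> G \<in> over_mixing CARD('k) \<Longrightarrow>
        C * (ln (real (m * N)) / real m) powr (1 / 2)
          \<le> hellinger_dist (documents N) (lda_mass \<alpha> G) (lda_mass \<alpha> G0)) \<Longrightarrow>
      vanishes_in_prob (\<Pi>\<^sub>M i\<in>(UNIV :: nat set). lda_measure \<alpha> G0 N)
        (\<lambda>m X. posterior \<alpha> (mixing_prior Pa Pt) m X (B m))"
proof -
  define D where "D = CARD('k + 'k \<times> 'v)"
  define d where "d = (CARD('k) - 1) + (CARD('v) - 1) * CARD('k)"
  define e where "e = 2 * D + 1 + d"
  define C where "C = sqrt (2 * real e)"
  have C: "0 < C" by (simp add: C_def e_def)
  have a0S: "a0 \<in> prob_simplex" using a0 space_simplex_prob[OF P(1)] by (simp add: msupport_def)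
  have t0S: "t0 k \<in> prob_simplex" for k using t0[of k] space_simplex_prob[OF P(2)] by (simp add: msupport_def)
  have G0o: "G0 \<in> over_mixing CARD('k)"
    unfolding G0 by (intro mixing_measure_in_over_mixing weights_simplex a0S t0S)
  note G0t = over_mixing_topic[OF G0o]
  have p0: "0 < lda_mass \<alpha> G0 xs" for xs
  proof -
    have "c0 ^ length xs \<le> lda_mass \<alpha> G0 xs"
      using c0 set_mixing_measure[OF weights_simplex[OF a0S], of t0]
      by (intro lda_mass_lower_bound assms(1) G0t) (auto simp: G0)
    then show ?thesis using c0(1) by (meson less_le_trans zero_less_power)
  qed
  show ?thesis
  proof (rule that[OF C])
    fix N :: nat and B :: "nat \<Rightarrow> (real ^ 'v) pmf set"
    assume N: "1 \<le> N" and B: "\<And>m G. G \<in> B m \<Longrightarrow> G \<in> over_mixing CARD('k) \<Longrightarrow>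
        C * (ln (real (m * N)) / real m) powr (1 / 2)
          \<le> hellinger_dist (documents N) (lda_mass \<alpha> G) (lda_mass \<alpha> G0)"
    let ?P = "\<Pi>\<^sub>M i\<in>(UNIV :: nat set). lda_measure \<alpha> G0 N"
    let ?post = "\<lambda>m X. posterior \<alpha> (mixing_prior Pa Pt) m X (B m)"
    define L where "L = card (documents N :: 'v list set)"
    define \<kappa> where "\<kappa> = N * (CARD('k) + N) * L\<^sup>2"
    have "replicate N undefined \<in> (documents N :: 'v list set)" by (simp add: documents_def)
    then have L: "0 < L" unfolding L_def using finite_documents by (auto simp: card_gt_0_iff)
    have \<kappa>: "0 < \<kappa>" using N L by (simp add: \<kappa>_def)
    obtain b where b: "0 < b" "\<forall>\<^sub>F m in sequentially. b * (1 / real m) ^ d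
        \<le> measure (mixing_prior Pa Pt) (lda_ball \<alpha> CARD('k) N G0 (1 / (2 * real m)))"
      using prior_mass_lda_ball[OF assms(1) P reg a0 t0 G0 c0 N] unfolding d_def by blast
    show "vanishes_in_prob ?P ?post"
      unfolding vanishes_in_prob_def
    proof (intro allI impI)
      fix \<epsilon> :: real assume \<epsilon>: "0 < \<epsilon>"
      define W where "W m = {X \<in> space ?P. \<epsilon> < \<bar>?post m X\<bar>}" for m
      define g where "g m = (2 * real \<kappa>) ^ D * exp 1 * (1 / real m)" for m
      have "(\<lambda>m. 2 / b * (1 / real m)) \<longlonglongrightarrow> 2 / b * 0"
        by (intro tendsto_mult tendsto_const lim_1_over_n)
      then have small: "\<forall>\<^sub>F m in sequentially. 2 / b * (1 / real m) < \<epsilon>"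
        using \<epsilon> by (intro order_tendstoD(2)[where a = \<epsilon>]) auto
      have "\<forall>\<^sub>F m in sequentially. measure ?P (W m) \<le> g m"
        using b(2) small eventually_gt_at_top[of 0]
      proof eventually_elim
        case (elim m)
        define r where "r = C * (ln (real (m * N)) / real m) powr (1 / 2)"
        define M where "M = \<kappa> * m\<^sup>2"
        define A where "A = {G \<in> over_mixing CARD('k). r \<le> hellinger_dist (documents N) (lda_mass \<alpha> G) (lda_mass \<alpha> G0)}"
        \<comment> \<open>The mesh \<open>1 / M\<close> is fine enough that masses vary by at most \<open>\<delta>\<close> on a cell.\<close>
        define \<delta> where "\<delta> = (1 / (real L * real m))\<^sup>2"
        have m: "0 < m" and mN: "m \<le> m * N" using elim(3) N by auto
        have "1 \<le> m * N" using m mN by linarith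
        then have "real 1 \<le> real (m * N)" by (rule of_nat_mono)
        then have "1 \<le> real (m * N)" by (simp only: of_nat_1)
        then have ln0: "0 \<le> ln (real (m * N))" by (rule ln_ge_zero)
        have "r\<^sup>2 = 2 * real e * (ln (real (m * N)) / real m)"
          using ln0 by (simp add: r_def power_mult_distrib C_def powr_half_sqrt)
        then have mr: "real m * r\<^sup>2 = 2 * (real e * ln (real (m * N)))"
          using m by simp
        have tail: "exp (- (real e * ln (real (m * N)))) \<le> (1 / real m) ^ e"
        proof -
          have "exp (- (real e * ln (real (m * N)))) \<le> exp (- (real e * ln (real m)))"
          proof -
            have "real m \<le> real (m * N)" using mN by (rule of_nat_mono)
            then have "ln (real m) \<le> ln (real (m * N))" using m by (intro ln_mono) simp_all
            then show ?thesis by (simp only: exp_le_cancel_iff neg_le_iff_le mult_left_mono of_nat_0_le_iff)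
          qed
          also have "\<dots> = (1 / real m) ^ e"
            using m by (simp add: exp_minus exp_of_nat_mult power_one_over inverse_eq_divide)
          finally show ?thesis .
        qed
        have tail2: "exp (- (real m * r\<^sup>2)) \<le> (1 / real m) ^ e"
        proof -
          have "0 \<le> real e * ln (real (m * N))" using ln0 by simp
          then have "exp (- (real m * r\<^sup>2)) \<le> exp (- (real e * ln (real (m * N))))"
            unfolding mr by simp
          then show ?thesis using tail by linarith
        qed
        have M: "0 < M" using \<kappa> m by (simp add: M_def)
        obtain code :: "(real ^ 'v) pmf \<Rightarrow> ('k + 'k \<times> 'v \<Rightarrow> nat)"
          where code1: "\<And>G. G \<in> over_mixing CARD('k) \<Longrightarrow> code G \<in> Pi\<^sub>E UNIV (\<lambda>_. {..M})"
            and code2: "\<And>G G' xs. G \<in> over_mixing CARD('k) \<Longrightarrow> G' \<in> over_mixing CARD('k) \<Longrightarrow> code G = code G' \<Longrightarrow>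
              \<bar>lda_mass \<alpha> G xs - lda_mass \<alpha> G' xs\<bar>
                \<le> real (length xs) * ((real CARD('k) + real (length xs)) * (1 / real M))"
          using lda_mass_grid_cover[OF assms(1) M] by blast
        let ?Z = "Pi\<^sub>E UNIV (\<lambda>_ :: 'k + 'k \<times> 'v. {..M})"
        have Z: "finite ?Z" "card ?Z = (M + 1) ^ D"
          by (auto simp: finite_PiE card_PiE D_def)
        have \<delta>: "real N * ((real CARD('k) + real N) * (1 / real M)) = \<delta>"
        proof -
          have "real N * (real CARD('k) + real N) \<noteq> 0" using N by simp
          moreover have "real M = (real N * (real CARD('k) + real N)) * (real L * real m)\<^sup>2"
            by (simp add: M_def \<kappa>_def power_mult_distrib)
          ultimately show ?thesis by (simp add: \<delta>_def power_divide)
        qed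
        have "sqrt \<delta> * real L = 1 / real m"
          using L m by (simp add: \<delta>_def)
        then have \<delta>': "sqrt \<delta> * real (card (documents N :: 'v list set)) \<le> 1 / real m"
          by (simp add: L_def)
        have Peq: "?P = (\<Pi>\<^sub>M i\<in>(UNIV :: nat set). point_measure (documents N) (\<lambda>x. ennreal (lda_mass \<alpha> G0 x)))"
          by (simp add: lda_measure_def)
        obtain E where E: "E \<in> sets ?P" "measure ?P E \<le> real (card ?Z) * exp (1 - real m * r\<^sup>2 / 2)"
          "\<And>X G. X \<in> space ?P - E \<Longrightarrow> G \<in> A \<Longrightarrow>
            (\<Prod>i<m. lda_mass \<alpha> G (X i)) \<le> exp (- (real m * r\<^sup>2)) * (\<Prod>i<m. lda_mass \<alpha> G0 (X i))"
        proof (rule likelihood_ratio_deviation[of "documents N" "lda_mass \<alpha> G0" A "lda_mass \<alpha>" r code ?Z \<delta> m, folded Peq])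
          show "finite (documents N :: 'v list set)" by (rule finite_documents)
          show "sum (lda_mass \<alpha> G0) (documents N) = 1" by (rule sum_lda_mass[OF assms(1) G0t])
          show "0 \<le> lda_mass \<alpha> G x" "sum (lda_mass \<alpha> G) (documents N) = 1" if "G \<in> A" for G x
            using that by (auto simp: A_def intro!: lda_mass_bounds sum_lda_mass assms(1) dest: over_mixing_topic)
          show "r \<le> hellinger_dist (documents N) (lda_mass \<alpha> G) (lda_mass \<alpha> G0)" if "G \<in> A" for G
            using that by (simp add: A_def)
          show "0 \<le> r" using C by (simp add: r_def)
          show "code ` A \<subseteq> ?Z" using code1 by (auto simp: A_def)
          show "\<bar>lda_mass \<alpha> G x - lda_mass \<alpha> G' x\<bar> \<le> \<delta>"
            if "G \<in> A" "G' \<in> A" "code G = code G'" "x \<in> documents N" for G G' x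
            using code2[of G G' x] that \<delta> by (simp add: A_def documents_def)
          show "0 \<le> \<delta>" by (simp add: \<delta>_def)
        qed (use p0 Z(1) \<delta>' m in auto)
        interpret prob_space ?P
        proof (intro prob_space_PiM prob_spaceI)
          have "(\<Sum>x\<in>documents N. ennreal (lda_mass \<alpha> G0 x)) = ennreal (\<Sum>x\<in>documents N. lda_mass \<alpha> G0 x)"
            by (intro sum_ennreal lda_mass_bounds[OF assms(1) G0t])
          then show "emeasure (lda_measure \<alpha> G0 N) (space (lda_measure \<alpha> G0 N)) = 1"
            by (simp add: lda_measure_def space_point_measure emeasure_point_measure_finite finite_documents
                sum_lda_mass[OF assms(1) G0t])
        qed
        have "W m \<subseteq> E"
        proof
          fix X assume X: "X \<in> W m"
          show "X \<in> E"
          proof (rule ccontr)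
            assume "X \<notin> E"
            with X have XE: "X \<in> space ?P - E" by (simp add: W_def)
            have Xdoc: "X i \<in> documents N" for i
              using XE by (auto simp: space_PiM lda_measure_def space_point_measure PiE_def Pi_def)
            have "\<bar>?post m X\<bar> \<le> 2 * exp (- (real m * r\<^sup>2)) / (b * (1 / real m) ^ d)"
            proof (rule posterior_le[OF assms(1) prob_space_mixing_prior[OF P] sets_mixing_prior Xdoc m p0 _ elim(1)])
              show "0 < b * (1 / real m) ^ d" using b(1) m by simp
              fix G assume "G \<in> over_mixing CARD('k)" "G \<in> B m"
              then have "G \<in> A" using B by (simp add: A_def r_def)
              then show "(\<Prod>i<m. lda_mass \<alpha> G (X i)) \<le> exp (- (real m * r\<^sup>2)) * (\<Prod>i<m. lda_mass \<alpha> G0 (X i))"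
                by (rule E(3)[OF XE])
            qed simp
            also have "\<dots> \<le> 2 * (1 / real m) ^ e / (b * (1 / real m) ^ d)"
              using tail2 b(1) m by (intro divide_right_mono mult_left_mono) auto
            also have "(1 / real m) ^ e = (1 / real m) ^ (2 * D + 1) * (1 / real m) ^ d"
              by (simp add: e_def power_add)
            also have "2 * ((1 / real m) ^ (2 * D + 1) * (1 / real m) ^ d) / (b * (1 / real m) ^ d)
                = 2 / b * (1 / real m) ^ (2 * D + 1)"
              using m by simp
            also have "\<dots> \<le> 2 / b * (1 / real m) ^ 1"
              using b(1) m by (intro mult_left_mono power_decreasing) auto
            also have "\<dots> < \<epsilon>" using elim(2) by simp
            finally show False using X by (simp add: W_def)
          qed
        qed
        then have "measure ?P (W m) \<le> measure ?P E"
          by (rule finite_measure_mono[OF _ E(1)])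
        also have "\<dots> \<le> real ((M + 1) ^ D) * exp (1 - real m * r\<^sup>2 / 2)"
          using E(2) unfolding Z(2) .
        also have "exp (1 - real m * r\<^sup>2 / 2) = exp 1 * exp (- (real e * ln (real (m * N))))"
          by (simp add: mr flip: exp_add)
        also have "real ((M + 1) ^ D) * (exp 1 * exp (- (real e * ln (real (m * N)))))
            \<le> (2 * real \<kappa> * (real m)\<^sup>2) ^ D * (exp 1 * (1 / real m) ^ e)"
        proof -
          have "M + 1 \<le> 2 * \<kappa> * m\<^sup>2" using M by (simp add: M_def)
          then have "real (M + 1) \<le> 2 * real \<kappa> * (real m)\<^sup>2"
            by (metis of_nat_le_iff of_nat_mult of_nat_numeral of_nat_power)
          then have "real (M + 1) ^ D \<le> (2 * real \<kappa> * (real m)\<^sup>2) ^ D"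
            by (intro power_mono) auto
          then show ?thesis using tail by (intro mult_mono) auto
        qed
        also have "\<dots> = (2 * real \<kappa>) ^ D * exp 1 * (1 / real m) ^ (1 + d)"
        proof -
          have "(real m)\<^sup>2 ^ D * (1 / real m) ^ (2 * D) = 1"
            using m by (simp add: power_mult power_one_over flip: power_mult_distrib)
          then show ?thesis
            by (simp add: e_def power_mult_distrib power_add algebra_simps)
        qed
        also have "\<dots> \<le> (2 * real \<kappa>) ^ D * exp 1 * (1 / real m) ^ 1"
          using m by (intro mult_left_mono power_decreasing) auto
        finally show ?case by (simp add: g_def)
      qed
      moreover have "g \<longlonglongrightarrow> 0"
      proof -
        have "g \<longlonglongrightarrow> (2 * real \<kappa>) ^ D * exp 1 * 0"
          unfolding g_def by (intro tendsto_mult tendsto_const lim_1_over_n)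
        then show ?thesis by simp
      qed
      ultimately have "(\<lambda>m. measure ?P (W m)) \<longlonglongrightarrow> 0"
        by (rule tendsto_sandwich[where f = "\<lambda>_. 0" and h = g, rotated 1, OF _ tendsto_const]) simp
      then show "(\<lambda>m. measure ?P {X \<in> space ?P. \<epsilon> < \<bar>?post m X\<bar>}) \<longlonglongrightarrow> 0"
        unfolding W_def .
    qed
  qed
qed

section \<open>From Hellinger to transport distance\<close>

lemma INF_enat_attained:
  assumes "(INF n\<in>S. enat n) \<le> enat N"
  obtains n where "n \<in> S" "(INF n\<in>S. enat n) = enat n"
proof -
  have "S \<noteq> {}" using assms by (auto simp: top_enat_def)
  then have "(INF n\<in>S. enat n) \<in> enat ` S" by (auto intro: wellorder_InfI)
  then show ?thesis using that by auto
qed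

lemma min_length1_attained:
  assumes "min_length1 \<alpha> G0 \<le> enat N"
  obtains n c where "min_length1 \<alpha> G0 = enat n" "0 < c"
    "\<And>G. G \<in> exact_mixing (card (set_pmf G0)) \<Longrightarrow>
        c * wasserstein 1 G G0 \<le> tv_dist (documents n) (lda_mass \<alpha> G0) (lda_mass \<alpha> G)"
proof -
  obtain n where "n \<in> {N. 1 \<le> N \<and> (\<exists>c>0. \<forall>G\<in>exact_mixing (card (set_pmf G0)).
        c * wasserstein 1 G G0 \<le> tv_dist (documents N) (lda_mass \<alpha> G0) (lda_mass \<alpha> G))}" "min_length1 \<alpha> G0 = enat n"
    using INF_enat_attained[OF assms[unfolded min_length1_def]] unfolding min_length1_def .
  then show ?thesis using that by blast
qed

lemma min_length2_attained:
  assumes "min_length2 \<alpha> G0 K \<le> enat N"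
  obtains n c where "min_length2 \<alpha> G0 K = enat n" "0 < c"
    "\<And>G. G \<in> over_mixing K \<Longrightarrow>
        c * (wasserstein 2 G G0)\<^sup>2 \<le> tv_dist (documents n) (lda_mass \<alpha> G0) (lda_mass \<alpha> G)"
proof -
  obtain n where "n \<in> {N. 1 \<le> N \<and> (\<exists>c>0. \<forall>G\<in>over_mixing K.
        c * (wasserstein 2 G G0)\<^sup>2 \<le> tv_dist (documents N) (lda_mass \<alpha> G0) (lda_mass \<alpha> G))}" "min_length2 \<alpha> G0 K = enat n"
    using INF_enat_attained[OF assms[unfolded min_length2_def]] unfolding min_length2_def .
  then show ?thesis using that by blast
qed

text \<open>Splitting atoms approximates a measure with fewer than \<open>K\<close> atoms by measures with exactly \<open>K\<close>
  atoms, and both sides of the inequality are continuous in the transport distance. A second point of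
  the simplex, needed to split atoms, is supplied by \<open>G0\<close>: it has \<open>K \<ge> 2\<close> atoms whenever there is
  something to prove.\<close>

lemma tv_dist_bound_over_mixing:
  fixes G0 :: "(real ^ 'v::finite) pmf"
  assumes "0 < \<alpha>" and G0: "G0 \<in> exact_mixing K" and "0 < c"
    and exact: "\<And>G. G \<in> exact_mixing K \<Longrightarrow> c * wasserstein 1 G G0 \<le> tv_dist (documents n) (lda_mass \<alpha> G0) (lda_mass \<alpha> G)"
    and G: "G \<in> over_mixing K"
  shows "c * wasserstein 1 G G0 \<le> tv_dist (documents n) (lda_mass \<alpha> G0) (lda_mass \<alpha> G)"
proof -
  obtain j where j: "1 \<le> j" "j \<le> K" "G \<in> exact_mixing j" using G by (auto simp: over_mixing_def)
  show ?thesis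
  proof (cases "j = K")
    case True
    then show ?thesis using exact j(3) by simp
  next
    case False
    then have K2: "2 \<le> K" using j by simp
    have S: "set_pmf G0 \<subseteq> prob_simplex" "card (set_pmf G0) = K" "finite (set_pmf G0)"
      using G0 by (auto simp: exact_mixing_def)
    have "\<not> is_singleton (set_pmf G0)" using S(2) K2 by (simp add: is_singleton_altdef)
    then obtain x y where xy: "x \<in> set_pmf G0" "y \<in> set_pmf G0" "x \<noteq> y"
      using set_pmf_not_empty[of G0] by (meson is_singletonI')
    define R where "R = real (card (documents n :: 'v list set)) * (real n)\<^sup>2 + c"
    have R: "0 < R" using assms(3) by (simp add: R_def add_nonneg_pos)
    show ?thesis
    proof (rule field_le_epsilon)
      fix e :: real assume e: "0 < e"
      obtain F where F: "F \<in> exact_mixing K" "wasserstein 1 G F \<le> e / R"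
        using exact_mixing_dense[OF j(3,2) _ _ xy(3), of "e / R"] xy S(1) e R by auto
      note top = exact_mixing_topic[OF j(3)] exact_mixing_topic[OF F(1)] exact_mixing_topic[OF G0]
      have "wasserstein 1 G G0 \<le> wasserstein 1 G F + wasserstein 1 F G0"
        using top by (intro wasserstein1_triangle) (auto simp: topic_mixing_def)
      then have "c * wasserstein 1 G G0 \<le> c * wasserstein 1 G F + c * wasserstein 1 F G0"
        using assms(3) by (simp flip: distrib_left)
      also have "\<dots> \<le> c * wasserstein 1 G F + tv_dist (documents n) (lda_mass \<alpha> G0) (lda_mass \<alpha> F)"
        using exact[OF F(1)] by simp
      also have "tv_dist (documents n) (lda_mass \<alpha> G0) (lda_mass \<alpha> F)
          \<le> tv_dist (documents n) (lda_mass \<alpha> G0) (lda_mass \<alpha> G)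
            + real (card (documents n :: 'v list set)) * (real n)\<^sup>2 * wasserstein 1 G F"
      proof -
        have "(\<Sum>xs\<in>documents n. \<bar>lda_mass \<alpha> G0 xs - lda_mass \<alpha> F xs\<bar>)
            \<le> (\<Sum>xs\<in>documents n. \<bar>lda_mass \<alpha> G0 xs - lda_mass \<alpha> G xs\<bar> + (real n)\<^sup>2 * wasserstein 1 G F)"
        proof (rule sum_mono)
          fix xs :: "'v list" assume "xs \<in> documents n"
          then have "\<bar>lda_mass \<alpha> G xs - lda_mass \<alpha> F xs\<bar> \<le> (real n)\<^sup>2 * wasserstein 1 G F"
            using lda_mass_diff_le_wasserstein1[OF assms(1) top(1,2), of xs] by (simp add: documents_def)
          then show "\<bar>lda_mass \<alpha> G0 xs - lda_mass \<alpha> F xs\<bar>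
              \<le> \<bar>lda_mass \<alpha> G0 xs - lda_mass \<alpha> G xs\<bar> + (real n)\<^sup>2 * wasserstein 1 G F" by linarith
        qed
        moreover have "0 \<le> real (card (documents n :: 'v list set)) * (real n)\<^sup>2 * wasserstein 1 G F"
          by (intro mult_nonneg_nonneg wasserstein1_nonneg) auto
        ultimately show ?thesis by (simp add: tv_dist_def sum.distrib)
      qed
      finally have "c * wasserstein 1 G G0
          \<le> tv_dist (documents n) (lda_mass \<alpha> G0) (lda_mass \<alpha> G) + R * wasserstein 1 G F"
        by (simp add: R_def algebra_simps)
      also have "R * wasserstein 1 G F \<le> e"
        using F(2) R by (simp add: pos_le_divide_eq mult.commute)
      finally show "c * wasserstein 1 G G0 \<le> tv_dist (documents n) (lda_mass \<alpha> G0) (lda_mass \<alpha> G) + e"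
        by simp
    qed
  qed
qed

theorem theorem3:
  fixes \<alpha> :: real
    and K0 K :: nat
    and w0 :: "nat \<Rightarrow> real"
    and \<theta>0 :: "nat \<Rightarrow> real ^ 'v::finite"
    and G0 :: "(real ^ 'v) pmf"
    and Pa :: "(real ^ 'k::finite) measure"
    and Pt :: "(real ^ 'v) measure"
    and num :: "'k \<Rightarrow> nat"
  assumes "0 < \<alpha>"
    and "\<And>k. 0 \<le> w0 k"
    and "\<And>k. K0 \<le> k \<Longrightarrow> w0 k = 0"
    and "(\<Sum>k<K0. w0 k) = 1"
    and "G0 = mixing_measure w0 \<theta>0"
    and "G0 \<in> exact_mixing K0"
    and "K0 \<le> K"
    and "CARD('k) = K"
    and "bij_betw num UNIV {..<K}"
    and "simplex_prob Pa"
    and "simplex_prob Pt"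
    and P1: "\<exists>c0>0. \<forall>k<K0. \<forall>v. c0 \<le> \<theta>0 k $ v"
    and P2_regular: "regular_prior Pa" "regular_prior Pt"
    and P2_support: "(\<chi> k. w0 (num k)) \<in> msupport Pa" "\<And>k. k < K0 \<Longrightarrow> \<theta>0 k \<in> msupport Pt"
  shows
    "(\<exists>C>0. \<forall>N\<ge>1.
       vanishes_in_prob (\<Pi>\<^sub>M i\<in>(UNIV :: nat set). lda_measure \<alpha> G0 N)
         (\<lambda>m X. posterior \<alpha> (mixing_prior Pa Pt) m X
            {G \<in> over_mixing K.
               C * (ln (real (m * N)) / real m) powr (1 / 2)
               \<le> hellinger_dist (documents N) (lda_mass \<alpha> G) (lda_mass \<alpha> G0)}))
     \<and> (K = K0 \<longrightarrow>
     (\<exists>C>0. \<forall>N\<ge>1. min_length1 \<alpha> G0 \<le> enat N \<longrightarrow>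
       vanishes_in_prob (\<Pi>\<^sub>M i\<in>(UNIV :: nat set). lda_measure \<alpha> G0 N)
         (\<lambda>m X. posterior \<alpha> (mixing_prior Pa Pt) m X
            {G \<in> over_mixing K0.
               C * (ln (real (m * N)) / real m) powr (1 / 2) \<le> wasserstein 1 G G0})))
     \<and> (K0 < K \<longrightarrow>
     (\<exists>C>0. \<forall>N\<ge>1. min_length2 \<alpha> G0 K \<le> enat N \<longrightarrow>
       vanishes_in_prob (\<Pi>\<^sub>M i\<in>(UNIV :: nat set). lda_measure \<alpha> G0 N)
         (\<lambda>m X. posterior \<alpha> (mixing_prior Pa Pt) m X
            {G \<in> over_mixing K.
               C * (ln (real (m * N)) / real m) powr (1 / 4) \<le> wasserstein 2 G G0})))"
proof -
  have K0: "0 < K0" using assms(4) by (cases K0) auto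
  have w0: "weights {..<K0} w0"
    using assms(2-4) by (auto simp: weights_def not_less)
  define a0 :: "real ^ 'k" where "a0 = (\<chi> k. w0 (num k))"
  \<comment> \<open>Spare labels carry no weight, but their topic must lie in the support of \<open>Pt\<close> and satisfy (P1).\<close>
  define t0 where "t0 k = (if num k < K0 then \<theta>0 (num k) else \<theta>0 0)" for k
  have a0: "a0 \<in> msupport Pa" unfolding a0_def by (rule P2_support(1))
  have t0: "t0 k \<in> msupport Pt" for k using P2_support(2) K0 by (simp add: t0_def)
  have G0: "G0 = mixing_measure (\<lambda>k. a0 $ k) t0"
    using mixing_measure_reindex[OF w0 assms(9,7), of t0 \<theta>0] assms(5) by (simp add: a0_def t0_def)
  obtain c0 where c0: "0 < c0" "\<And>k v. k < K0 \<Longrightarrow> c0 \<le> \<theta>0 k $ v" using P1 by blast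
  have c0': "c0 \<le> t0 k $ v" for k v using c0(2) K0 by (simp add: t0_def)
  obtain C where C: "0 < C"
    "\<And>N B. 1 \<le> N \<Longrightarrow>
      (\<And>m G. G \<in> B m \<Longrightarrow> G \<in> over_mixing K \<Longrightarrow>
        C * (ln (real (m * N)) / real m) powr (1 / 2)
          \<le> hellinger_dist (documents N) (lda_mass \<alpha> G) (lda_mass \<alpha> G0)) \<Longrightarrow>
      vanishes_in_prob (\<Pi>\<^sub>M i\<in>(UNIV :: nat set). lda_measure \<alpha> G0 N)
        (\<lambda>m X. posterior \<alpha> (mixing_prior Pa Pt) m X (B m))"
    using posterior_contraction_hellinger[OF assms(1,10,11) P2_regular a0 t0 G0 c0(1) c0']
    unfolding assms(8) by blast
  have G0t: "topic_mixing G0" using assms(6) by (rule exact_mixing_topic)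
  \<comment> \<open>A transport bound at length \<open>n\<close> gives Hellinger separation at every \<open>N \<ge> n\<close>, with the
    constant that belongs to \<open>n\<close>.\<close>
  have transfer: "C * \<rho> \<le> hellinger_dist (documents N) (lda_mass \<alpha> G) (lda_mass \<alpha> G0)"
    if c: "0 < c" and n: "n \<le> N" and G: "G \<in> over_mixing K"
      and bound: "c * x \<le> tv_dist (documents n) (lda_mass \<alpha> G0) (lda_mass \<alpha> G)"
      and x: "sqrt 2 * C / c * \<rho> \<le> x" for c n N G x \<rho>
  proof -
    note Gt = over_mixing_topic[OF G]
    have "sqrt 2 * (C * \<rho>) = c * (sqrt 2 * C / c * \<rho>)" using c by simp
    also have "\<dots> \<le> c * x" using x c by (intro mult_left_mono) auto
    also have "\<dots> \<le> tv_dist (documents N) (lda_mass \<alpha> G0) (lda_mass \<alpha> G)"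
      using bound tv_dist_mono[OF assms(1) G0t Gt n] by linarith
    also have "\<dots> \<le> sqrt 2 * hellinger_dist (documents N) (lda_mass \<alpha> G) (lda_mass \<alpha> G0)"
      by (rule tv_dist_lda_le_hellinger[OF assms(1) Gt G0t])
    finally show ?thesis by simp
  qed
  have part_a: "\<exists>C>0. \<forall>N\<ge>1.
       vanishes_in_prob (\<Pi>\<^sub>M i\<in>(UNIV :: nat set). lda_measure \<alpha> G0 N)
         (\<lambda>m X. posterior \<alpha> (mixing_prior Pa Pt) m X
            {G \<in> over_mixing K.
               C * (ln (real (m * N)) / real m) powr (1 / 2)
               \<le> hellinger_dist (documents N) (lda_mass \<alpha> G) (lda_mass \<alpha> G0)})"
  proof (intro exI[of _ C] conjI allI impI C(1))
    fix N :: nat assume "1 \<le> N"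
    then show "vanishes_in_prob (\<Pi>\<^sub>M i\<in>(UNIV :: nat set). lda_measure \<alpha> G0 N)
         (\<lambda>m X. posterior \<alpha> (mixing_prior Pa Pt) m X
            {G \<in> over_mixing K.
               C * (ln (real (m * N)) / real m) powr (1 / 2)
               \<le> hellinger_dist (documents N) (lda_mass \<alpha> G) (lda_mass \<alpha> G0)})"
      by (rule C(2)) blast
  qed
  have part_b: "\<exists>C>0. \<forall>N\<ge>1. min_length1 \<alpha> G0 \<le> enat N \<longrightarrow>
       vanishes_in_prob (\<Pi>\<^sub>M i\<in>(UNIV :: nat set). lda_measure \<alpha> G0 N)
         (\<lambda>m X. posterior \<alpha> (mixing_prior Pa Pt) m X
            {G \<in> over_mixing K0.
               C * (ln (real (m * N)) / real m) powr (1 / 2) \<le> wasserstein 1 G G0})" if K: "K = K0"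
  proof (cases "\<exists>N. min_length1 \<alpha> G0 \<le> enat N")
    case True
    then obtain N' where "min_length1 \<alpha> G0 \<le> enat N'" by blast
    then obtain n c where n: "min_length1 \<alpha> G0 = enat n" and c: "0 < c"
      and exact: "\<And>G. G \<in> exact_mixing (card (set_pmf G0)) \<Longrightarrow>
        c * wasserstein 1 G G0 \<le> tv_dist (documents n) (lda_mass \<alpha> G0) (lda_mass \<alpha> G)"
      using min_length1_attained by blast
    have "card (set_pmf G0) = K0" using assms(6) by (simp add: exact_mixing_def)
    note bound = tv_dist_bound_over_mixing[OF assms(1,6) c exact[unfolded this]]
    show ?thesis
    proof (intro exI[of _ "sqrt 2 * C / c"] conjI allI impI)
      show "0 < sqrt 2 * C / c" using C(1) c by simp
      fix N :: nat assume N: "1 \<le> N" "min_length1 \<alpha> G0 \<le> enat N"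
      then have nN: "n \<le> N" by (simp add: n)
      show "vanishes_in_prob (\<Pi>\<^sub>M i\<in>(UNIV :: nat set). lda_measure \<alpha> G0 N)
         (\<lambda>m X. posterior \<alpha> (mixing_prior Pa Pt) m X
            {G \<in> over_mixing K0.
               sqrt 2 * C / c * (ln (real (m * N)) / real m) powr (1 / 2) \<le> wasserstein 1 G G0})"
      proof (rule C(2)[OF N(1)])
        fix m G assume "G \<in> {G \<in> over_mixing K0.
          sqrt 2 * C / c * (ln (real (m * N)) / real m) powr (1 / 2) \<le> wasserstein 1 G G0}"
        then have "G \<in> over_mixing K0"
          and "sqrt 2 * C / c * (ln (real (m * N)) / real m) powr (1 / 2) \<le> wasserstein 1 G G0" by blast+
        then show "C * (ln (real (m * N)) / real m) powr (1 / 2)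
            \<le> hellinger_dist (documents N) (lda_mass \<alpha> G) (lda_mass \<alpha> G0)"
          using bound K by (intro transfer[OF c nN]) blast+
      qed
    qed
  next
    case False
    then show ?thesis by (intro exI[of _ 1]) auto
  qed
  have part_c: "\<exists>C>0. \<forall>N\<ge>1. min_length2 \<alpha> G0 K \<le> enat N \<longrightarrow>
       vanishes_in_prob (\<Pi>\<^sub>M i\<in>(UNIV :: nat set). lda_measure \<alpha> G0 N)
         (\<lambda>m X. posterior \<alpha> (mixing_prior Pa Pt) m X
            {G \<in> over_mixing K.
               C * (ln (real (m * N)) / real m) powr (1 / 4) \<le> wasserstein 2 G G0})"
  proof (cases "\<exists>N. min_length2 \<alpha> G0 K \<le> enat N")
    case True
    then obtain N' where "min_length2 \<alpha> G0 K \<le> enat N'" by blast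
    then obtain n c where n: "min_length2 \<alpha> G0 K = enat n" and c: "0 < c"
      and bound: "\<And>G. G \<in> over_mixing K \<Longrightarrow>
        c * (wasserstein 2 G G0)\<^sup>2 \<le> tv_dist (documents n) (lda_mass \<alpha> G0) (lda_mass \<alpha> G)"
      using min_length2_attained by blast
    let ?C = "sqrt (sqrt 2 * C / c)"
    show ?thesis
    proof (intro exI[of _ ?C] conjI allI impI)
      show "0 < ?C" using C(1) c by simp
      fix N :: nat assume N: "1 \<le> N" "min_length2 \<alpha> G0 K \<le> enat N"
      then have nN: "n \<le> N" by (simp add: n)
      show "vanishes_in_prob (\<Pi>\<^sub>M i\<in>(UNIV :: nat set). lda_measure \<alpha> G0 N)
         (\<lambda>m X. posterior \<alpha> (mixing_prior Pa Pt) m X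
            {G \<in> over_mixing K. ?C * (ln (real (m * N)) / real m) powr (1 / 4) \<le> wasserstein 2 G G0})"
      proof (rule C(2)[OF N(1)])
        fix m G assume G: "G \<in> {G \<in> over_mixing K.
          ?C * (ln (real (m * N)) / real m) powr (1 / 4) \<le> wasserstein 2 G G0}"
        let ?x = "ln (real (m * N)) / real m"
        have "(?C * ?x powr (1 / 4))\<^sup>2 = sqrt 2 * C / c * ?x powr (1 / 2)"
          using C(1) c by (simp only: power_mult_distrib power2_eq_square[of "_ powr _"] powr_add[symmetric]) simp
        moreover have "(?C * ?x powr (1 / 4))\<^sup>2 \<le> (wasserstein 2 G G0)\<^sup>2"
          using G C(1) c by (intro power_mono) auto
        ultimately have "sqrt 2 * C / c * ?x powr (1 / 2) \<le> (wasserstein 2 G G0)\<^sup>2" by simp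
        then show "C * ?x powr (1 / 2)
            \<le> hellinger_dist (documents N) (lda_mass \<alpha> G) (lda_mass \<alpha> G0)"
          using bound G by (intro transfer[OF c nN]) blast+
      qed
    qed
  next
    case False
    then show ?thesis by (intro exI[of _ 1]) auto
  qed
  show ?thesis
    using part_a part_b part_c by blast
qed

end
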